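(* Let $0<p_1\le p_2<\infty$, $0<\theta\le\infty$, $v_1,v_2\in\mathcal W(\mathbb{R}^n)$ and $\omega\in\Omega_\theta$. Write $J:=\|\mathrm{Id}\|_{LM_{p_2\theta,\omega}(\mathbb{R}^n,v_2)\to L_{p_1}(\mathbb{R}^n,v_1)}$ and $s:=\frac{p_1p_2}{p_2-p_1}$ (with $s=\infty$ when $p_1=p_2$). (a) If $0<\theta\le p_1\le p_2<\infty$, then, uniformly in $\omega\in\Omega_\theta$, $$J\approx\sup_{t>0}\|\omega\|_{\theta,(t,\infty)}^{-1}\big\|v_1^{1/p_1}v_2^{-1/p_2}\big\|_{s,{}^cB(0,t)}.$$ (b) If $0<p_1\le p_2<\infty$ and $p_1<\theta\le\infty$, then, with $\rho:=\frac{p_1\theta}{\theta-p_1}$ ($\rho=p_1$ when $\theta=\infty$), uniformly in $\omega\in\Omega_\theta$, $$J\approx\Big(\int_{(0,\infty)}\big\|v_1^{1/p_1}v_2^{-1/p_2}\big\|_{s,{}^cB(0,t)}^{\rho}\,d\Big(\|\omega\|_{\theta,(t-,\infty)}^{-\rho}\Big)\Big)^{1/\rho}+\|\omega\|_{\theta,(0,\infty)}^{-1}\big\|v_1^{1/p_1}v_2^{-1/p_2}\big\|_{s,\mathbb{R}^n}.$$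
   Context: $B(0,r)$ is the open ball of radius $r$ centered at $0$ in $\mathbb{R}^n$; ${}^cB(0,r):=\mathbb{R}^n\setminus B(0,r)$. For measurable $A$, $0<p\le\infty$, measurable $w\ge0$: $\|f\|_{p,A,w}:=(\int_A|f|^pw)^{1/p}$ if $p<\infty$, $\operatorname{ess\,sup}_A|f|w$ if $p=\infty$; $\|f\|_{p,A}:=\|f\|_{p,A,1}$. $\mathcal W(\mathbb{R}^n)$: measurable functions positive and finite a.e. Conventions $0/0=0$, $0\cdot(\pm\infty)=0$, $1/(\pm\infty)=0$. $L_p(\mathbb{R}^n,v)=\{f:\|f\|_{p,\mathbb{R}^n,v}<\infty\}$. $LM_{p\theta,\omega}(\mathbb{R}^n,v)$ is the set of $f\in L^{\mathrm{loc}}_{p,v}(\mathbb{R}^n)$ with $\|f\|_{LM}:=\big\|\omega(r)\|f\|_{p,B(0,r),v}\big\|_{\theta,(0,\infty)}<\infty$. $\Omega_\theta$: measurable $\omega\ge0$ on $(0,\infty)$ with $0<\|\omega\|_{\theta,(t,\infty)}<\infty$ for all $t>0$. $\|\mathrm{Id}\|_{X\to Y}:=\sup_{f\in X, f\not\sim0}\|f\|_Y/\|f\|_X\in[0,\infty]$. $\|\omega\|_{\theta,(t-,\infty)}:=\lim_{s\to t-}\|\omega\|_{\theta,(s,\infty)}$; the integral is the Lebesgue–Stieltjes integral with respect to the non-decreasing, left-continuous function $t\mapsto\|\omega\|_{\theta,(t-,\infty)}^{-\rho}$ (i.e. w.r.t. the Borel measure $\lambda$ with $\lambda([\alpha,\beta))=h(\beta)-h(\alpha)$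 for $h$ this function). "Uniformly in $\omega$" means the constants in $\approx$ may depend on $n,p_1,p_2,\theta,v_1,v_2$ but not on $\omega$. *)

theory Defs
  imports "HOL-Analysis.Analysis" "HOL-Probability.Essential_Supremum"
begin

definition epowr :: "ennreal \<Rightarrow> real \<Rightarrow> ennreal" where
  "epowr x r =
     (if x = top then (if r > 0 then top else if r < 0 then 0 else 1)
      else if x = 0 then (if r > 0 then 0 else if r < 0 then top else 1)
      else ennreal (enn2real x powr r))"

definition Lnorm :: "'a measure \<Rightarrow> ennreal \<Rightarrow> 'a set \<Rightarrow> ('a \<Rightarrow> ennreal) \<Rightarrow> ennreal" where
  "Lnorm M p A g =
     (if p = top then esssup M (\<lambda>x. g x * indicator A x)
      else epowr (\<integral>\<^sup>+ x \<in> A. epowr (g x) (enn2real p) \<partial>M) (1 / enn2real p))"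

definition wnorm :: "'a measure \<Rightarrow> ennreal \<Rightarrow> 'a set \<Rightarrow> ('a \<Rightarrow> real) \<Rightarrow> ('a \<Rightarrow> real) \<Rightarrow> ennreal" where
  "wnorm M p A w f =
     (if p = top then esssup M (\<lambda>x. ennreal (\<bar>f x\<bar> * w x) * indicator A x)
      else epowr (\<integral>\<^sup>+ x \<in> A. ennreal (\<bar>f x\<bar> powr (enn2real p) * w x) \<partial>M) (1 / enn2real p))"

definition Wclass :: "('a::euclidean_space \<Rightarrow> real) set" where
  "Wclass = {v. v \<in> borel_measurable lebesgue \<and> (AE x in lebesgue. v x > 0)}"

definition Omega :: "ennreal \<Rightarrow> (real \<Rightarrow> real) set" where
  "Omega \<theta> = {\<omega>. \<omega> \<in> borel_measurable (restrict_space lebesgue {0<..}) \<and> (\<forall>t>0. \<omega> t \<ge> 0) \<and>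
     (\<forall>t>0. 0 < Lnorm lebesgue \<theta> {t<..} (\<lambda>r. ennreal (\<omega> r)) \<and>
            Lnorm lebesgue \<theta> {t<..} (\<lambda>r. ennreal (\<omega> r)) < top)}"

definition Lloc :: "ennreal \<Rightarrow> ('a::euclidean_space \<Rightarrow> real) \<Rightarrow> ('a \<Rightarrow> real) set" where
  "Lloc p v = {f. f \<in> borel_measurable lebesgue \<and> (\<forall>K. compact K \<longrightarrow> wnorm lebesgue p K v f < top)}"

definition LMnorm :: "ennreal \<Rightarrow> ennreal \<Rightarrow> (real \<Rightarrow> real) \<Rightarrow> ('a::euclidean_space \<Rightarrow> real) \<Rightarrow> ('a \<Rightarrow> real) \<Rightarrow> ennreal" where
  "LMnorm p \<theta> \<omega> v f = Lnorm lebesgue \<theta> {0<..} (\<lambda>r. ennreal (\<omega> r) * wnorm lebesgue p (ball 0 r) v f)"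

definition LM :: "ennreal \<Rightarrow> ennreal \<Rightarrow> (real \<Rightarrow> real) \<Rightarrow> ('a::euclidean_space \<Rightarrow> real) \<Rightarrow> ('a \<Rightarrow> real) set" where
  "LM p \<theta> \<omega> v = {f \<in> Lloc p v. LMnorm p \<theta> \<omega> v f < top}"

definition embnorm :: "ennreal \<Rightarrow> ennreal \<Rightarrow> ennreal \<Rightarrow> (real \<Rightarrow> real) \<Rightarrow> ('a::euclidean_space \<Rightarrow> real)
     \<Rightarrow> ('a \<Rightarrow> real) \<Rightarrow> ennreal" where
  "embnorm p2 \<theta> p1 \<omega> v2 v1 =
     (SUP f \<in> {f \<in> LM p2 \<theta> \<omega> v2. \<not> (AE x in lebesgue. f x = 0)}.
        wnorm lebesgue p1 UNIV v1 f / LMnorm p2 \<theta> \<omega> v2 f)"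

text \<open>Lebesgue--Stieltjes measure \<lambda> on R of a non-decreasing left-continuous h,
  with \<lambda>([a,b)) = h b - h a: reflect the right-continuous function u \<mapsto> - h (-u).\<close>
definition ls_measure :: "(real \<Rightarrow> real) \<Rightarrow> real measure" where
  "ls_measure h = distr (interval_measure (\<lambda>u. - h (- u))) borel uminus"

text \<open>h t = (norm of omega over (t-,infinity)) to the power -rho; norms are taken over
  subsets of (0,infinity), so for t <= 0 h is constant, equal to the value for (0,infinity).\<close>
definition hfun :: "ennreal \<Rightarrow> real \<Rightarrow> (real \<Rightarrow> real) \<Rightarrow> real \<Rightarrow> real" where
  "hfun \<theta> \<rho> \<omega> t =
     enn2real (epowr (Lim (at_left t) (\<lambda>s. Lnorm lebesgue \<theta> ({s<..} \<inter> {0<..}) (\<lambda>r. ennreal (\<omega> r)))) (- \<rho>))"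

end

theory Submission
  imports Defs
begin

text \<open>
  With \<open>W = v\<^sub>1\<^bsup>1/p\<^sub>1\<^esup> v\<^sub>2\<^bsup>-1/p\<^sub>2\<^esup>\<close>, Hoelder's inequality and its sharpness say that \<open>\<parallel>W\<parallel>\<^sub>s\<close> on a set \<open>X\<close>
  is the best constant of the embedding of the weighted \<open>L\<close>-spaces over \<open>X\<close>, so everything reduces to
  the radial function \<open>G t = \<parallel>W\<parallel>\<^sub>s\<close> over the complement of \<open>B(0,t)\<close> and to \<open>S t = \<parallel>\<omega>\<parallel>\<close> over \<open>(t,\<infinity>)\<close>.
  Cut \<open>[0,\<infinity>)\<close> into the dyadic levels \<open>A i\<close> on which \<open>2\<^bsup>-i-1\<^esup> < S \<le> 2\<^bsup>-i\<^esup>\<close>.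

  Upper bounds: on the shell over \<open>A i\<close> use the local embedding. The mass of \<open>f\<close> in that shell times
  \<open>2\<^bsup>-i\<^esup>\<close> is controlled by the part of the Morrey norm carried by \<open>A i \<union> A (i + 1)\<close>, while
  \<open>2\<^sup>i G\<close> is controlled by the Stieltjes integral over \<open>A (i - 1) \<union> A i\<close>; sum over \<open>i\<close> with
  \<open>\<ell>\<^sup>\<theta> \<subseteq> \<ell>\<^bsup>p\<^sub>1\<^esup>\<close> in case (a) and with Hoelder's inequality in case (b).

  Lower bounds: (a) tests with one function supported outside a ball; (b) tests with
  \<open>(\<Sum>\<^sub>i c\<^sub>i \<bar>g\<^sub>i\<bar>\<^bsup>p\<^sub>1\<^esup>)\<^bsup>1/p\<^sub>1\<^esup>\<close>, where \<open>g\<^sub>i\<close> is almost extremal over the union of the levels \<open>\<ge> i\<close>.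
  Taking this \<open>p\<^sub>1\<close>-sum rather than disjointly supported pieces makes the left-hand side additive in \<open>i\<close>,
  and Jensen's inequality still bounds the \<open>L\<^bsub>p\<^sub>2\<^esub>\<close>-norm on \<open>B(0,r)\<close> by \<open>(\<Sum>\<^sub>i c\<^sub>i)\<^bsup>1/p\<^sub>1\<^esup>\<close> over the levels met.
\<close>

section \<open>Powers of extended nonnegative reals\<close>

lemma epowr_ennreal: "0 < x \<Longrightarrow> epowr (ennreal x) r = ennreal (x powr r)"
  by (auto simp: epowr_def)

lemma epowr_ennreal_nonneg: "0 \<le> x \<Longrightarrow> 0 < r \<Longrightarrow> epowr (ennreal x) r = ennreal (x powr r)"
  by (auto simp: epowr_def)

lemma epowr_0 [simp]: "0 < r \<Longrightarrow> epowr 0 r = 0"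
  by (simp add: epowr_def)

lemma epowr_top [simp]: "0 < r \<Longrightarrow> epowr top r = top"
  by (simp add: epowr_def)

lemma epowr_zero_exponent [simp]: "epowr x 0 = 1"
  by (cases x) (auto simp: epowr_def)

lemma epowr_one_exponent [simp]: "epowr x 1 = x"
  by (cases x) (auto simp: epowr_def)

lemma epowr_one [simp]: "epowr 1 r = 1"
  by (auto simp: epowr_def)

lemma epowr_eq_0_iff: "0 < r \<Longrightarrow> epowr x r = 0 \<longleftrightarrow> x = 0"
  by (cases x) (auto simp: epowr_def)

lemma epowr_eq_top_iff: "0 < r \<Longrightarrow> epowr x r = top \<longleftrightarrow> x = top"
  by (cases x) (auto simp: epowr_def)

lemma epowr_less_top_iff: "0 < r \<Longrightarrow> epowr x r < top \<longleftrightarrow> x < top"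
  by (metis epowr_eq_top_iff top.not_eq_extremum)

lemma epowr_mono: "0 \<le> r \<Longrightarrow> x \<le> y \<Longrightarrow> epowr x r \<le> epowr y r"
  by (cases x; cases y) (auto simp: epowr_def top_unique powr_mono2 intro!: ennreal_leI)

lemma epowr_mult: "0 < r \<Longrightarrow> epowr (x * y) r = epowr x r * epowr y r"
  by (cases x; cases y) (auto simp: epowr_def ennreal_mult_top ennreal_top_mult powr_mult ennreal_mult
    simp flip: ennreal_mult)

lemma epowr_epowr: "a \<noteq> 0 \<Longrightarrow> b \<noteq> 0 \<Longrightarrow> epowr (epowr x a) b = epowr x (a * b)"
  by (cases x) (auto simp: epowr_def powr_powr mult_less_0_iff zero_less_mult_iff)

lemma epowr_inverse [simp]: "r \<noteq> 0 \<Longrightarrow> epowr (epowr x r) (1 / r) = x" "r \<noteq> 0 \<Longrightarrow> epowr (epowr x (1 / r)) r = x"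
  by (simp_all add: epowr_epowr)

lemma epowr_add: "0 < a \<Longrightarrow> 0 \<le> b \<Longrightarrow> epowr x (a + b) = epowr x a * epowr x b"
  by (cases x) (auto simp: epowr_def powr_add ennreal_mult ennreal_mult_top ennreal_top_mult)

lemma epowr_le_iff: "0 < r \<Longrightarrow> epowr x r \<le> epowr y r \<longleftrightarrow> x \<le> y"
  by (metis epowr_inverse(1) epowr_mono less_eq_real_def order_less_irrefl zero_le_divide_1_iff)

lemma epowr_le_swap: "0 < r \<Longrightarrow> epowr x r \<le> y \<longleftrightarrow> x \<le> epowr y (1 / r)"
  by (metis epowr_inverse(2) epowr_le_iff less_irrefl)

lemma epowr_less_iff: "0 < r \<Longrightarrow> epowr x r < epowr y r \<longleftrightarrow> x < y"
  by (meson epowr_le_iff linorder_not_le)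

lemma measurable_epowr [measurable (raw)]:
  assumes [measurable]: "f \<in> borel_measurable M"
  shows "(\<lambda>x. epowr (f x) r) \<in> borel_measurable M"
  unfolding epowr_def by measurable

section \<open>Inequalities for integrals and series with values in [0, infinity]\<close>

lemma weighted_Young:
  assumes ab: "0 < a" "0 < b" "a + b = 1"
  shows "epowr x a * epowr y b \<le> ennreal a * x + ennreal b * y"
proof (cases "x = 0 \<or> y = 0 \<or> x = top \<or> y = top")
  case True
  then show ?thesis using ab by (auto simp: ennreal_mult_top)
next
  case False
  then obtain x' y' where xy: "x = ennreal x'" "y = ennreal y'" "0 < x'" "0 < y'"
    by (metis ennreal_cases ennreal_0 order_le_less)
  then show ?thesis
    using Youngs_inequality_0[of a b x' y'] ab
    by (simp add: epowr_ennreal flip: ennreal_mult ennreal_plus)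
qed

text \<open>If one integral vanishes, its integrand vanishes almost everywhere and so does the
  product; this case is settled first because the right-hand side may then be
  \<open>0 * top = 0\<close>. If one integral is infinite and none is zero, the right-hand side is
  \<open>top\<close>. Otherwise both functions are divided by their integrals and
  \<open>weighted_Young\<close> is integrated.\<close>

lemma nn_integral_Hoelder:
  assumes ab: "0 < a" "0 < b" "a + b = 1"
    and [measurable]: "f \<in> borel_measurable M" "g \<in> borel_measurable M"
  shows "(\<integral>\<^sup>+x. epowr (f x) a * epowr (g x) b \<partial>M)
           \<le> epowr (\<integral>\<^sup>+x. f x \<partial>M) a * epowr (\<integral>\<^sup>+x. g x \<partial>M) b" (is "?L \<le> epowr ?F a * epowr ?G b")
proof -
  have z: "?L = 0" if "?F = 0 \<or> ?G = 0"
  proof -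
    have "AE x in M. epowr (f x) a * epowr (g x) b = 0"
      using that
    proof
      assume "?F = 0"
      then have "AE x in M. f x = 0" by (simp add: nn_integral_0_iff_AE)
      then show ?thesis using ab by (auto elim!: eventually_mono)
    next
      assume "?G = 0"
      then have "AE x in M. g x = 0" by (simp add: nn_integral_0_iff_AE)
      then show ?thesis using ab by (auto elim!: eventually_mono)
    qed
    then show ?thesis by (simp add: nn_integral_0_iff_AE)
  qed
  consider "?F = 0 \<or> ?G = 0" | "?F \<noteq> 0" "?G \<noteq> 0" "?F = top \<or> ?G = top"
    | "?F \<noteq> 0" "?G \<noteq> 0" "?F \<noteq> top" "?G \<noteq> top" by blast
  then show ?thesis
  proof cases
    case 1 then show ?thesis using z by simp
  next
    case 2
    then have "epowr ?F a * epowr ?G b = top"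
      using ab by (auto simp: ennreal_mult_top ennreal_top_mult epowr_eq_0_iff)
    then show ?thesis by simp
  next
    case 3
    define F G where "F = ?F" and "G = ?G"
    have FG: "F \<noteq> 0" "G \<noteq> 0" "F \<noteq> top" "G \<noteq> top" using 3 by (auto simp: F_def G_def)
    have id: "x = F * (x / F)" for x
      using FG by (metis ennreal_mult_divide_eq ennreal_times_divide mult.commute)
    have id': "x = G * (x / G)" for x
      using FG by (metis ennreal_mult_divide_eq ennreal_times_divide mult.commute)
    have "?L \<le> (\<integral>\<^sup>+x. (epowr F a * epowr G b) * (ennreal a * (f x / F) + ennreal b * (g x / G)) \<partial>M)"
    proof (rule nn_integral_mono)
      fix x
      have "epowr (f x) a * epowr (g x) b = (epowr F a * epowr G b) * (epowr (f x / F) a * epowr (g x / G) b)"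
        using ab by (subst id, subst id') (simp add: epowr_mult mult_ac)
      also have "\<dots> \<le> (epowr F a * epowr G b) * (ennreal a * (f x / F) + ennreal b * (g x / G))"
        by (intro mult_left_mono weighted_Young ab) auto
      finally show "epowr (f x) a * epowr (g x) b \<le> \<dots>" .
    qed
    also have "\<dots> = (epowr F a * epowr G b) * (ennreal a * (F / F) + ennreal b * (G / G))"
      by (simp add: nn_integral_cmult nn_integral_add nn_integral_divide F_def G_def)
    also have "\<dots> = epowr F a * epowr G b"
      using FG ab by (simp add: ennreal_divide_self top.not_eq_extremum flip: ennreal_plus)
    finally show ?thesis by (simp add: F_def G_def)
  qed
qed

lemma suminf_Hoelder:
  fixes x y :: "nat \<Rightarrow> ennreal"
  assumes "0 < a" "0 < b" "a + b = 1"
  shows "(\<Sum>n. epowr (x n) a * epowr (y n) b) \<le> epowr (\<Sum>n. x n) a * epowr (\<Sum>n. y n) b"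
  using nn_integral_Hoelder[OF assms, of x "count_space UNIV" y]
  by (simp add: nn_integral_count_space_nat)

text \<open>Every term is at most the total \<open>T\<close>, so \<open>epowr (y n) r\<close> is at
  most \<open>y n\<close> times the power \<open>r - 1\<close> of \<open>T\<close>. This inclusion
  of sequence spaces serves the case of \<open>\<theta>\<close> at most \<open>p1\<close>, with
  \<open>r = p1 / \<theta>\<close>.\<close>

lemma suminf_epowr_le:
  fixes y :: "nat \<Rightarrow> ennreal"
  assumes "1 \<le> r"
  shows "(\<Sum>n. epowr (y n) r) \<le> epowr (\<Sum>n. y n) r"
proof -
  define T where "T = (\<Sum>n. y n)"
  have "epowr (y n) r \<le> y n * epowr T (r - 1)" for n
  proof -
    have "y n \<le> T"
      using sum_le_suminf[of y "{n}"] by (simp add: T_def)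
    moreover have "epowr (y n) r = y n * epowr (y n) (r - 1)"
      using assms epowr_add[of 1 "r - 1" "y n"] by simp
    ultimately show ?thesis using assms
      by (simp add: epowr_mono mult_left_mono)
  qed
  then have "(\<Sum>n. epowr (y n) r) \<le> (\<Sum>n. y n * epowr T (r - 1))"
    by (intro suminf_le) auto
  also have "\<dots> = T * epowr T (r - 1)" by (simp add: T_def)
  also have "\<dots> = epowr T r" using assms epowr_add[of 1 "r - 1" T] by simp
  finally show ?thesis by (simp add: T_def)
qed

section \<open>Monotone families of sets\<close>

lemma nn_integral_UN_incseq_le:
  assumes [measurable]: "f \<in> borel_measurable M" "\<And>n::nat. X n \<in> sets M"
    and X: "incseq X" and le: "\<And>n. (\<integral>\<^sup>+x\<in>X n. f x \<partial>M) \<le> K"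
  shows "(\<integral>\<^sup>+x\<in>(\<Union>n. X n). f x \<partial>M) \<le> K"
proof -
  have "f x * indicator (\<Union>n. X n) x = (SUP n. f x * indicator (X n) x)" for x
    by (auto simp: indicator_def SUP_upper intro!: antisym SUP_least
        intro: SUP_upper2 split: if_splits)
  moreover have "incseq (\<lambda>n x. f x * indicator (X n) x)"
    using X by (auto simp: incseq_def le_fun_def indicator_def)
  ultimately have "(\<integral>\<^sup>+x\<in>(\<Union>n. X n). f x \<partial>M) = (SUP n. \<integral>\<^sup>+x\<in>X n. f x \<partial>M)"
    by (simp add: nn_integral_monotone_convergence_SUP)
  then show ?thesis using le by (simp add: SUP_least)
qed

text \<open>Lets a union over uncountably many radii be replaced by a countable monotone one,
  whether or not \<open>A\<close> is bounded or has a maximum. Without a maximum, each rational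
  below some element selects an element above it, and \<open>t\<close> takes running maxima of
  these.\<close>

lemma incseq_cofinal:
  fixes A :: "real set"
  assumes "A \<noteq> {}"
  obtains t :: "nat \<Rightarrow> real" where "incseq t" "\<And>n. t n \<in> A" "\<And>a. a \<in> A \<Longrightarrow> \<exists>n. a \<le> t n"
proof (cases "\<exists>m\<in>A. \<forall>a\<in>A. a \<le> m")
  case True
  then obtain m where "m \<in> A" "\<forall>a\<in>A. a \<le> m" by blast
  then show ?thesis using that[of "\<lambda>_. m"] by auto
next
  case False
  obtain a0 where a0: "a0 \<in> A" using assms by blast
  obtain Q :: "nat \<Rightarrow> rat" where Q: "surj Q"
    using surj_from_nat[where 'a=rat] by blast
  define c where "c = (\<lambda>n. if \<exists>a\<in>A. of_rat (Q n) < a then (SOME a. a \<in> A \<and> of_rat (Q n) < a) else a0)"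
  have cA: "c n \<in> A" for n
    unfolding c_def using a0 someI_ex[of "\<lambda>a. a \<in> A \<and> of_rat (Q n) < a"] by auto
  have cQ: "of_rat (Q n) < c n" if "\<exists>a\<in>A. of_rat (Q n) < a" for n
    unfolding c_def using that someI_ex[of "\<lambda>a. a \<in> A \<and> of_rat (Q n) < a"] by auto
  define t where "t = (\<lambda>n. Max (c ` {..n}))"
  show ?thesis
  proof
    show "incseq t" unfolding t_def incseq_def by (auto intro!: Max_mono)
    show "t n \<in> A" for n
      unfolding t_def using Max_in[of "c ` {..n}"] cA
      by (metis atMost_iff finite_atMost finite_imageI image_is_empty image_iff empty_iff order_refl)
    fix a assume "a \<in> A"
    with False obtain a' where "a' \<in> A" "a < a'" by force
    then obtain r where r: "a < of_rat r" "of_rat r < a'" using of_rat_dense by blast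
    obtain n where n: "r = Q n" using Q by blast
    have "a \<le> c n" using cQ[of n] r \<open>a' \<in> A\<close> by (fastforce simp: n)
    also have "c n \<le> t n" unfolding t_def by simp
    finally show "\<exists>n. a \<le> t n" by blast
  qed
qed

lemma decseq_cofinal:
  fixes A :: "real set"
  assumes "A \<noteq> {}"
  obtains t :: "nat \<Rightarrow> real" where "decseq t" "\<And>n. t n \<in> A" "\<And>a. a \<in> A \<Longrightarrow> \<exists>n. t n \<le> a"
proof -
  obtain t :: "nat \<Rightarrow> real" where t: "incseq t" "\<And>n. t n \<in> uminus ` A" "\<And>a. a \<in> uminus ` A \<Longrightarrow> \<exists>n. a \<le> t n"
    using incseq_cofinal[of "uminus ` A"] assms by blast
  show ?thesis
  proof (rule that[of "\<lambda>n. - t n"])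
    show "decseq (\<lambda>n. - t n)" using t(1) by (simp add: incseq_def decseq_def)
    show "- t n \<in> A" for n using t(2)[of n] by auto
    show "\<exists>n. - t n \<le> a" if "a \<in> A" for a
      using t(3)[of "- a"] that by (metis imageI minus_le_iff)
  qed
qed

lemma up_closed_borel:
  fixes A :: "real set"
  assumes "\<And>s t. s \<in> A \<Longrightarrow> s \<le> t \<Longrightarrow> t \<in> A"
  shows "A \<in> sets borel"
proof (cases "A = {}")
  case False
  then obtain t where t: "decseq t" "\<And>n::nat. t n \<in> A" "\<And>a. a \<in> A \<Longrightarrow> \<exists>n. t n \<le> a"
    using decseq_cofinal by blast
  then have "A = (\<Union>n. {t n..})" using assms by auto
  then show ?thesis by simp
qed simp

lemma borel_measurable_mono_real:
  fixes f :: "real \<Rightarrow> 'b::{linorder_topology, second_countable_topology}"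
  assumes "mono f" shows "f \<in> borel_measurable borel"
  using assms by (intro borel_measurableI_greater) (auto simp: mono_def intro!: up_closed_borel intro: less_le_trans)

lemma borel_measurable_antimono_real:
  fixes f :: "real \<Rightarrow> 'b::{linorder_topology, second_countable_topology}"
  assumes "antimono f" shows "f \<in> borel_measurable borel"
  using assms by (intro borel_measurableI_less) (auto simp: antimono_def intro!: up_closed_borel intro: le_less_trans)

section \<open>The best constant of the local embedding\<close>

text \<open>The integral is kept without the outer root so that it is additive over disjoint sets
  and can be summed over shells.\<close>

definition wint :: "real \<Rightarrow> ('a::euclidean_space \<Rightarrow> real) \<Rightarrow> ('a \<Rightarrow> real) \<Rightarrow> 'a set \<Rightarrow> ennreal" where
  "wint p v f X = (\<integral>\<^sup>+x\<in>X. ennreal (\<bar>f x\<bar> powr p * v x) \<partial>lebesgue)"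

lemma wnorm_eq_wint: "0 < p \<Longrightarrow> wnorm lebesgue (ennreal p) X v f = epowr (wint p v f X) (1 / p)"
  by (simp add: wnorm_def wint_def)

lemma wint_mono: "X \<subseteq> Y \<Longrightarrow> wint p v f X \<le> wint p v f Y"
  unfolding wint_def by (intro nn_integral_mono) (auto simp: indicator_def)

lemma measurable_ident_lebesgue [measurable]: "(\<lambda>x. x) \<in> borel_measurable lebesgue"
  by (rule measurable_completion) simp

locale weight_pair =
  fixes p1 p2 :: real and v1 v2 :: "'a::euclidean_space \<Rightarrow> real"
  assumes p1_pos: "0 < p1" and p12: "p1 \<le> p2"
    and v1: "v1 \<in> Wclass" and v2: "v2 \<in> Wclass"
begin

definition q :: real where "q = p1 / p2"

definition s :: ennreal where "s = (if p1 = p2 then top else ennreal (p1 * p2 / (p2 - p1)))"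

definition u :: "'a \<Rightarrow> real" where "u = (\<lambda>x. v1 x powr (1 / p1) * v2 x powr (- 1 / p2))"

text \<open>The weight of this norm is constantly 1 and \<open>u\<close> is the function measured.
  \<open>MM_le\<close> and \<open>MM_sharp\<close> identify \<open>U X\<close> as the best constant
  when \<open>MM\<close> to the power \<open>1 / p1\<close> is bounded by \<open>II\<close> to the
  power \<open>1 / p2\<close> on \<open>X\<close>.\<close>

definition U :: "'a set \<Rightarrow> ennreal" where "U X = wnorm lebesgue s X (\<lambda>_. 1) u"

abbreviation MM :: "('a \<Rightarrow> real) \<Rightarrow> 'a set \<Rightarrow> ennreal" where "MM \<equiv> wint p1 v1"
abbreviation II :: "('a \<Rightarrow> real) \<Rightarrow> 'a set \<Rightarrow> ennreal" where "II \<equiv> wint p2 v2"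

lemma p2_pos: "0 < p2" using p1_pos p12 by simp

lemma q_pos: "0 < q" and q_le_1: "q \<le> 1"
  using p1_pos p12 by (simp_all add: q_def)

lemma v_measurable [measurable]: "v1 \<in> borel_measurable lebesgue" "v2 \<in> borel_measurable lebesgue"
  using v1 v2 by (simp_all add: Wclass_def)

lemma v_pos: "AE x in lebesgue. 0 < v1 x \<and> 0 < v2 x"
  using v1 v2 by (auto simp: Wclass_def)

lemma u_measurable [measurable]: "u \<in> borel_measurable lebesgue"
  unfolding u_def by measurable

lemma u_nonneg: "0 \<le> u x" by (simp add: u_def)

lemma u_powr: "0 < v1 x \<Longrightarrow> 0 < v2 x \<Longrightarrow> u x powr p1 = v1 x * v2 x powr (- q)"
  using p1_pos p2_pos by (simp add: u_def powr_mult powr_powr q_def)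

lemma u_powr_eq:
  assumes "p1 = p2" "0 < v1 x" "0 < v2 x"
  shows "u x powr p1 * v2 x = v1 x"
proof -
  have "q = 1" using p2_pos by (subst q_def) (simp add: assms)
  then show ?thesis using u_powr[OF assms(2,3)] assms(3) by (simp add: powr_minus field_simps)
qed

lemma U_top: "p1 = p2 \<Longrightarrow> U X = esssup lebesgue (\<lambda>x. ennreal (u x) * indicator X x)"
proof -
  assume "p1 = p2"
  then have "s = top" unfolding s_def by (rule if_P)
  then show ?thesis by (simp add: U_def wnorm_def u_nonneg)
qed

text \<open>Here \<open>s = p1 / (1 - q)\<close>, so the power \<open>p1\<close> turns the outer
  root \<open>1 / s\<close> into \<open>1 - q\<close>, the second of the two Hoelder exponents
  \<open>q\<close> and \<open>1 - q\<close>.\<close>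

lemma U_finite:
  assumes "p1 < p2"
  shows "epowr (U X) p1 = epowr (\<integral>\<^sup>+x\<in>X. ennreal (u x powr (p1 / (1 - q))) \<partial>lebesgue) (1 - q)"
proof -
  have *: "p1 * p2 / (p2 - p1) = p1 / (1 - q)" "p1 / (1 - q) > 0" "1 - q > 0"
    using assms p1_pos p2_pos by (auto simp: q_def field_simps)
  have "enn2real s = p1 / (1 - q)" using assms * by (simp add: s_def)
  moreover have "s \<noteq> top" using assms by (simp add: s_def)
  ultimately show ?thesis
    using * p1_pos by (simp add: U_def wnorm_def u_nonneg epowr_epowr)
qed

text \<open>Hoelder's inequality with exponents \<open>q\<close> and \<open>1 - q\<close>: almost
  everywhere the integrand of \<open>MM\<close> is the \<open>q\<close>-th power of that of
  \<open>II\<close> times the \<open>(1 - q)\<close>-th power of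
  \<open>u x powr (p1 / (1 - q))\<close>. For \<open>p1 = p2\<close> the second factor degenerates
  and is bounded pointwise by the essential supremum of \<open>u\<close>.\<close>

lemma MM_le:
  assumes [measurable]: "f \<in> borel_measurable lebesgue" "X \<in> sets lebesgue"
  shows "MM f X \<le> epowr (U X) p1 * epowr (II f X) q"
proof (cases "p1 = p2")
  case True
  have [simp]: "q = 1" using p2_pos by (subst q_def) (simp add: True)
  have "MM f X \<le> (\<integral>\<^sup>+x. epowr (U X) p1 * (ennreal (\<bar>f x\<bar> powr p2 * v2 x) * indicator X x) \<partial>lebesgue)"
    unfolding wint_def
  proof (rule nn_integral_mono_AE)
    have "AE x in lebesgue. ennreal (u x) * indicator X x \<le> U X"
      unfolding U_top[OF True] by (rule esssup_AE)
    with v_pos show "AE x in lebesgue. ennreal (\<bar>f x\<bar> powr p1 * v1 x) * indicator X x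
      \<le> epowr (U X) p1 * (ennreal (\<bar>f x\<bar> powr p2 * v2 x) * indicator X x)"
    proof eventually_elim
      case (elim x)
      show ?case
      proof (cases "x \<in> X")
        case x: True
        have "ennreal (u x powr p1) \<le> epowr (U X) p1"
          using elim x p1_pos epowr_mono[of p1 "ennreal (u x)" "U X"]
          by (simp add: epowr_ennreal_nonneg u_nonneg)
        then have "ennreal (u x powr p1) * ennreal (\<bar>f x\<bar> powr p2 * v2 x)
           \<le> epowr (U X) p1 * ennreal (\<bar>f x\<bar> powr p2 * v2 x)"
          by (rule mult_right_mono) simp
        also have "ennreal (u x powr p1) * ennreal (\<bar>f x\<bar> powr p2 * v2 x) = ennreal (\<bar>f x\<bar> powr p1 * v1 x)"
        proof -
          have "v1 x = u x powr p1 * v2 x"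
            using elim u_powr_eq[OF True] by simp
          then have "\<bar>f x\<bar> powr p1 * v1 x = u x powr p1 * (\<bar>f x\<bar> powr p2 * v2 x)" by (simp add: True)
          then show ?thesis using elim by (simp flip: ennreal_mult)
        qed
        finally show ?thesis using x by simp
      qed simp
    qed
  qed
  also have "\<dots> = epowr (U X) p1 * II f X"
    unfolding wint_def by (rule nn_integral_cmult) simp
  finally show ?thesis by simp
next
  case False
  with p12 have lt: "p1 < p2" by simp
  then have q: "0 < q" "0 < 1 - q" using q_pos p2_pos by (auto simp: q_def)
  have "MM f X \<le> (\<integral>\<^sup>+x. epowr (ennreal (\<bar>f x\<bar> powr p2 * v2 x) * indicator X x) q
      * epowr (ennreal (u x powr (p1 / (1 - q))) * indicator X x) (1 - q) \<partial>lebesgue)"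
    unfolding wint_def
  proof (rule nn_integral_mono_AE)
    from v_pos show "AE x in lebesgue. ennreal (\<bar>f x\<bar> powr p1 * v1 x) * indicator X x
      \<le> epowr (ennreal (\<bar>f x\<bar> powr p2 * v2 x) * indicator X x) q
      * epowr (ennreal (u x powr (p1 / (1 - q))) * indicator X x) (1 - q)"
    proof eventually_elim
      case (elim x)
      have "(\<bar>f x\<bar> powr p2 * v2 x) powr q * (u x powr (p1 / (1 - q))) powr (1 - q)
          = \<bar>f x\<bar> powr p1 * (v2 x powr q * u x powr p1)"
        using elim q p2_pos by (simp add: powr_mult powr_powr q_def)
      also have "\<dots> = \<bar>f x\<bar> powr p1 * v1 x"
        using elim by (simp add: u_powr powr_minus field_simps)
      finally show ?case
        using elim q by (cases "x \<in> X") (auto simp: epowr_ennreal_nonneg simp flip: ennreal_mult)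
    qed
  qed
  also have "\<dots> \<le> epowr (II f X) q * epowr (\<integral>\<^sup>+x\<in>X. ennreal (u x powr (p1 / (1 - q))) \<partial>lebesgue) (1 - q)"
    unfolding wint_def by (rule nn_integral_Hoelder) (use q in auto)
  finally show ?thesis using U_finite[OF lt] by (simp add: mult.commute)
qed

text \<open>Truncation to a set \<open>Z n\<close> of finite measure reaches any number below the
  best constant, even when \<open>U X\<close> is infinite. For \<open>p1 < p2\<close> the function
  is the equality case of Hoelder's inequality on \<open>Z n\<close>; for \<open>p1 = p2\<close> it
  makes the integrand of \<open>II\<close> constant on a set where \<open>u\<close> exceeds a number
  \<open>k\<close> below its essential supremum.\<close>

lemma MM_sharp:
  assumes X[measurable]: "X \<in> sets lebesgue" and \<kappa>: "\<kappa> < epowr (U X) p1"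
  obtains f where "f \<in> borel_measurable lebesgue" "\<And>x. x \<notin> X \<Longrightarrow> f x = 0" "II f UNIV \<le> 1" "\<kappa> < MM f UNIV"
proof (cases "p1 = p2")
  case True
  \<comment> \<open>The margin between \<open>\<kappa>\<close> and \<open>\<kappa>'\<close> supplies
    the strict inequality at the end, where \<open>\<kappa>'\<close> is only bounded by the
    integral.\<close>
  obtain \<kappa>' where \<kappa>': "\<kappa> < \<kappa>'" "\<kappa>' < epowr (U X) p1" using dense[OF \<kappa>] by blast
  define k where "k = epowr \<kappa>' (1 / p1)"
  have "k < U X"
    using \<kappa>' p1_pos unfolding k_def by (metis epowr_less_iff epowr_inverse(1) less_irrefl zero_less_divide_1_iff)
  define Z where "Z = (\<lambda>n::nat. {x \<in> X. norm x \<le> n \<and> k < ennreal (u x) \<and> 0 < v1 x \<and> 0 < v2 x})"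
  have Z[measurable]: "Z n \<in> sets lebesgue" for n unfolding Z_def by measurable
  have "\<exists>n. emeasure lebesgue (Z n) \<noteq> 0"
  proof (rule ccontr)
    assume "\<nexists>n. emeasure lebesgue (Z n) \<noteq> 0"
    then have "Z n \<in> null_sets lebesgue" for n by (auto simp: null_sets_def)
    then have "(\<Union>n. Z n) \<in> null_sets lebesgue" by (intro null_sets_UN') auto
    from AE_not_in[OF this] v_pos have "AE x in lebesgue. ennreal (u x) * indicator X x \<le> k"
    proof eventually_elim
      case (elim x)
      then have "x \<notin> Z (nat \<lceil>norm x\<rceil>)" by blast
      with elim show ?case by (auto simp: Z_def indicator_def not_less)
    qed
    then have "U X \<le> k" unfolding U_top[OF True] by (intro esssup_I) auto
    with \<open>k < U X\<close> show False by simp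
  qed
  then obtain n where n: "emeasure lebesgue (Z n) \<noteq> 0" by blast
  have "emeasure lebesgue (Z n) \<le> emeasure lebesgue (cball (0::'a) n)"
    by (intro emeasure_mono) (auto simp: Z_def)
  also have "\<dots> < \<infinity>" using fmeasurableD2[OF lmeasurable_cball[of "0::'a" n]] by (simp add: top.not_eq_extremum)
  finally obtain m where m: "emeasure lebesgue (Z n) = ennreal m" "0 < m"
    using n by (cases "emeasure lebesgue (Z n)") (auto simp: less_le)
  \<comment> \<open>With this choice the integrand of \<open>II\<close> equals \<open>1 / m\<close>
    on \<open>Z n\<close>, a set of measure \<open>m\<close>.\<close>
  define f where "f = (\<lambda>x. if x \<in> Z n then (1 / (m * v2 x)) powr (1 / p2) else 0)"
  show ?thesis
  proof
    show [measurable]: "f \<in> borel_measurable lebesgue" unfolding f_def by measurable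
    show "f x = 0" if "x \<notin> X" for x using that by (simp add: f_def Z_def)
    have "II f UNIV = (\<integral>\<^sup>+x. ennreal (1 / m) * indicator (Z n) x \<partial>lebesgue)"
      unfolding wint_def
      using m p2_pos by (intro nn_integral_cong) (auto simp: f_def powr_powr Z_def field_simps indicator_def)
    also have "\<dots> = 1" using m by (simp add: nn_integral_cmult_indicator flip: ennreal_mult)
    finally show "II f UNIV \<le> 1" by simp
    have "\<kappa>' = \<kappa>' * ennreal (1 / m) * emeasure lebesgue (Z n)"
      unfolding m using m(2) by (simp add: mult.assoc flip: ennreal_mult)
    also have "\<dots> = (\<integral>\<^sup>+x. \<kappa>' * ennreal (1 / m) * indicator (Z n) x \<partial>lebesgue)"
      by (rule nn_integral_cmult_indicator[symmetric]) (rule Z)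
    also have "\<dots> \<le> MM f UNIV"
      unfolding wint_def
    proof (rule nn_integral_mono)
      fix x
      show "\<kappa>' * ennreal (1 / m) * indicator (Z n) x \<le> ennreal (\<bar>f x\<bar> powr p1 * v1 x) * indicator UNIV x"
      proof (cases "x \<in> Z n")
        case x: True
        then have pos: "0 < v1 x" "0 < v2 x" and "k < ennreal (u x)" by (auto simp: Z_def)
        then have "\<kappa>' \<le> ennreal (u x powr p1)"
          using p1_pos epowr_mono[of p1 k "ennreal (u x)"]
          by (simp add: k_def epowr_ennreal_nonneg u_nonneg)
        then have "\<kappa>' * ennreal (1 / m) \<le> ennreal (u x powr p1) * ennreal (1 / m)"
          by (rule mult_right_mono) simp
        also have "\<dots> = ennreal (\<bar>f x\<bar> powr p1 * v1 x)"
        proof -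
          have "v1 x = u x powr p1 * v2 x"
            using pos u_powr_eq[OF True pos] by simp
          moreover have "\<bar>f x\<bar> powr p1 = 1 / (m * v2 x)"
            using x pos m p1_pos by (simp add: f_def powr_powr True)
          ultimately show ?thesis using pos m by (simp flip: ennreal_mult)
        qed
        finally show ?thesis using x by simp
      qed (simp add: f_def)
    qed
    finally show "\<kappa> < MM f UNIV" using \<kappa>' by simp
  qed
next
  case False
  with p12 have lt: "p1 < p2" by simp
  then have q: "0 < q" "0 < 1 - q" using q_pos p2_pos by (auto simp: q_def)
  define r where "r = p1 / (1 - q)"
  \<comment> \<open>The bound on the norm makes the measure of \<open>Z n\<close> finite and the
    bound on \<open>u\<close> makes the integral over it finite; up to a null set these sets exhaust
    \<open>X\<close>.\<close>
  define Z where "Z = (\<lambda>n::nat. {x \<in> X. norm x \<le> n \<and> u x \<le> n \<and> 0 < v1 x \<and> 0 < v2 x})"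
  have Z[measurable]: "Z n \<in> sets lebesgue" for n unfolding Z_def by measurable
  have "\<exists>n. epowr \<kappa> (1 / (1 - q)) < (\<integral>\<^sup>+x\<in>Z n. ennreal (u x powr r) \<partial>lebesgue)"
  proof (rule ccontr)
    assume "\<not> ?thesis"
    then have "(\<integral>\<^sup>+x\<in>Z n. ennreal (u x powr r) \<partial>lebesgue) \<le> epowr \<kappa> (1 / (1 - q))" for n
      by (simp add: not_less)
    then have "(\<integral>\<^sup>+x\<in>(\<Union>n. Z n). ennreal (u x powr r) \<partial>lebesgue) \<le> epowr \<kappa> (1 / (1 - q))"
      by (intro nn_integral_UN_incseq_le) (auto simp: incseq_def Z_def)
    moreover have "(\<integral>\<^sup>+x\<in>X. ennreal (u x powr r) \<partial>lebesgue) \<le> (\<integral>\<^sup>+x\<in>(\<Union>n. Z n). ennreal (u x powr r) \<partial>lebesgue)"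
    proof (rule nn_integral_mono_AE)
      from v_pos show "AE x in lebesgue. ennreal (u x powr r) * indicator X x \<le> ennreal (u x powr r) * indicator (\<Union>n. Z n) x"
      proof eventually_elim
        case (elim x)
        have "x \<in> Z (nat \<lceil>max (norm x) (u x)\<rceil>)" if "x \<in> X"
          using that elim by (simp add: Z_def le_nat_iff) linarith
        then show ?case by (auto simp: indicator_def)
      qed
    qed
    ultimately have "epowr (U X) p1 \<le> \<kappa>"
      using U_finite[OF lt, of X] q by (simp add: r_def epowr_le_swap)
    with \<kappa> show False by simp
  qed
  then obtain n where n: "epowr \<kappa> (1 / (1 - q)) < (\<integral>\<^sup>+x\<in>Z n. ennreal (u x powr r) \<partial>lebesgue)" (is "_ < ?T") by blast
  have "?T \<le> (\<integral>\<^sup>+x. ennreal (real n powr r) * indicator (cball (0::'a) n) x \<partial>lebesgue)"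
    using q p1_pos
    by (intro nn_integral_mono) (auto simp: Z_def indicator_def r_def u_nonneg intro!: ennreal_leI powr_mono2)
  also have "\<dots> < \<infinity>"
    using fmeasurableD2[OF lmeasurable_cball[of "0::'a" n]]
    by (simp add: nn_integral_cmult_indicator ennreal_mult_less_top top.not_eq_extremum)
  finally have "?T < \<infinity>" .
  moreover have "0 < ?T" using n by (rule le_less_trans[rotated]) simp
  ultimately obtain T where T: "?T = ennreal T" "0 < T"
    by (cases ?T) auto
  \<comment> \<open>The two factors of Hoelder's inequality become proportional: on
    \<open>Z n\<close> the integrand of \<open>II\<close> is \<open>u x powr r / T\<close>, with
    total 1, and \<open>r * q + p1 = r\<close> makes that of \<open>MM\<close> equal to
    \<open>u x powr r\<close> times \<open>T powr (- q)\<close>.\<close>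
  define f where "f = (\<lambda>x. if x \<in> Z n then (u x powr r / (T * v2 x)) powr (1 / p2) else 0)"
  show ?thesis
  proof
    show [measurable]: "f \<in> borel_measurable lebesgue" unfolding f_def by measurable
    show "f x = 0" if "x \<notin> X" for x using that by (simp add: f_def Z_def)
    have "II f UNIV = (\<integral>\<^sup>+x. ennreal (1 / T) * (ennreal (u x powr r) * indicator (Z n) x) \<partial>lebesgue)"
      unfolding wint_def
      using T p2_pos by (intro nn_integral_cong) (auto simp: f_def powr_powr Z_def field_simps indicator_def simp flip: ennreal_mult)
    also have "\<dots> = 1" using T by (subst nn_integral_cmult) (simp_all flip: ennreal_mult)
    finally show "II f UNIV \<le> 1" by simp
    have "MM f UNIV = (\<integral>\<^sup>+x. ennreal (T powr (- q)) * (ennreal (u x powr r) * indicator (Z n) x) \<partial>lebesgue)"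
      unfolding wint_def
    proof (rule nn_integral_cong)
      fix x
      show "ennreal (\<bar>f x\<bar> powr p1 * v1 x) * indicator UNIV x = ennreal (T powr (- q)) * (ennreal (u x powr r) * indicator (Z n) x)"
      proof (cases "x \<in> Z n")
        case x: True
        then have pos: "0 < v1 x" "0 < v2 x" by (auto simp: Z_def)
        then have upos: "0 < u x" by (simp add: u_def)
        have e: "p1 * r / p2 = r * q" by (simp add: q_def)
        have "\<bar>f x\<bar> powr p1 * v1 x = u x powr (r * q) * T powr (- q) * (v1 x * v2 x powr (- q))"
          using x pos T p2_pos by (simp add: f_def powr_powr powr_mult powr_divide powr_minus field_simps e flip: q_def)
        also have "v1 x * v2 x powr (- q) = u x powr p1" using u_powr[OF pos] by simp
        also have "u x powr (r * q) * T powr (- q) * u x powr p1 = T powr (- q) * u x powr (r * q + p1)"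
          by (simp add: powr_add)
        also have "r * q + p1 = r" using q by (simp add: r_def field_simps)
        finally show ?thesis using x by (simp flip: ennreal_mult)
      qed (simp add: f_def)
    qed
    also have "\<dots> = ennreal (T powr (- q)) * ennreal T"
      by (subst nn_integral_cmult) (use T in simp_all)
    also have "\<dots> = ennreal (T powr (1 - q))"
      using T by (simp add: powr_diff powr_minus field_simps flip: ennreal_mult)
    also have "\<dots> = epowr ?T (1 - q)" using T by (simp add: epowr_ennreal)
    also have "\<kappa> < \<dots>"
      using n q by (metis epowr_less_iff epowr_inverse(2) less_irrefl)
    finally show "\<kappa> < MM f UNIV" .
  qed
qed

text \<open>Contrapositive of \<open>MM_sharp\<close>. It turns bounds on \<open>U\<close> into
  inequalities for test functions, so that finite and infinite \<open>s\<close> are treated alike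
  from here on.\<close>

lemma U_leI:
  assumes "X \<in> sets lebesgue"
    and "\<And>f. f \<in> borel_measurable lebesgue \<Longrightarrow> (\<And>x. x \<notin> X \<Longrightarrow> f x = 0) \<Longrightarrow> II f UNIV \<le> 1 \<Longrightarrow> MM f UNIV \<le> epowr K p1"
  shows "U X \<le> K"
proof (rule ccontr)
  assume "\<not> ?thesis"
  then have "epowr K p1 < epowr (U X) p1" using p1_pos by (simp add: epowr_less_iff)
  from MM_sharp[OF assms(1) this] assms(2) show False by (metis linorder_not_le)
qed

text \<open>Monotone convergence for the test functions of \<open>U_leI\<close>: on each
  \<open>X n\<close> the embedding holds with constant \<open>K\<close>, and what \<open>Y\<close>
  has outside the union is null. This covers infinite \<open>s\<close> too, where \<open>U\<close>
  is an essential supremum.\<close>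

lemma U_UN_le:
  assumes X [measurable]: "\<And>n::nat. X n \<in> sets lebesgue" and Y [measurable]: "Y \<in> sets lebesgue"
    and inc: "incseq X" and sub: "Y - (\<Union>n. X n) \<in> null_sets lebesgue"
    and le: "\<And>n. U (X n) \<le> K"
  shows "U Y \<le> K"
proof (rule U_leI[OF Y])
  fix f :: "'a \<Rightarrow> real" assume f [measurable]: "f \<in> borel_measurable lebesgue"
    and 0: "\<And>x. x \<notin> Y \<Longrightarrow> f x = 0" and 1: "II f UNIV \<le> 1"
  have "MM f UNIV \<le> MM f (\<Union>n. X n)"
    unfolding wint_def using AE_not_in[OF sub]
    by (intro nn_integral_mono_AE, eventually_elim) (use 0 in \<open>auto simp: indicator_def\<close>)
  also have "\<dots> \<le> epowr K p1"
    unfolding wint_def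
  proof (rule nn_integral_UN_incseq_le[OF _ X inc])
    fix n
    have "MM f (X n) \<le> epowr (U (X n)) p1 * epowr (II f (X n)) q" by (rule MM_le) auto
    also have "\<dots> \<le> epowr K p1 * epowr 1 q"
      using p1_pos q_pos 1 wint_mono[of "X n" UNIV p2 v2 f] le
      by (intro mult_mono epowr_mono) auto
    finally show "(\<integral>\<^sup>+x\<in>X n. ennreal (\<bar>f x\<bar> powr p1 * v1 x) \<partial>lebesgue) \<le> epowr K p1"
      by (simp add: wint_def)
  qed simp
  finally show "MM f UNIV \<le> epowr K p1" .
qed

lemma U_mono:
  assumes [measurable]: "X \<in> sets lebesgue" "Y \<in> sets lebesgue" and "X \<subseteq> Y"
  shows "U X \<le> U Y"
  using assms by (intro U_UN_le[of "\<lambda>_. Y" X]) (auto simp: incseq_def Diff_eq_empty_iff[THEN iffD2])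

end

section \<open>The weight on the half-line\<close>

text \<open>The power with exponent \<open>- r\<close> reverses the order of [0, infinity],
  exchanges 0 and \<open>top\<close>, and has the power with exponent \<open>- (1 / r)\<close> as
  its inverse.\<close>

lemma epowr_minus_swap:
  assumes "0 < r" shows "epowr x (- r) \<le> y \<longleftrightarrow> epowr y (- (1 / r)) \<le> x"
proof -
  have *: "epowr y (- (1 / r)) \<le> x" if "epowr x (- r) \<le> y" "0 < r" for x y r
  proof (cases "x = 0 \<or> x = top \<or> y = 0 \<or> y = top")
    case True
    then show ?thesis using that by (cases x; cases y) (auto simp: epowr_def top_unique split: if_splits)
  next
    case False
    then obtain a b where ab: "x = ennreal a" "y = ennreal b" "0 < a" "0 < b"
      by (metis ennreal_cases ennreal_0 order_le_less)
    then have "a powr (- r) \<le> b" using that by (simp add: epowr_ennreal)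
    then have "b powr (- (1 / r)) \<le> (a powr (- r)) powr (- (1 / r))"
      using that ab by (intro powr_mono2') auto
    also have "\<dots> = a" using that ab by (simp add: powr_powr)
    finally show ?thesis using ab by (simp add: epowr_ennreal ennreal_leI)
  qed
  show ?thesis using *[of x r y] *[of y "1 / r" x] assms by auto
qed

section \<open>Comparison of norms and exhaustion by tails\<close>

lemma Lnorm_mono_AE:
  assumes p: "0 < p" and meas: "(\<lambda>x. f x * indicator A x) \<in> borel_measurable M"
    and le: "AE x in M. f x * indicator A x \<le> g x * indicator B x"
  shows "Lnorm M p A f \<le> Lnorm M p B g"
proof (cases "p = top")
  case True
  then show ?thesis using meas le by (auto simp: Lnorm_def intro!: esssup_AE_mono)
next
  case False
  then have p: "0 < enn2real p" using p by (simp add: enn2real_positive_iff top.not_eq_extremum)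
  have *: "epowr (f x) (enn2real p) * indicator A x = epowr (f x * indicator A x) (enn2real p)"
    for f :: "'a \<Rightarrow> ennreal" and A x
    using p by (auto simp: indicator_def)
  have "(\<integral>\<^sup>+x\<in>A. epowr (f x) (enn2real p) \<partial>M) \<le> (\<integral>\<^sup>+x\<in>B. epowr (g x) (enn2real p) \<partial>M)"
    unfolding * using le p by (intro nn_integral_mono_AE) (auto elim!: eventually_mono intro: epowr_mono)
  then show ?thesis using False p by (auto simp: Lnorm_def intro!: epowr_mono)
qed

lemma Lnorm_cmult:
  assumes [measurable]: "f \<in> borel_measurable M" "A \<in> sets M" and "c \<noteq> top" and p: "0 < p"
  shows "c * Lnorm M p A f \<le> Lnorm M p A (\<lambda>x. c * f x)"
proof (cases "p = top")
  case True
  show ?thesis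
  proof (cases "c = 0")
    case False
    have "esssup M (\<lambda>x. f x * indicator A x) \<le> esssup M (\<lambda>x. c * f x * indicator A x) / c"
    proof (rule esssup_I)
      show "AE x in M. f x * indicator A x \<le> esssup M (\<lambda>x. c * f x * indicator A x) / c"
        using esssup_AE[of "\<lambda>x. c * f x * indicator A x" M]
      proof eventually_elim
        case (elim x)
        then have "c * (f x * indicator A x) / c \<le> esssup M (\<lambda>x. c * f x * indicator A x) / c"
          by (intro divide_right_mono_ennreal) (simp add: mult.assoc)
        then show ?case using False assms(3) by (metis ennreal_mult_divide_eq mult.commute)
      qed
    qed measurable
    then have "c * Lnorm M p A f \<le> c * (Lnorm M p A (\<lambda>x. c * f x) / c)"
      using True by (intro mult_left_mono) (auto simp: Lnorm_def)
    then show ?thesis using False assms(3)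
      by (metis ennreal_mult_divide_eq ennreal_times_divide mult.commute)
  qed simp
next
  case False
  then have p: "0 < enn2real p" using p by (simp add: enn2real_positive_iff top.not_eq_extremum)
  have "(\<integral>\<^sup>+x\<in>A. epowr (c * f x) (enn2real p) \<partial>M) = (\<integral>\<^sup>+x. epowr c (enn2real p) * (epowr (f x) (enn2real p) * indicator A x) \<partial>M)"
    using p by (simp add: epowr_mult mult.assoc)
  also have "\<dots> = epowr c (enn2real p) * (\<integral>\<^sup>+x\<in>A. epowr (f x) (enn2real p) \<partial>M)"
    by (rule nn_integral_cmult) measurable
  finally show ?thesis using p False by (simp add: Lnorm_def epowr_mult)
qed

text \<open>The tails are nested, so a decreasing cofinal sequence in \<open>T\<close> exhausts
  their union; monotone convergence then applies for finite \<open>p\<close>, and a countable union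
  of null sets for \<open>p = top\<close>. If \<open>T\<close> is empty, \<open>A\<close> itself is
  null.\<close>

lemma Lnorm_tail_union_le:
  fixes f :: "real \<Rightarrow> ennreal"
  assumes p: "0 < p"
    and [measurable]: "f \<in> borel_measurable lebesgue" "A \<in> sets borel"
    and null: "A - (\<Union>t\<in>T. {t<..}) \<in> null_sets lebesgue"
    and le: "\<And>t. t \<in> T \<Longrightarrow> Lnorm lebesgue p {t<..} f \<le> K"
  shows "Lnorm lebesgue p A f \<le> K"
proof (cases "T = {}")
  case True
  then have "AE x in lebesgue. x \<notin> A" using null by (auto dest: AE_not_in)
  then have "AE x in lebesgue. f x * indicator A x = 0" "AE x in lebesgue. epowr (f x) (enn2real p) * indicator A x = 0"
    by (auto elim!: eventually_mono)
  moreover from this(2) have "(\<integral>\<^sup>+x\<in>A. epowr (f x) (enn2real p) \<partial>lebesgue) = 0"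
    by (subst nn_integral_0_iff_AE) simp_all
  ultimately show ?thesis
    using p by (auto simp: Lnorm_def enn2real_positive_iff top.not_eq_extremum intro!: esssup_I elim!: eventually_mono)
next
  case False
  from decseq_cofinal[OF False] obtain t where t: "decseq t" "\<And>n::nat. t n \<in> T" "\<And>a. a \<in> T \<Longrightarrow> \<exists>n. t n \<le> a"
    by blast
  have "(\<Union>t\<in>T. {t<..}) \<subseteq> (\<Union>n. {t n<..})"
    by auto (meson t(3) le_less_trans)
  then have "A - (\<Union>n. {t n<..}) \<in> null_sets lebesgue"
    by (intro null_sets_subset[OF null]) auto
  note ae = AE_not_in[OF this]
  have [measurable]: "A \<in> sets lebesgue" by simp
  show ?thesis
  proof (cases "p = top")
    case True
    have "AE x in lebesgue. \<forall>n. f x * indicator {t n<..} x \<le> K"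
      unfolding AE_all_countable
    proof
      fix n
      have "esssup lebesgue (\<lambda>x. f x * indicator {t n<..} x) \<le> K"
        using le[OF t(2)[of n]] True by (simp add: Lnorm_def)
      then show "AE x in lebesgue. f x * indicator {t n<..} x \<le> K"
        using esssup_AE[of "\<lambda>x. f x * indicator {t n<..} x" lebesgue] by (auto elim: eventually_mono)
    qed
    with ae have "AE x in lebesgue. f x * indicator A x \<le> K"
    proof eventually_elim
      case (elim x)
      show ?case
      proof (cases "x \<in> A")
        case True
        with elim(1) obtain n where "t n < x" by auto
        with elim(2)[rule_format, of n] True show ?thesis by simp
      qed simp
    qed
    then show ?thesis using True by (auto simp: Lnorm_def intro!: esssup_I)
  next
    case False
    then have p: "0 < enn2real p" using p by (simp add: enn2real_positive_iff top.not_eq_extremum)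
    have "(\<integral>\<^sup>+x\<in>A. epowr (f x) (enn2real p) \<partial>lebesgue) \<le> (\<integral>\<^sup>+x\<in>(\<Union>n. {t n<..}). epowr (f x) (enn2real p) \<partial>lebesgue)"
      using ae by (intro nn_integral_mono_AE, eventually_elim) (auto simp: indicator_def)
    also have "\<dots> \<le> epowr K (enn2real p)"
    proof (rule nn_integral_UN_incseq_le)
      show "incseq (\<lambda>n. {t n<..})" using t(1) by (auto simp: incseq_def decseq_def intro: le_less_trans)
      show "(\<integral>\<^sup>+x\<in>{t n<..}. epowr (f x) (enn2real p) \<partial>lebesgue) \<le> epowr K (enn2real p)" for n
        using le[OF t(2)[of n]] False p by (simp add: Lnorm_def flip: epowr_le_swap[of "1 / enn2real p", simplified])
    qed simp_all
    finally show ?thesis using False p epowr_le_swap[of "1 / enn2real p"] by (simp add: Lnorm_def)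
  qed
qed

text \<open>Only a least point of \<open>A\<close>, if there is one, escapes the open tails starting
  in \<open>A\<close>, and a single point is null.\<close>

lemma Lnorm_up_closed_le:
  fixes f :: "real \<Rightarrow> ennreal"
  assumes p: "0 < p"
    and f [measurable]: "f \<in> borel_measurable lebesgue"
    and up: "\<And>s t. s \<in> A \<Longrightarrow> s \<le> t \<Longrightarrow> t \<in> A"
    and le: "\<And>t. t \<in> A \<Longrightarrow> Lnorm lebesgue p {t<..} f \<le> K"
  shows "Lnorm lebesgue p A f \<le> K"
proof (rule Lnorm_tail_union_le[OF p f _ _ le])
  show "A \<in> sets borel" by (rule up_closed_borel) (rule up)
  have "A - (\<Union>t\<in>A. {t<..}) \<subseteq> {Inf A}"
  proof
    fix x assume "x \<in> A - (\<Union>t\<in>A. {t<..})"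
    then have "Inf A = x" by (intro cInf_eq_minimum) (auto simp: not_less)
    then show "x \<in> {Inf A}" by simp
  qed
  then show "A - (\<Union>t\<in>A. {t<..}) \<in> null_sets lebesgue"
    by (rule negligible_subset[OF negligible_sing, unfolded negligible_iff_null_sets])
qed

text \<open>The reflection carries \<open>[a,b)\<close> to \<open>(-b,-a]\<close>, and left
  continuity to the right continuity that \<open>interval_measure\<close> requires.\<close>

lemma ls_measure_atLeastLessThan:
  assumes "mono h" "\<And>t. (h \<longlongrightarrow> h t) (at_left t)" "a \<le> b"
  shows "emeasure (ls_measure h) {a..<b} = ennreal (h b - h a)"
proof -
  have m: "(uminus :: real \<Rightarrow> real) \<in> interval_measure (\<lambda>u. - h (- u)) \<rightarrow>\<^sub>M borel"
    by (simp add: measurable_cong_sets[OF sets_interval_measure refl])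
  have "emeasure (ls_measure h) {a..<b} = emeasure (interval_measure (\<lambda>u. - h (- u))) {-b<..-a}"
    unfolding ls_measure_def by (subst emeasure_distr[OF m]) (auto intro!: arg_cong2[where f=emeasure])
  also have "\<dots> = ennreal (- h (- (- a)) - - h (- (- b)))"
  proof (rule emeasure_interval_measure_Ioc)
    show "- b \<le> - a" using assms by simp
    show "- h (- x) \<le> - h (- y)" if "x \<le> y" for x y using monoD[OF assms(1)] that by simp
    show "continuous (at_right x) (\<lambda>u. - h (- u))" for x
    proof -
      have "((\<lambda>u. h (- u)) \<longlongrightarrow> h (- x)) (at_right x)"
        using assms(2)[of "-x"] by (simp add: at_left_minus filterlim_filtermap)
      then show ?thesis by (simp add: continuous_within tendsto_minus)
    qed
  qed
  finally show ?thesis by simp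
qed

lemma sets_ls_measure [simp, measurable_cong]: "sets (ls_measure h) = sets borel"
  by (simp add: ls_measure_def)

section \<open>Tails of the weight and their dyadic levels\<close>

abbreviation dy :: "int \<Rightarrow> ennreal" where "dy i \<equiv> ennreal (2 powr (- real_of_int i))"

lemma dy_mono: "i \<le> j \<Longrightarrow> dy j \<le> dy i"
  by (intro ennreal_leI powr_mono) auto

lemma dy_less_iff: "dy i < dy j \<longleftrightarrow> j < i"
  by (simp add: ennreal_less_iff)

locale radial_weight =
  fixes \<theta> :: ennreal and \<omega> :: "real \<Rightarrow> real"
  assumes \<theta>_pos: "0 < \<theta>" and \<omega>: "\<omega> \<in> Omega \<theta>"
begin

text \<open>Only on the positive half-line is \<open>\<omega>\<close> known to be measurable;
  extension by zero gives a function measurable on the whole line.\<close>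

definition w :: "real \<Rightarrow> ennreal" where "w r = ennreal (\<omega> r) * indicator {0<..} r"

definition S :: "real \<Rightarrow> ennreal" where "S t = Lnorm lebesgue \<theta> ({t<..} \<inter> {0<..}) (\<lambda>r. ennreal (\<omega> r))"

lemma w_measurable [measurable]: "w \<in> borel_measurable lebesgue"
proof -
  have "(\<lambda>r. ennreal (\<omega> r)) \<in> borel_measurable (restrict_space lebesgue {0<..})"
    using \<omega> by (intro measurable_compose[OF _ measurable_ennreal]) (simp add: Omega_def)
  then show ?thesis unfolding w_def by (subst (asm) borel_measurable_restrict_space_iff_ennreal) auto
qed

lemma S_eq: "S t = Lnorm lebesgue \<theta> {t<..} w"
proof (cases "\<theta> = top")
  case True
  have "(\<lambda>x. ennreal (\<omega> x) * indicator ({t<..} \<inter> {0<..}) x) = (\<lambda>x. w x * indicator {t<..} x)"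
    by (auto simp: w_def indicator_def)
  then show ?thesis unfolding S_def Lnorm_def if_P[OF True] by simp
next
  case False
  then have "0 < enn2real \<theta>" using \<theta>_pos by (simp add: enn2real_positive_iff top.not_eq_extremum)
  then have "(\<lambda>x. epowr (ennreal (\<omega> x)) (enn2real \<theta>) * indicator ({t<..} \<inter> {0<..}) x) = (\<lambda>x. epowr (w x) (enn2real \<theta>) * indicator {t<..} x)"
    by (auto simp: w_def indicator_def)
  then show ?thesis using False by (simp add: S_def Lnorm_def)
qed

lemma S_nonneg: "0 \<le> t \<Longrightarrow> S t = Lnorm lebesgue \<theta> {t<..} (\<lambda>r. ennreal (\<omega> r))"
  unfolding S_def by (rule arg_cong[where f="\<lambda>A. Lnorm lebesgue \<theta> A _"]) auto

lemma S_nonpos: "t \<le> 0 \<Longrightarrow> S t = S 0"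
  unfolding S_def by (rule arg_cong[where f="\<lambda>A. Lnorm lebesgue \<theta> A _"]) auto

lemma S_antimono: "s \<le> t \<Longrightarrow> S t \<le> S s"
  unfolding S_eq by (rule Lnorm_mono_AE[OF \<theta>_pos]) (auto simp: indicator_def)

lemma S_finite: "0 < t \<Longrightarrow> S t < top"
  using \<omega> by (simp add: S_nonneg Omega_def)

lemma S_pos: "0 < S t"
proof (cases "0 < t")
  case True then show ?thesis using \<omega> by (simp add: S_nonneg Omega_def)
next
  case False
  moreover have "0 < S 1" using \<omega> by (simp add: S_nonneg Omega_def)
  ultimately show ?thesis using S_antimono[of t 1] by simp
qed

text \<open>The open tail at \<open>t\<close> is the union of the tails at later points. Stated as
  an inequality, right continuity also covers an infinite \<open>S t\<close>.\<close>

lemma S_right_continuous: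
  assumes "\<And>t'. t < t' \<Longrightarrow> S t' \<le> K" shows "S t \<le> K"
  unfolding S_eq
proof (rule Lnorm_up_closed_le[OF \<theta>_pos w_measurable])
  show "Lnorm lebesgue \<theta> {t'<..} w \<le> K" if "t' \<in> {t<..}" for t'
    using assms[of t'] that by (simp add: S_eq)
qed auto

text \<open>The point \<open>0\<close> lies in some level exactly if \<open>\<parallel>\<omega>\<parallel>\<close> over \<open>(0,\<infinity>)\<close> is finite; in case (b) it plays the
  role of an additional atom, which accounts for the second summand.\<close>

definition D :: "int \<Rightarrow> real set" where "D i = {t. 0 \<le> t \<and> S t \<le> dy i}"

definition A :: "int \<Rightarrow> real set" where "A i = D i - D (i + 1)"

lemma D_up: "t \<in> D i \<Longrightarrow> t \<le> t' \<Longrightarrow> t' \<in> D i"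
  using S_antimono order_trans by (fastforce simp: D_def)

lemma D_antimono: "i \<le> j \<Longrightarrow> D j \<subseteq> D i"
  using dy_mono[of i j] by (auto simp: D_def intro: order_trans)

lemma D_borel [measurable]: "D i \<in> sets borel"
  by (rule up_closed_borel) (rule D_up)

lemma A_borel [measurable]: "A i \<in> sets borel"
  unfolding A_def by measurable

lemma A_iff: "t \<in> A i \<longleftrightarrow> 0 \<le> t \<and> dy (i + 1) < S t \<and> S t \<le> dy i"
  by (auto simp: A_def D_def)

lemma A_subset_D: "A i \<subseteq> D i" by (auto simp: A_def)

lemma A_disjoint: "t \<in> A i \<Longrightarrow> t \<in> A j \<Longrightarrow> i = j"
proof (rule ccontr)
  assume *: "t \<in> A i" "t \<in> A j" "i \<noteq> j"
  then have "dy (i + 1) < dy j" "dy (j + 1) < dy i"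
    unfolding A_iff by (meson less_le_trans)+
  then show False using *(3) unfolding dy_less_iff by simp
qed

lemma A_cover:
  assumes "0 \<le> t" "S t \<noteq> top" shows "\<exists>i. t \<in> A i"
proof -
  obtain x where x: "S t = ennreal x" "0 < x"
    using assms S_pos[of t] by (cases "S t") auto
  define i where "i = \<lfloor>- log 2 x\<rfloor>"
  have "real_of_int i \<le> - log 2 x" "- log 2 x < real_of_int i + 1" by (auto simp: i_def)
  then have "log 2 x \<le> - real_of_int i" "- real_of_int (i + 1) < log 2 x" by auto
  then have "x \<le> 2 powr (- real_of_int i)" "2 powr (- real_of_int (i + 1)) < x"
    using x(2) by (simp_all add: log_le_iff less_log_iff)
  then show ?thesis using x assms(1) by (auto simp: A_iff ennreal_less_iff intro!: exI[of _ i] ennreal_leI)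
qed

text \<open>By right continuity the strict inequality \<open>dy (i + 1) < S t\<close> persists
  slightly to the right of \<open>t\<close>. Hence half-open intervals with endpoints in
  \<open>A i\<close> cover the level, and open balls with radii in \<open>A i\<close> cover its
  shell.\<close>

lemma A_no_max:
  assumes "t \<in> A i" obtains t' where "t < t'" "t' \<in> A i"
proof -
  have "\<exists>t'>t. dy (i + 1) < S t'"
    using assms S_right_continuous[of t "dy (i + 1)"] by (force simp: A_iff not_le)
  then obtain t' where "t < t'" "dy (i + 1) < S t'" by blast
  with assms S_antimono[of t t'] that[of t'] show ?thesis by (auto simp: A_iff)
qed

lemma Lnorm_D_le: "Lnorm lebesgue \<theta> (D i) w \<le> dy i"
  by (rule Lnorm_up_closed_le[OF \<theta>_pos w_measurable]) (use D_up in blast, simp add: D_def flip: S_eq)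

text \<open>Since \<open>S\<close> is nonincreasing, its left limit is the infimum over earlier
  points. The three facts say just that, and nothing else is used of the limit afterwards.\<close>

lemma Lim_S_bounds:
  defines "L \<equiv> \<lambda>t. Lim (at_left t) S"
  shows "S t \<le> L t" "t' < t \<Longrightarrow> L t \<le> S t'" "(\<And>t'. t' < t \<Longrightarrow> K \<le> S t') \<Longrightarrow> K \<le> L t"
proof -
  have "(S \<longlongrightarrow> (INF s\<in>{..<t}. S s)) (at_left t)"
  proof (rule order_tendstoI)
    fix a assume "a < (INF s\<in>{..<t}. S s)"
    then have "a < S s" if "s < t" for s using that by (meson INF_lower lessThan_iff less_le_trans)
    then show "\<forall>\<^sub>F x in at_left t. a < S x" by (auto simp: eventually_at_filter)
  next
    fix a assume "(INF s\<in>{..<t}. S s) < a"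
    then obtain s where "s < t" "S s < a" by (auto simp: INF_less_iff)
    then show "\<forall>\<^sub>F x in at_left t. S x < a"
      unfolding eventually_at_left_field
      by (intro exI[of _ s]) (meson S_antimono le_less_trans less_imp_le)
  qed
  then have L: "L t = (INF s\<in>{..<t}. S s)" unfolding L_def by (intro tendsto_Lim) auto
  show "S t \<le> L t" unfolding L by (auto intro!: INF_greatest S_antimono)
  show "L t \<le> S t'" if "t' < t" unfolding L using that by (auto intro!: INF_lower)
  show "K \<le> L t" if "\<And>t'. t' < t \<Longrightarrow> K \<le> S t'" unfolding L using that by (auto intro!: INF_greatest)
qed

section \<open>The Stieltjes function of the weight and its mass on the levels\<close>

context
  fixes \<rho> :: real assumes \<rho>: "0 < \<rho>"
begin

definition h :: "real \<Rightarrow> real" where "h = hfun \<theta> \<rho> \<omega>"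

text \<open>The left limit is at least \<open>S t > 0\<close>, so its negative power is finite and
  \<open>enn2real\<close> loses nothing; an infinite limit gives \<open>h t = 0\<close>.\<close>

lemma h_eq: "ennreal (h t) = epowr (Lim (at_left t) S) (- \<rho>)"
proof -
  have "epowr (Lim (at_left t) S) (- \<rho>) \<noteq> top"
    using \<rho> less_le_trans[OF S_pos Lim_S_bounds(1), of t] by (auto simp: epowr_def)
  then show ?thesis by (simp add: h_def hfun_def S_def[abs_def] ennreal_enn2real_if)
qed

lemma h_nonneg: "0 \<le> h t" by (simp add: h_def hfun_def)

lemma h_le_iff: "0 \<le> K \<Longrightarrow> h t \<le> K \<longleftrightarrow> epowr (ennreal K) (- (1 / \<rho>)) \<le> Lim (at_left t) S"
  using epowr_minus_swap[OF \<rho>, of "Lim (at_left t) S" "ennreal K"] by (simp flip: h_eq)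

lemma h_le: "0 < x \<Longrightarrow> (\<And>t'. t' < t \<Longrightarrow> ennreal x \<le> S t') \<Longrightarrow> h t \<le> x powr (- \<rho>)"
  using Lim_S_bounds(3)[of t "ennreal x"] \<rho> by (simp add: h_le_iff epowr_ennreal powr_powr)

lemma h_ge:
  assumes "0 < x" "t' < t" "S t' \<le> ennreal x" shows "x powr (- \<rho>) \<le> h t"
proof -
  have "epowr (ennreal (h t)) (- (1 / \<rho>)) \<le> ennreal x"
    using assms(3) Lim_S_bounds(2)[OF assms(2)] \<rho> h_le_iff[OF h_nonneg, of t t] by simp
  then show ?thesis using epowr_minus_swap[OF \<rho>, of "ennreal x" "ennreal (h t)"] assms(1) h_nonneg
    by (simp add: epowr_ennreal)
qed

lemma mono_h: "mono h"
proof (rule monoI)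
  fix s t :: real assume "s \<le> t"
  then have "Lim (at_left t) S \<le> Lim (at_left s) S"
    by (intro Lim_S_bounds(3)) (auto intro!: Lim_S_bounds(2))
  moreover have "epowr (ennreal (h t)) (- (1 / \<rho>)) \<le> Lim (at_left t) S"
    using h_le_iff[OF h_nonneg, of t t] by simp
  ultimately show "h s \<le> h t" by (simp add: h_le_iff h_nonneg)
qed

lemma h_left_continuous: "(h \<longlongrightarrow> h t) (at_left t)"
proof (rule order_tendstoI)
  fix a assume a: "a < h t"
  have "\<exists>s<t. a < h s"
  proof (rule ccontr)
    assume "\<not> ?thesis"
    then have *: "h s \<le> max a 0" if "s < t" for s using that by force
    \<comment> \<open>The left limit at the midpoint of \<open>s\<close> and \<open>t\<close> is at
      most \<open>S s\<close>, while the bound on \<open>h\<close> at the midpoint bounds that limit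
      from below.\<close>
    have "epowr (ennreal (max a 0)) (- (1 / \<rho>)) \<le> S s" if "s < t" for s
      using *[of "(s + t) / 2"] Lim_S_bounds(2)[of s "(s + t) / 2"] that by (simp add: h_le_iff)
    then have "h t \<le> max a 0" by (subst h_le_iff) (auto intro: Lim_S_bounds(3))
    with a have "h t \<le> 0" "a < 0" by (auto simp: max_def split: if_splits)
    then have "t - 1 < t \<and> a < h (t - 1)" using h_nonneg[of "t - 1"] by linarith
    with \<open>\<not> ?thesis\<close> show False by blast
  qed
  then obtain s where "s < t" "a < h s" by blast
  then show "\<forall>\<^sub>F x in at_left t. a < h x"
    unfolding eventually_at_left_field using monoD[OF mono_h, of s] by (force intro: less_le_trans less_imp_le)
next
  fix a assume "h t < a"
  then show "\<forall>\<^sub>F x in at_left t. h x < a"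
    unfolding eventually_at_left_field
    by (intro exI[of _ "t - 1"]) (auto intro: le_less_trans[OF monoD[OF mono_h, of _ t]])
qed

lemma emeasure_h: "a \<le> b \<Longrightarrow> emeasure (ls_measure h) {a..<b} = ennreal (h b - h a)"
  by (intro ls_measure_atLeastLessThan mono_h h_left_continuous)

text \<open>As \<open>A i\<close> has no maximum, intervals \<open>[0,t)\<close> with
  \<open>t\<close> in \<open>A i\<close> cover it. Before such a \<open>t\<close> the tail norm
  exceeds \<open>dy (i + 1)\<close>, so \<open>h t\<close>, and with it the mass of the interval, is
  at most \<open>2 powr ((i + 1) * \<rho>)\<close>.\<close>

lemma emeasure_A_le: "emeasure (ls_measure h) (A i) \<le> ennreal (2 powr (real_of_int (i + 1) * \<rho>))"
proof (cases "A i = {}")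
  case False
  from incseq_cofinal[OF False] obtain t where t: "incseq t" "\<And>n::nat. t n \<in> A i" "\<And>a. a \<in> A i \<Longrightarrow> \<exists>n. a \<le> t n"
    by blast
  have "A i \<subseteq> (\<Union>n. {0..<t n})"
  proof
    fix a assume a: "a \<in> A i"
    then obtain a' where "a < a'" "a' \<in> A i" by (rule A_no_max)
    with t(3)[of a'] obtain n where "a < t n" by (meson less_le_trans)
    with a show "a \<in> (\<Union>n. {0..<t n})" by (auto simp: A_iff)
  qed
  then have "emeasure (ls_measure h) (A i) \<le> emeasure (ls_measure h) (\<Union>n. {0..<t n})"
    by (intro emeasure_mono) auto
  also have "\<dots> = (SUP n. emeasure (ls_measure h) {0..<t n})"
    using t(1) by (intro SUP_emeasure_incseq[symmetric]) (auto simp: incseq_def intro: less_le_trans)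
  also have "\<dots> \<le> ennreal (2 powr (real_of_int (i + 1) * \<rho>))"
  proof (rule SUP_least)
    fix n
    have "0 \<le> t n" "dy (i + 1) < S (t n)" using t(2)[of n] by (auto simp: A_iff)
    then have "h (t n) \<le> (2 powr (- real_of_int (i + 1))) powr (- \<rho>)"
      by (intro h_le) (auto intro: less_imp_le less_le_trans S_antimono)
    also have "\<dots> = 2 powr (real_of_int (i + 1) * \<rho>)"
      by (simp add: powr_powr algebra_simps)
    finally have "h (t n) - h 0 \<le> 2 powr (real_of_int (i + 1) * \<rho>)"
      using h_nonneg[of 0] by linarith
    then show "emeasure (ls_measure h) {0..<t n} \<le> ennreal (2 powr (real_of_int (i + 1) * \<rho>))"
      using \<open>0 \<le> t n\<close> by (simp add: emeasure_h ennreal_leI)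
  qed
  finally show ?thesis .
qed simp

text \<open>Let \<open>b\<close> be the least point of \<open>D (i - 1)\<close>. Before
  \<open>b\<close> the tail norm exceeds \<open>dy (i - 1)\<close>, while \<open>S t\<close> is at
  most \<open>dy i\<close>, so \<open>h\<close> grows between \<open>b\<close> and \<open>t'\<close>
  by the stated amount. The strict \<open>t < t'\<close> is used because the left-continuous
  \<open>h\<close> sees the value of \<open>S\<close> at \<open>t\<close> only after
  \<open>t\<close>.\<close>

lemma emeasure_two_levels:
  assumes t: "t \<in> A i" "t' \<in> A i" "t < t'" and 0: "0 \<notin> D (i - 1)"
  shows "ennreal ((1 - 2 powr (- \<rho>)) * 2 powr (real_of_int i * \<rho>))
    \<le> emeasure (ls_measure h) ((A (i - 1) \<union> A i) \<inter> {0<..<t'})"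
proof -
  have tD: "t \<in> D (i - 1)" using t(1) D_antimono[of "i - 1" i] by (auto simp: A_def)
  define b where "b = Inf (D (i - 1))"
  have bdd: "bdd_below (D (i - 1))" by (auto simp: D_def intro!: bdd_belowI[of _ 0])
  have up: "t' \<in> D (i - 1)" if "b < t'" for t'
  proof -
    have "D (i - 1) \<noteq> {}" using tD by blast
    from cInf_less_iff[OF this bdd, of t'] that obtain d where "d \<in> D (i - 1)" "d < t'"
      unfolding b_def by blast
    then show ?thesis using D_up[of d "i - 1" t'] by simp
  qed
  have "0 \<le> b" unfolding b_def using tD by (intro cInf_greatest) (auto simp: D_def)
  \<comment> \<open>Right continuity of \<open>S\<close> shows that the infimum \<open>b\<close> is
    attained.\<close>
  moreover have "S b \<le> dy (i - 1)"
    by (rule S_right_continuous) (use up D_def in blast)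
  ultimately have bD: "b \<in> D (i - 1)" by (simp add: D_def)
  with 0 have "0 < b" by (auto simp: D_def order_le_less)
  have "b \<le> t" using tD bdd by (simp add: b_def cInf_lower)
  have "h b \<le> (2 powr (- real_of_int (i - 1))) powr (- \<rho>)"
  proof (rule h_le)
    fix s assume "s < b"
    \<comment> \<open>For negative \<open>s\<close> the value \<open>S s\<close> is
      \<open>S 0\<close>, which is large because 0 is not in \<open>D (i - 1)\<close>.\<close>
    then have "max s 0 \<notin> D (i - 1)" using bdd 0 cInf_lower[of s "D (i - 1)"] by (auto simp: b_def max_def)
    then show "dy (i - 1) \<le> S s" using S_nonpos[of s] by (cases "0 \<le> s") (auto simp: D_def max_def not_le intro: less_imp_le split: if_splits)
  qed simp
  also have "\<dots> = 2 powr (- \<rho>) * 2 powr (real_of_int i * \<rho>)"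
    by (simp add: powr_powr algebra_simps flip: powr_add)
  finally have hb: "h b \<le> 2 powr (- \<rho>) * 2 powr (real_of_int i * \<rho>)" .
  have "(2 powr (- real_of_int i)) powr (- \<rho>) \<le> h t'"
    by (rule h_ge[OF _ \<open>t < t'\<close>]) (use t(1) in \<open>auto simp: A_iff\<close>)
  then have "2 powr (real_of_int i * \<rho>) \<le> h t'" by (simp add: powr_powr)
  with hb have "ennreal ((1 - 2 powr (- \<rho>)) * 2 powr (real_of_int i * \<rho>)) \<le> ennreal (h t' - h b)"
    by (intro ennreal_leI) (simp add: algebra_simps)
  also have "\<dots> = emeasure (ls_measure h) {b..<t'}" using \<open>b \<le> t\<close> t by (simp add: emeasure_h)
  also have "\<dots> \<le> emeasure (ls_measure h) ((A (i - 1) \<union> A i) \<inter> {0<..<t'})"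
  proof (rule emeasure_mono)
    show "{b..<t'} \<subseteq> (A (i - 1) \<union> A i) \<inter> {0<..<t'}"
    proof
      fix x assume x: "x \<in> {b..<t'}"
      then have "x \<in> D (i - 1)" using bD D_up by auto
      moreover have "x \<notin> D (i + 1)" using x t(2) D_up[of x "i + 1" t'] by (auto simp: A_def)
      ultimately show "x \<in> (A (i - 1) \<union> A i) \<inter> {0<..<t'}" using x \<open>0 < b\<close> by (auto simp: A_def)
    qed
  qed simp
  finally show ?thesis .
qed

end

end

section \<open>Reduction to the dyadic levels of the weight\<close>

locale embedding = weight_pair p1 p2 v1 v2 + radial_weight \<theta> \<omega>
  for p1 p2 :: real and v1 v2 :: "'a::euclidean_space \<Rightarrow> real" and \<theta> :: ennreal and \<omega> :: "real \<Rightarrow> real"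
begin

definition J :: ennreal where "J = embnorm (ennreal p2) \<theta> (ennreal p1) \<omega> v2 v1"

definition G :: "real \<Rightarrow> ennreal" where "G t = U (- ball 0 t)"

definition \<phi> :: "('a \<Rightarrow> real) \<Rightarrow> real \<Rightarrow> ennreal" where "\<phi> f r = epowr (II f (ball 0 r)) (1 / p2)"

definition N :: "('a \<Rightarrow> real) \<Rightarrow> ennreal" where "N f = LMnorm (ennreal p2) \<theta> \<omega> v2 f"

lemma N_eq: "N f = Lnorm lebesgue \<theta> {0<..} (\<lambda>r. w r * \<phi> f r)"
proof -
  have *: "ennreal (\<omega> r) * wnorm lebesgue (ennreal p2) (ball 0 r) v2 f * indicator {0<..} r = w r * \<phi> f r * indicator {0<..} r" for r
    using p2_pos by (auto simp: w_def \<phi>_def wnorm_eq_wint indicator_def)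
  have **: "epowr (ennreal (\<omega> r) * wnorm lebesgue (ennreal p2) (ball 0 r) v2 f) e * indicator {0<..} r = epowr (w r * \<phi> f r) e * indicator {0<..} r" for r e
    using p2_pos by (auto simp: w_def \<phi>_def wnorm_eq_wint indicator_def)
  show ?thesis unfolding N_def LMnorm_def Lnorm_def * ** ..
qed

lemma \<phi>_mono: "r \<le> r' \<Longrightarrow> \<phi> f r \<le> \<phi> f r'"
  unfolding \<phi>_def using p2_pos by (intro epowr_mono wint_mono) auto

lemma \<phi>_measurable [measurable]: "\<phi> f \<in> borel_measurable borel"
  using \<phi>_mono by (intro borel_measurable_mono_real) (auto simp: mono_def)

lemma G_antimono: "r \<le> r' \<Longrightarrow> G r' \<le> G r"
  unfolding G_def by (intro U_mono) (auto simp: dist_norm)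

lemma G_measurable [measurable]: "G \<in> borel_measurable borel"
  using G_antimono by (intro borel_measurable_antimono_real) (auto simp: antimono_def)

text \<open>Beyond radius \<open>t\<close> the local norm is at least \<open>\<phi> f t\<close>, so
  the Morrey norm dominates this constant times the tail norm. Finiteness on the ball lets the
  constant be pulled out of \<open>Lnorm\<close>.\<close>

lemma \<phi>_S_le_N:
  assumes "0 < t" "II f (ball 0 t) < top"
  shows "\<phi> f t * S t \<le> N f"
proof -
  have "\<phi> f t \<noteq> top" using assms(2) p2_pos by (simp add: \<phi>_def epowr_eq_top_iff)
  then have "\<phi> f t * S t \<le> Lnorm lebesgue \<theta> {t<..} (\<lambda>r. \<phi> f t * w r)"
    unfolding S_eq by (intro Lnorm_cmult \<theta>_pos) auto
  also have "\<dots> \<le> N f"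
    unfolding N_eq using assms(1) \<phi>_mono[of t _ f]
    by (intro Lnorm_mono_AE[OF \<theta>_pos]) (auto simp: indicator_def mult.commute intro!: mult_left_mono)
  finally show ?thesis .
qed

text \<open>A zero Morrey norm would force a zero local norm on every ball, as all tails of
  \<open>\<omega>\<close> have positive norm, and \<open>v2\<close> is positive almost everywhere.
  This keeps the denominators in \<open>embnorm\<close> away from 0.\<close>

lemma N_pos:
  assumes [measurable]: "f \<in> borel_measurable lebesgue" and fin: "\<And>r. II f (ball 0 r) < top"
    and nz: "\<not> (AE x in lebesgue. f x = 0)"
  shows "0 < N f"
proof (rule ccontr)
  assume "\<not> 0 < N f"
  then have 0: "N f = 0" by (simp add: zero_less_iff_neq_zero)
  have ae: "AE x in lebesgue. ennreal (\<bar>f x\<bar> powr p2 * v2 x) * indicator Y x = 0"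
    if "II f Y = 0" "Y \<in> sets lebesgue" for Y
    using that unfolding wint_def by (subst (asm) nn_integral_0_iff_AE) auto
  have "AE x in lebesgue. f x * indicator (ball 0 (Suc n)) x = 0" for n
  proof -
    have "\<phi> f (Suc n) * S (Suc n) = 0" using \<phi>_S_le_N[of "Suc n" f] fin 0 by simp
    then have "II f (ball 0 (Suc n)) = 0"
      using S_pos[of "Suc n"] p2_pos by (auto simp: \<phi>_def epowr_eq_0_iff zero_less_iff_neq_zero)
    then have "AE x in lebesgue. ennreal (\<bar>f x\<bar> powr p2 * v2 x) * indicator (ball 0 (Suc n)) x = 0"
      by (intro ae) auto
    with v_pos show ?thesis
      by eventually_elim (auto simp: indicator_def ennreal_eq_0_iff mult_le_0_iff split: if_splits)
  qed
  then have "AE x in lebesgue. \<forall>n. f x * indicator (ball 0 (Suc n)) x = 0"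
    unfolding AE_all_countable by blast
  then have "AE x in lebesgue. f x = 0"
  proof eventually_elim
    case (elim x)
    have "norm x < Suc (nat \<lceil>norm x\<rceil>)" by (simp add: less_Suc_eq_le) linarith
    then show ?case using elim[rule_format, of "nat \<lceil>norm x\<rceil>"] by (simp add: indicator_def)
  qed
  with nz show False by simp
qed

text \<open>For a nonzero member of the Morrey space the denominator is positive and finite, so
  bounding the quotient amounts to the inequality assumed here; compactness of closed balls gives
  finiteness on all balls.\<close>

lemma J_leI:
  assumes "\<And>f. f \<in> borel_measurable lebesgue \<Longrightarrow> (\<And>r. II f (ball 0 r) < top) \<Longrightarrow> N f < top
    \<Longrightarrow> epowr (MM f UNIV) (1 / p1) \<le> K * N f"
  shows "J \<le> K"
  unfolding J_def embnorm_def
proof (rule SUP_least)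
  fix f assume f: "f \<in> {f \<in> LM (ennreal p2) \<theta> \<omega> v2. \<not> (AE x in lebesgue. f x = 0)}"
  then have m: "f \<in> borel_measurable lebesgue" and N: "N f < top"
    and loc: "\<And>K. compact K \<Longrightarrow> II f K < top"
    using p2_pos by (auto simp: LM_def Lloc_def N_def wnorm_eq_wint epowr_less_top_iff)
  have fin: "II f (ball 0 r) < top" for r
    using loc[of "cball 0 r"] wint_mono[OF ball_subset_cball, of p2 v2 f 0 r] by (auto intro: le_less_trans)
  have "0 < N f" using N_pos[OF m fin] f by auto
  then show "wnorm lebesgue (ennreal p1) UNIV v1 f / LMnorm (ennreal p2) \<theta> \<omega> v2 f \<le> K"
    using assms[OF m fin N] p1_pos N unfolding N_def[symmetric]
    by (simp add: wnorm_eq_wint divide_le_posI_ennreal mult.commute)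
qed

lemma le_J:
  assumes m: "f \<in> borel_measurable lebesgue" and II: "II f UNIV < top" and N: "N f \<le> B" "B < top"
  shows "epowr (MM f UNIV) (1 / p1) \<le> J * B"
proof (cases "AE x in lebesgue. f x = 0")
  case True
  then have "AE x in lebesgue. ennreal (\<bar>f x\<bar> powr p1 * v1 x) * indicator UNIV x = 0" by (auto elim: eventually_mono)
  then have "MM f UNIV = 0" unfolding wint_def using m by (subst nn_integral_0_iff_AE) auto
  then show ?thesis using p1_pos by simp
next
  case False
  have fin: "II f X < top" for X using II wint_mono[of X UNIV p2 v2 f] by (auto intro: le_less_trans)
  have N': "0 < N f" "N f < top" using N_pos[OF m fin False] N by (auto intro: le_less_trans)
  have "f \<in> LM (ennreal p2) \<theta> \<omega> v2"
    using m fin N' p2_pos by (simp add: LM_def Lloc_def wnorm_eq_wint epowr_less_top_iff N_def)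
  then have "wnorm lebesgue (ennreal p1) UNIV v1 f / N f \<le> J"
    unfolding J_def embnorm_def N_def using False by (intro SUP_upper) simp
  then have "epowr (MM f UNIV) (1 / p1) / N f * N f \<le> J * N f"
    using p1_pos by (intro mult_right_mono) (simp_all add: wnorm_eq_wint)
  also have "epowr (MM f UNIV) (1 / p1) / N f * N f = epowr (MM f UNIV) (1 / p1)"
    using N' ennreal_mult_divide_eq[of "N f" "epowr (MM f UNIV) (1 / p1)"] by (simp add: ennreal_divide_times)
  also have "J * N f \<le> J * B" using N by (intro mult_left_mono) auto
  finally show ?thesis .
qed

text \<open>\<open>B\<close> contains every positive radius whose ball meets \<open>X\<close>. A
  function supported in \<open>X\<close> with \<open>II\<close> at most 1 has local norm 0 at
  positive radii outside \<open>B\<close> and at most 1 elsewhere, so its Morrey norm is at most the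
  norm of \<open>w\<close> over \<open>B\<close>.\<close>

lemma U_le_J:
  assumes [measurable]: "X \<in> sets lebesgue" "B \<in> sets borel"
    and B: "\<And>r. 0 < r \<Longrightarrow> ball 0 r \<inter> X \<noteq> {} \<Longrightarrow> r \<in> B"
    and K: "Lnorm lebesgue \<theta> B w \<le> K" "K < top"
  shows "U X \<le> J * K"
proof (rule U_leI)
  fix f :: "'a \<Rightarrow> real" assume f [measurable]: "f \<in> borel_measurable lebesgue"
    and 0: "\<And>x. x \<notin> X \<Longrightarrow> f x = 0" and 1: "II f UNIV \<le> 1"
  have [measurable]: "B \<in> sets lebesgue" by simp
  have "w r * \<phi> f r * indicator {0<..} r \<le> w r * indicator B r" for r
  proof (cases "0 < r \<and> r \<notin> B")
    case True
    then have "f x = 0" if "x \<in> ball 0 r" for x using B[of r] 0[of x] that by blast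
    then have "II f (ball 0 r) = 0" unfolding wint_def
      by (subst nn_integral_0_iff_AE) (auto simp: indicator_def)
    then show ?thesis using p2_pos by (simp add: \<phi>_def)
  next
    case False
    have "\<phi> f r \<le> epowr 1 (1 / p2)" unfolding \<phi>_def
      using p2_pos 1 wint_mono[of "ball 0 r" UNIV p2 v2 f] by (intro epowr_mono) auto
    then show ?thesis using False mult_left_mono[of "\<phi> f r" 1 "w r"] by (auto simp: indicator_def)
  qed
  then have "N f \<le> Lnorm lebesgue \<theta> B w"
    unfolding N_eq by (intro Lnorm_mono_AE[OF \<theta>_pos]) auto
  then have "epowr (MM f UNIV) (1 / p1) \<le> J * K"
    using K 1 by (intro le_J) (auto intro: le_less_trans)
  then show "MM f UNIV \<le> epowr (J * K) p1"
    using p1_pos epowr_le_swap[of "1 / p1"] by simp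
qed simp

lemma G_le_J: "0 \<le> t \<Longrightarrow> S t < top \<Longrightarrow> G t \<le> J * S t"
  unfolding G_def by (intro U_le_J[where B="{t<..}"]) (auto simp: S_eq)

section \<open>Shells over the dyadic levels\<close>

definition X :: "int \<Rightarrow> 'a set" where "X i = {x. norm x \<in> A i}"

lemma X_borel [measurable]: "X i \<in> sets borel"
  unfolding X_def by measurable

lemma X_lebesgue [measurable]: "X i \<in> sets lebesgue"
  by simp

text \<open>Sums over the integers run over the naturals through \<open>int_decode\<close>. The
  levels are disjoint, so at most one term is nonzero for any shift \<open>k\<close>; shifts serve
  to sum over the neighbour of each level.\<close>

lemma suminf_indicator_A:
  "(\<Sum>n. indicator (A (int_decode n + k)) t :: ennreal) = (if \<exists>i. t \<in> A i then 1 else 0)"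
proof (cases "\<exists>i. t \<in> A i")
  case True
  then obtain i where i: "t \<in> A i" by blast
  have "t \<in> A (int_decode n + k) \<longleftrightarrow> n = int_encode (i - k)" for n
    using i A_disjoint[OF i, of "int_decode n + k"] by (auto simp: algebra_simps)
  then have "(indicator (A (int_decode n + k)) t :: ennreal) = (if n = int_encode (i - k) then 1 else 0)" for n
    by (simp add: indicator_def)
  then show ?thesis using True sums_unique[OF sums_single[of "int_encode (i - k)" "\<lambda>_. 1 :: ennreal"]] by simp
qed simp

lemma suminf_nn_integral_A_le:
  assumes [measurable]: "g \<in> borel_measurable M" and M: "\<And>i. A i \<in> sets M"
  shows "(\<Sum>n. \<integral>\<^sup>+t\<in>A (int_decode n + k). g t \<partial>M) \<le> (\<integral>\<^sup>+t. g t \<partial>M)"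
proof -
  note M[measurable]
  have "(\<Sum>n. \<integral>\<^sup>+t\<in>A (int_decode n + k). g t \<partial>M) = (\<integral>\<^sup>+t. (\<Sum>n. g t * indicator (A (int_decode n + k)) t) \<partial>M)"
    by (rule nn_integral_suminf[symmetric]) measurable
  also have "\<dots> \<le> (\<integral>\<^sup>+t. g t \<partial>M)"
    by (intro nn_integral_mono) (simp add: suminf_indicator_A)
  finally show ?thesis .
qed

lemma X_cover:
  assumes "x \<noteq> 0" shows "\<exists>i. x \<in> X i"
  using A_cover[of "norm x"] S_finite[of "norm x"] assms by (auto simp: X_def)

text \<open>The shells cover everything except possibly the origin, which lies in no shell when
  \<open>S 0\<close> is infinite but is a null set.\<close>

lemma MM_le_suminf:
  assumes [measurable]: "f \<in> borel_measurable lebesgue"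
  shows "MM f UNIV \<le> (\<Sum>n. MM f (X (int_decode n)))"
proof -
  have "AE x in lebesgue. x \<notin> {0::'a}" by (rule AE_not_in) (simp flip: negligible_iff_null_sets)
  then have "MM f UNIV \<le> (\<integral>\<^sup>+x. (\<Sum>n. ennreal (\<bar>f x\<bar> powr p1 * v1 x) * indicator (X (int_decode n)) x) \<partial>lebesgue)"
    unfolding wint_def
  proof (intro nn_integral_mono_AE, eventually_elim)
    case (elim x)
    have "indicator (X i) x = (indicator (A i) (norm x) :: ennreal)" for i
      by (simp add: X_def indicator_def)
    with X_cover[of x] suminf_indicator_A[of 0 "norm x"] elim
    have "(\<Sum>n. indicator (X (int_decode n)) x) = (1 :: ennreal)" by (simp add: X_def)
    then show ?case by simp
  qed
  also have "\<dots> = (\<Sum>n. MM f (X (int_decode n)))"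
    unfolding wint_def by (rule nn_integral_suminf) measurable
  finally show ?thesis .
qed

definition \<Phi> :: "('a \<Rightarrow> real) \<Rightarrow> int \<Rightarrow> ennreal" where "\<Phi> f i = epowr (II f (X i)) (1 / p2)"

lemma MM_X_le:
  assumes "f \<in> borel_measurable lebesgue"
  shows "MM f (X i) \<le> epowr (U (X i) * \<Phi> f i) p1"
  using MM_le[OF assms X_lebesgue, of i] p1_pos p2_pos by (simp add: epowr_mult \<Phi>_def epowr_epowr q_def)

text \<open>\<open>A i\<close> has no maximum, so every point of the shell lies in an open ball with
  radius in \<open>A i\<close>; an increasing sequence of such balls is enough for monotone
  convergence.\<close>

lemma \<Phi>_le:
  assumes f [measurable]: "f \<in> borel_measurable lebesgue" and le: "\<And>t. t \<in> A i \<Longrightarrow> \<phi> f t \<le> K"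
  shows "\<Phi> f i \<le> K"
proof (cases "A i = {}")
  case True
  then show ?thesis using p2_pos by (simp add: \<Phi>_def X_def wint_def)
next
  case False
  from incseq_cofinal[OF False] obtain t where t: "incseq t" "\<And>n::nat. t n \<in> A i" "\<And>a. a \<in> A i \<Longrightarrow> \<exists>n. a \<le> t n"
    by blast
  have "X i \<subseteq> (\<Union>n. ball 0 (t n))"
  proof
    fix x assume "x \<in> X i"
    then obtain a' where "norm x < a'" "a' \<in> A i" unfolding X_def using A_no_max by blast
    with t(3)[of a'] obtain n where "norm x < t n" by (meson less_le_trans)
    then show "x \<in> (\<Union>n. ball 0 (t n))" by auto
  qed
  then have "II f (X i) \<le> II f (\<Union>n. ball 0 (t n))" by (rule wint_mono)
  also have "\<dots> \<le> epowr K p2"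
    unfolding wint_def
  proof (rule nn_integral_UN_incseq_le)
    show "incseq (\<lambda>n. ball (0::'a) (t n))" using t(1) by (auto simp: incseq_def) (meson less_le_trans)
    show "(\<integral>\<^sup>+x\<in>ball 0 (t n). ennreal (\<bar>f x\<bar> powr p2 * v2 x) \<partial>lebesgue) \<le> epowr K p2" for n
      using le[OF t(2)[of n]] p2_pos epowr_le_swap[of "1 / p2"] by (simp add: \<phi>_def wint_def)
  qed simp_all
  finally show ?thesis using p2_pos epowr_le_swap[of "1 / p2"] by (simp add: \<Phi>_def)
qed

text \<open>The least point \<open>t\<close> of \<open>A i\<close> may be ignored since spheres are null. This matters for \<open>\<theta> = \<infinity>\<close>: the
  Stieltjes measure can have an atom at \<open>t\<close>, which is not seen by the intervals ending there.\<close>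

lemma U_X_le:
  assumes le: "\<And>t t'. t \<in> A i \<Longrightarrow> t' \<in> A i \<Longrightarrow> t < t' \<Longrightarrow> G t' \<le> K"
  shows "U (X i) \<le> K"
proof (cases "A i = {}")
  case True
  then have "X i = {}" by (simp add: X_def)
  then show ?thesis using p1_pos by (intro U_leI) (auto simp: wint_def)
next
  case False
  define T where "T = {t'. t' \<in> A i \<and> (\<exists>t\<in>A i. t < t')}"
  have "T \<noteq> {}" using False A_no_max unfolding T_def by blast
  from decseq_cofinal[OF this] obtain t where t: "decseq t" "\<And>n::nat. t n \<in> T" "\<And>a. a \<in> T \<Longrightarrow> \<exists>n. t n \<le> a"
    by blast
  show ?thesis
  proof (rule U_UN_le[where X="\<lambda>n. - ball 0 (t n)"])
    show "incseq (\<lambda>n. - ball (0::'a) (t n))" using t(1) by (auto simp: incseq_def decseq_def) (meson less_le_trans)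
    show "U (- ball 0 (t n)) \<le> K" for n using t(2)[of n] le unfolding T_def G_def by blast
    have "X i - (\<Union>n. - ball 0 (t n)) \<subseteq> sphere 0 (Inf (A i))"
    proof
      fix x assume x: "x \<in> X i - (\<Union>n. - ball 0 (t n))"
      then have n: "norm x \<in> A i" and *: "\<And>n. norm x < t n" by (auto simp: X_def)
      have "norm x \<notin> T" using t(3)[of "norm x"] * by (meson not_le)
      then have "Inf (A i) = norm x" using n by (intro cInf_eq_minimum) (auto simp: T_def not_less)
      then show "x \<in> sphere 0 (Inf (A i))" by simp
    qed
    then show "X i - (\<Union>n. - ball 0 (t n)) \<in> null_sets lebesgue"
      by (rule negligible_subset[OF negligible_sphere, unfolded negligible_iff_null_sets])
  qed simp_all
qed

end

section \<open>Upper bounds\<close>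

lemma epowr_antimono: "0 < r \<Longrightarrow> x \<le> y \<Longrightarrow> epowr y (- r) \<le> epowr x (- r)"
  by (subst epowr_minus_swap) (simp_all add: epowr_epowr)

lemma dy_mult: "dy i * dy j = dy (i + j)"
  by (simp add: add.commute flip: ennreal_mult powr_add)

lemma dy_cancel [simp]: "dy i * dy (- i) = 1"
  by (simp flip: ennreal_mult powr_add)

lemma dy_cancel2 [simp]: "dy i * (dy (- i) * x) = x"
  by (simp flip: mult.assoc del: minus_minus of_int_minus)

lemma dy_cancel3 [simp]: "dy (- i) * (dy i * x) = x"
  using dy_cancel2[of "- i" x] by simp

text \<open>The denominator is the difference of the \<open>t\<close>-th powers of
  \<open>dy (i + 1)\<close> and \<open>dy (i + 2)\<close> divided by that of \<open>dy i\<close>; in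
  \<open>\<Phi>_level\<close> it bounds the mass of the weight on two levels from below.\<close>

definition level_const :: "real \<Rightarrow> real" where "level_const t = 1 / (2 powr (- t) - 2 powr (- (2 * t)))"

lemma level_const_pos: "0 < t \<Longrightarrow> 0 < level_const t"
  by (simp add: level_const_def)

text \<open>The first term inverts the factor in \<open>emeasure_two_levels\<close>; the second
  handles the levels for which 0 already belongs to \<open>D (i - 1)\<close>.\<close>

definition jump_const :: "real \<Rightarrow> real" where "jump_const r = max (1 / (1 - 2 powr (- r))) (2 powr r)"

lemma jump_const_pos: "0 < jump_const r"
  by (simp add: jump_const_def less_max_iff_disj)

context embedding
begin

abbreviation "\<tau> \<equiv> enn2real \<theta>"

lemma \<tau>_pos: "\<theta> \<noteq> top \<Longrightarrow> 0 < \<tau>"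
  using \<theta>_pos by (simp add: enn2real_positive_iff top.not_eq_extremum)

lemma epowr_N: "\<theta> \<noteq> top \<Longrightarrow> epowr (N f) \<tau> = (\<integral>\<^sup>+r. epowr (w r * \<phi> f r) \<tau> \<partial>lebesgue)"
  using \<tau>_pos unfolding N_eq Lnorm_def
  by (auto simp: w_def indicator_def intro!: nn_integral_cong)

text \<open>For \<open>r\<close> in \<open>A i\<close> the tail norm exceeds
  \<open>dy (i + 1)\<close>, and the part over \<open>D (i + 2)\<close> accounts for at most
  \<open>dy (i + 2)\<close>. The rest, measured in \<open>\<tau>\<close>-th powers, lies over
  \<open>A i\<close> and \<open>A (i + 1)\<close> beyond \<open>r\<close>, where
  \<open>\<phi> f\<close> is at least \<open>\<phi> f r\<close>. The level \<open>A i\<close> alone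
  would not do, since nothing bounds the excess of \<open>S r\<close> over \<open>dy (i + 1)\<close>
  from below.\<close>

lemma \<Phi>_level:
  assumes [measurable]: "f \<in> borel_measurable lebesgue" and \<theta>: "\<theta> \<noteq> top"
  defines "I \<equiv> \<lambda>i. \<integral>\<^sup>+r\<in>A i. epowr (w r * \<phi> f r) \<tau> \<partial>lebesgue"
  shows "epowr (dy i * \<Phi> f i) \<tau> \<le> ennreal (level_const \<tau>) * (I i + I (i + 1))"
proof -
  note \<tau> = \<tau>_pos[OF \<theta>]
  have [measurable]: "A j \<in> sets lebesgue" "D j \<in> sets lebesgue" for j by simp_all
  define K where "K = epowr (ennreal (level_const \<tau>) * (I i + I (i + 1))) (1 / \<tau>)"
  have "\<phi> f r \<le> dy (- i) * K" if r: "r \<in> A i" for r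
  proof -
    define Q where "Q = (A i \<union> A (i + 1)) \<inter> {r<..}"
    have [measurable]: "Q \<in> sets lebesgue" unfolding Q_def by measurable
    have "epowr (dy (i + 1)) \<tau> \<le> epowr (S r) \<tau>"
      using r \<tau> by (intro epowr_mono) (auto simp: A_iff)
    also have "\<dots> = (\<integral>\<^sup>+x\<in>{r<..}. epowr (w x) \<tau> \<partial>lebesgue)"
      using \<theta> \<tau> by (simp add: S_eq Lnorm_def)
    also have "\<dots> \<le> (\<integral>\<^sup>+x. epowr (w x) \<tau> * indicator (D (i + 2)) x + epowr (w x) \<tau> * indicator Q x \<partial>lebesgue)"
    proof (rule nn_integral_mono)
      fix x
      have "x \<in> Q \<or> x \<in> D (i + 2)" if "r < x"
        using that D_up[of r i x] r by (auto simp: Q_def A_def add.assoc)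
      then show "epowr (w x) \<tau> * indicator {r<..} x \<le> epowr (w x) \<tau> * indicator (D (i + 2)) x + epowr (w x) \<tau> * indicator Q x"
        by (auto simp: indicator_def)
    qed
    also have "\<dots> = (\<integral>\<^sup>+x\<in>D (i + 2). epowr (w x) \<tau> \<partial>lebesgue) + (\<integral>\<^sup>+x\<in>Q. epowr (w x) \<tau> \<partial>lebesgue)"
      by (rule nn_integral_add) measurable
    also have "(\<integral>\<^sup>+x\<in>D (i + 2). epowr (w x) \<tau> \<partial>lebesgue) \<le> epowr (dy (i + 2)) \<tau>"
      using Lnorm_D_le[of "i + 2"] \<theta> \<tau> epowr_le_swap[of "1 / \<tau>"] by (simp add: Lnorm_def)
    finally have "epowr (dy (i + 1)) \<tau> - epowr (dy (i + 2)) \<tau> \<le> (\<integral>\<^sup>+x\<in>Q. epowr (w x) \<tau> \<partial>lebesgue)"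
      by (subst ennreal_minus_le_iff) (auto simp: add_right_mono epowr_ennreal)
    also have "epowr (dy (i + 1)) \<tau> - epowr (dy (i + 2)) \<tau> = ennreal (1 / level_const \<tau>) * epowr (dy i) \<tau>"
    proof -
      have "(2 powr (- real_of_int (i + 1))) powr \<tau> - (2 powr (- real_of_int (i + 2))) powr \<tau>
          = (1 / level_const \<tau>) * (2 powr (- real_of_int i)) powr \<tau>"
        by (simp add: powr_powr level_const_def algebra_simps flip: powr_add)
      then show ?thesis by (simp add: epowr_ennreal ennreal_minus ennreal_mult' flip: ennreal_mult'')
    qed
    finally have "epowr (\<phi> f r) \<tau> * (ennreal (1 / level_const \<tau>) * epowr (dy i) \<tau>)
       \<le> epowr (\<phi> f r) \<tau> * (\<integral>\<^sup>+x\<in>Q. epowr (w x) \<tau> \<partial>lebesgue)"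
      by (rule mult_left_mono) simp
    also have "\<dots> = (\<integral>\<^sup>+x. epowr (\<phi> f r) \<tau> * (epowr (w x) \<tau> * indicator Q x) \<partial>lebesgue)"
      by (rule nn_integral_cmult[symmetric]) measurable
    also have "\<dots> \<le> (\<integral>\<^sup>+x. epowr (w x * \<phi> f x) \<tau> * indicator (A i) x + epowr (w x * \<phi> f x) \<tau> * indicator (A (i + 1)) x \<partial>lebesgue)"
    proof (rule nn_integral_mono)
      fix x
      have "epowr (\<phi> f r) \<tau> * epowr (w x) \<tau> \<le> epowr (w x * \<phi> f x) \<tau>" if "r < x"
        using \<tau> that \<phi>_mono[of r x f] by (simp add: mult.commute epowr_mono mult_left_mono flip: epowr_mult)
      then show "epowr (\<phi> f r) \<tau> * (epowr (w x) \<tau> * indicator Q x)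
        \<le> epowr (w x * \<phi> f x) \<tau> * indicator (A i) x + epowr (w x * \<phi> f x) \<tau> * indicator (A (i + 1)) x"
        by (auto simp: Q_def indicator_def add_increasing2)
    qed
    also have "\<dots> = I i + I (i + 1)"
      unfolding I_def by (rule nn_integral_add) measurable
    finally have "ennreal (level_const \<tau>) * (ennreal (1 / level_const \<tau>) * epowr (dy i * \<phi> f r) \<tau>)
        \<le> ennreal (level_const \<tau>) * (I i + I (i + 1))"
      using \<tau> by (intro mult_left_mono) (simp_all add: epowr_mult mult_ac)
    also have "ennreal (level_const \<tau>) * (ennreal (1 / level_const \<tau>) * epowr (dy i * \<phi> f r) \<tau>) = epowr (dy i * \<phi> f r) \<tau>"
      using level_const_pos[OF \<tau>] by (simp flip: mult.assoc ennreal_mult)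
    finally have "dy i * \<phi> f r \<le> K"
      using \<tau> by (simp add: K_def epowr_le_swap)
    then have "dy (- i) * (dy i * \<phi> f r) \<le> dy (- i) * K" by (rule mult_left_mono) simp
    then show ?thesis by (simp del: of_int_minus minus_minus)
  qed
  then have "\<Phi> f i \<le> dy (- i) * K" by (rule \<Phi>_le[OF assms(1)])
  then have "dy i * \<Phi> f i \<le> dy i * (dy (- i) * K)" by (rule mult_left_mono) simp
  then have "dy i * \<Phi> f i \<le> K" by (simp del: of_int_minus minus_minus)
  then show ?thesis using \<tau> by (simp add: K_def epowr_le_swap)
qed

text \<open>Each level enters once as level \<open>i\<close> and once as the successor of another,
  hence the factor 2.\<close>

lemma \<Phi>_sum:
  assumes f [measurable]: "f \<in> borel_measurable lebesgue" and \<theta>: "\<theta> \<noteq> top"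
  shows "(\<Sum>n. epowr (dy (int_decode n) * \<Phi> f (int_decode n)) \<tau>) \<le> ennreal (2 * level_const \<tau>) * epowr (N f) \<tau>"
proof -
  define I where "I \<equiv> \<lambda>i. \<integral>\<^sup>+r\<in>A i. epowr (w r * \<phi> f r) \<tau> \<partial>lebesgue"
  have I: "(\<Sum>n. I (int_decode n + k)) \<le> epowr (N f) \<tau>" for k
    unfolding I_def epowr_N[OF \<theta>] by (rule suminf_nn_integral_A_le) auto
  have "(\<Sum>n. epowr (dy (int_decode n) * \<Phi> f (int_decode n)) \<tau>)
     \<le> (\<Sum>n. ennreal (level_const \<tau>) * (I (int_decode n + 0) + I (int_decode n + 1)))"
    using \<Phi>_level[OF f \<theta>] by (intro suminf_le) (auto simp: I_def)
  also have "\<dots> = ennreal (level_const \<tau>) * ((\<Sum>n. I (int_decode n + 0)) + (\<Sum>n. I (int_decode n + 1)))"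
    by (simp only: ennreal_suminf_cmult suminf_add summableI)
  also have "\<dots> \<le> ennreal (level_const \<tau>) * (epowr (N f) \<tau> + epowr (N f) \<tau>)"
    by (intro mult_left_mono add_mono I) auto
  also have "\<dots> = ennreal (2 * level_const \<tau>) * epowr (N f) \<tau>"
    using level_const_pos[OF \<tau>_pos[OF \<theta>]] by (simp add: ennreal_mult mult_2 mult.assoc flip: mult_2 mult.left_commute[of 2])
  finally show ?thesis .
qed

text \<open>For \<open>t\<close> in \<open>A i\<close> the number \<open>dy i\<close> is less than
  twice \<open>S t\<close>, and \<open>\<phi>_S_le_N\<close> bounds \<open>\<phi> f t * S t\<close>.
  This uniform bound replaces the sum over levels when \<open>\<theta>\<close> is infinite.\<close>

lemma \<Phi>_top_le:
  assumes f: "f \<in> borel_measurable lebesgue" and fin: "\<And>r. II f (ball 0 r) < top"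
  shows "dy i * \<Phi> f i \<le> 2 * N f"
proof -
  have "\<phi> f t \<le> dy (- (i + 1)) * N f" if t: "t \<in> A i" for t
  proof (cases "t = 0")
    case True
    then show ?thesis using p2_pos by (simp add: \<phi>_def wint_def)
  next
    case False
    then have "0 < t" using t by (auto simp: A_iff)
    have "dy (i + 1) * \<phi> f t \<le> S t * \<phi> f t" using t by (intro mult_right_mono) (auto simp: A_iff)
    also have "\<dots> \<le> N f" using \<phi>_S_le_N[OF \<open>0 < t\<close> fin] by (simp add: mult.commute)
    finally have "dy (- (i + 1)) * (dy (i + 1) * \<phi> f t) \<le> dy (- (i + 1)) * N f" by (rule mult_left_mono) simp
    then show ?thesis unfolding dy_cancel3 .
  qed
  then have "dy i * \<Phi> f i \<le> dy i * (dy (- (i + 1)) * N f)"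
    by (intro mult_left_mono \<Phi>_le[OF f]) auto
  also have "dy i * (dy (- (i + 1)) * N f) = dy (- 1) * N f"
    unfolding mult.assoc[symmetric] dy_mult by simp
  finally show ?thesis by simp
qed

text \<open>On the shell over \<open>A i\<close> the best constant is at most \<open>dy i\<close>
  times the supremum, so the shell contributes a multiple of the \<open>p1\<close>-th power of
  \<open>dy i * \<Phi> f i\<close>. Since \<open>\<tau> \<le> p1\<close>, the sum of these powers is
  controlled by the sum of \<open>\<tau>\<close>-th powers in \<open>\<Phi>_sum\<close>.\<close>

lemma upper_small_theta:
  assumes le: "\<theta> \<le> ennreal p1"
  shows "J \<le> ennreal ((2 * level_const \<tau>) powr (1 / \<tau>)) * (SUP t\<in>{0<..}. epowr (S t) (- 1) * G t)"
proof (rule J_leI)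
  fix f :: "'a \<Rightarrow> real" assume f: "f \<in> borel_measurable lebesgue"
  define a where "a = (SUP t\<in>{0<..}. epowr (S t) (- 1) * G t)"
  have \<theta>: "\<theta> \<noteq> top" using le by (auto simp: top_unique)
  note \<tau> = \<tau>_pos[OF \<theta>]
  have "\<tau> \<le> p1" using le p1_pos enn2real_mono[of \<theta> "ennreal p1"] by simp
  have U: "U (X i) \<le> a * dy i" for i
  proof (rule U_X_le)
    fix t t' assume t: "t \<in> A i" "t' \<in> A i" "t < t'"
    then have "0 < t'" by (auto simp: A_iff)
    obtain x where x: "S t' = ennreal x" "0 < x"
      using S_finite[OF \<open>0 < t'\<close>] S_pos[of t'] by (cases "S t'") auto
    have "G t' = S t' * (epowr (S t') (- 1) * G t')"
      using x by (simp add: epowr_ennreal powr_minus flip: mult.assoc ennreal_mult)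
    also have "\<dots> \<le> dy i * a"
      using t \<open>0 < t'\<close> unfolding a_def by (intro mult_mono SUP_upper) (auto simp: A_iff)
    finally show "G t' \<le> a * dy i" by (simp add: mult.commute)
  qed
  have "MM f UNIV \<le> (\<Sum>n. MM f (X (int_decode n)))" by (rule MM_le_suminf[OF f])
  also have "\<dots> \<le> (\<Sum>n. epowr a p1 * epowr (epowr (dy (int_decode n) * \<Phi> f (int_decode n)) \<tau>) (p1 / \<tau>))"
  proof (intro suminf_le summableI)
    fix n
    define i where "i = int_decode n"
    have "MM f (X i) \<le> epowr (U (X i) * \<Phi> f i) p1" by (rule MM_X_le[OF f])
    also have "\<dots> \<le> epowr (a * dy i * \<Phi> f i) p1"
      using p1_pos by (intro epowr_mono mult_right_mono U) auto
    finally show "MM f (X i) \<le> epowr a p1 * epowr (epowr (dy i * \<Phi> f i) \<tau>) (p1 / \<tau>)"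
      using p1_pos \<tau> by (simp add: epowr_epowr epowr_mult mult.assoc)
  qed
  also have "\<dots> \<le> epowr a p1 * epowr (\<Sum>n. epowr (dy (int_decode n) * \<Phi> f (int_decode n)) \<tau>) (p1 / \<tau>)"
    using \<tau> \<open>\<tau> \<le> p1\<close> by (subst ennreal_suminf_cmult) (intro mult_left_mono suminf_epowr_le, auto)
  also have "\<dots> \<le> epowr a p1 * epowr (ennreal (2 * level_const \<tau>) * epowr (N f) \<tau>) (p1 / \<tau>)"
    using \<tau> p1_pos by (intro mult_left_mono epowr_mono \<Phi>_sum[OF f \<theta>]) auto
  also have "\<dots> = epowr (ennreal ((2 * level_const \<tau>) powr (1 / \<tau>)) * a * N f) p1"
    using \<tau> p1_pos level_const_pos[OF \<tau>] by (simp add: epowr_mult epowr_epowr epowr_ennreal powr_powr mult_ac)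
  finally show "epowr (MM f UNIV) (1 / p1) \<le> ennreal ((2 * level_const \<tau>) powr (1 / \<tau>)) * a * N f"
    using p1_pos by (simp add: epowr_le_swap)
qed

section \<open>The upper bound for \<theta> above \<open>p1\<close>\<close>

lemma G_0: "G 0 = U UNIV" by (simp add: G_def)

text \<open>Counterpart of \<open>\<Phi>_level\<close> on the Stieltjes side. If 0 is not in
  \<open>D (i - 1)\<close>, the growth of \<open>h\<close> over two levels puts enough mass below
  \<open>t'\<close>, where \<open>G\<close> is at least \<open>G t'\<close>. Otherwise, for nonempty
  \<open>A i\<close>, the tail norm at 0 is comparable with \<open>dy i\<close>, and the second
  summand of (b), placed as an atom \<open>B\<close> at 0, gives the bound.\<close>

lemma U_level:
  assumes \<rho>: "0 < \<rho>"
  defines "g \<equiv> \<lambda>t. epowr (G t) \<rho> * indicator {0<..} t"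
    and "B \<equiv> epowr (epowr (S 0) (- 1) * U UNIV) \<rho>"
  defines "I \<equiv> \<lambda>i. (\<integral>\<^sup>+t\<in>A i. g t \<partial>ls_measure (h \<rho>)) + B * indicator (A i) 0"
  shows "epowr (dy (- i) * U (X i)) \<rho> \<le> ennreal (jump_const \<rho>) * (I (i - 1) + I i)"
proof (cases "0 \<in> D (i - 1)")
  case True
  show ?thesis
  proof (cases "A i = {}")
    case True
    then have "U (X i) \<le> 0" by (intro U_X_le) auto
    then show ?thesis using \<rho> by simp
  next
    case False
    then obtain t where t: "t \<in> A i" by blast
    \<comment> \<open>A point of \<open>A i\<close> keeps 0 out of \<open>D (i + 1)\<close>, so 0
      lies in one of the two levels and the atom is counted.\<close>
    then have "0 \<notin> D (i + 1)" using D_up[of 0 "i + 1" t] by (auto simp: A_iff D_def)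
    with True have 0: "0 \<in> A (i - 1) \<union> A i" by (auto simp: A_def)
    have "epowr (dy (i - 1)) (- 1) \<le> epowr (S 0) (- 1)"
      using True by (intro epowr_antimono) (auto simp: D_def)
    also have "epowr (dy (i - 1)) (- 1) = ennreal ((2 powr (- real_of_int (i - 1))) powr (- 1))"
      by (simp add: epowr_ennreal)
    also have "\<dots> = dy (- (i - 1))" by (subst powr_powr) simp
    finally have "2 * dy (- (i - 1)) \<le> 2 * epowr (S 0) (- 1)" by (rule mult_left_mono) simp
    moreover have "dy (- i) = dy (- 1) * dy (- (i - 1))" by (subst dy_mult) simp
    moreover have "dy (- 1) = 2" by simp
    ultimately have "dy (- i) \<le> 2 * epowr (S 0) (- 1)" by metis
    then have "dy (- i) * U (X i) \<le> (2 * epowr (S 0) (- 1)) * U UNIV"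
      by (intro mult_mono U_mono) auto
    then have "epowr (dy (- i) * U (X i)) \<rho> \<le> epowr 2 \<rho> * B"
      unfolding B_def using \<rho> by (simp add: epowr_mono mult.assoc flip: epowr_mult)
    also have "\<dots> \<le> ennreal (jump_const \<rho>) * (I (i - 1) + I i)"
    proof (rule mult_mono)
      show "epowr 2 \<rho> \<le> ennreal (jump_const \<rho>)"
        using epowr_ennreal[of 2 \<rho>] by (simp add: jump_const_def ennreal_leI)
      show "B \<le> I (i - 1) + I i" using 0 by (auto simp: I_def add_increasing add_increasing2)
    qed auto
    finally show ?thesis .
  qed
next
  case False
  have "(\<lambda>x. g x * indicator (A j) x) \<in> borel_measurable borel" for j unfolding g_def by measurable
  then have m: "(\<lambda>x. g x * indicator (A j) x) \<in> borel_measurable (ls_measure (h \<rho>))" for j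
    by (simp add: measurable_cong_sets[OF sets_ls_measure refl])
  have cancel: "ennreal (1 / d) * (x * ennreal (d * P)) = x * ennreal P" if "0 < d" "0 \<le> P" for x d P
  proof -
    have "ennreal (1 / d) * (x * ennreal (d * P)) = x * (ennreal (1 / d) * ennreal (d * P))"
      by (simp only: mult_ac)
    also have "ennreal (1 / d) * ennreal (d * P) = ennreal P" using that by (simp flip: ennreal_mult)
    finally show ?thesis .
  qed
  define K where "K = epowr (ennreal (jump_const \<rho>) * (I (i - 1) + I i)) (1 / \<rho>)"
  have "U (X i) \<le> dy i * K"
  proof (rule U_X_le)
    fix t t' assume t: "t \<in> A i" "t' \<in> A i" "t < t'"
    define Q where "Q = (A (i - 1) \<union> A i) \<inter> {0<..<t'}"
    have Q [measurable]: "Q \<in> sets borel" unfolding Q_def by measurable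
    have "epowr (G t') \<rho> * ennreal ((1 - 2 powr (- \<rho>)) * 2 powr (real_of_int i * \<rho>))
      \<le> epowr (G t') \<rho> * emeasure (ls_measure (h \<rho>)) Q"
      unfolding Q_def by (intro mult_left_mono emeasure_two_levels[OF \<rho> t False]) auto
    also have "\<dots> = (\<integral>\<^sup>+x. epowr (G t') \<rho> * indicator Q x \<partial>ls_measure (h \<rho>))"
      by (rule nn_integral_cmult_indicator[symmetric]) simp
    also have "\<dots> \<le> (\<integral>\<^sup>+x. g x * indicator (A (i - 1)) x + g x * indicator (A i) x \<partial>ls_measure (h \<rho>))"
    proof (rule nn_integral_mono)
      fix x
      have "epowr (G t') \<rho> \<le> g x" if "x \<in> Q"
        using that \<rho> G_antimono[of x t'] by (auto simp: g_def Q_def epowr_mono)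
      then show "epowr (G t') \<rho> * indicator Q x \<le> g x * indicator (A (i - 1)) x + g x * indicator (A i) x"
        by (auto simp: Q_def indicator_def add_increasing add_increasing2)
    qed
    also have "\<dots> = (\<integral>\<^sup>+t\<in>A (i - 1). g t \<partial>ls_measure (h \<rho>)) + (\<integral>\<^sup>+t\<in>A i. g t \<partial>ls_measure (h \<rho>))"
      by (rule nn_integral_add) (rule m)+
    also have "\<dots> \<le> I (i - 1) + I i" unfolding I_def by (intro add_mono) auto
    finally have "ennreal (1 / (1 - 2 powr (- \<rho>))) * (epowr (G t') \<rho> * ennreal ((1 - 2 powr (- \<rho>)) * 2 powr (real_of_int i * \<rho>)))
      \<le> ennreal (jump_const \<rho>) * (I (i - 1) + I i)"
      by (intro mult_mono) (auto simp: jump_const_def intro!: ennreal_leI)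
    also have "ennreal (1 / (1 - 2 powr (- \<rho>))) * (epowr (G t') \<rho> * ennreal ((1 - 2 powr (- \<rho>)) * 2 powr (real_of_int i * \<rho>)))
      = epowr (G t') \<rho> * ennreal (2 powr (real_of_int i * \<rho>))"
      using powr_less_mono[of "- \<rho>" 0 2] \<rho> by (intro cancel) auto
    also have "epowr (G t') \<rho> * ennreal (2 powr (real_of_int i * \<rho>)) = epowr (dy (- i) * G t') \<rho>"
      using \<rho> by (simp add: epowr_mult epowr_ennreal powr_powr mult.commute)
    finally have "dy (- i) * G t' \<le> K" using \<rho> by (simp only: K_def epowr_le_swap)
    then have "dy i * (dy (- i) * G t') \<le> dy i * K" by (rule mult_left_mono) simp
    then show "G t' \<le> dy i * K" unfolding dy_cancel2 .
  qed
  then have "dy (- i) * U (X i) \<le> dy (- i) * (dy i * K)" by (rule mult_left_mono) simp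
  then have "dy (- i) * U (X i) \<le> K" unfolding dy_cancel3 .
  then show ?thesis using \<rho> unfolding K_def by (simp only: epowr_le_swap)
qed

text \<open>The right-hand side of (b). If \<open>S 0\<close> is infinite, its power
  \<open>- 1\<close> is 0 and the second summand vanishes, even for infinite
  \<open>U UNIV\<close>.\<close>

definition Rhs :: "real \<Rightarrow> ennreal" where
  "Rhs \<rho> = epowr (\<integral>\<^sup>+t\<in>{0<..}. epowr (G t) \<rho> \<partial>ls_measure (h \<rho>)) (1 / \<rho>) + epowr (S 0) (- 1) * U UNIV"

text \<open>The integral and the atom are each at most the \<open>\<rho>\<close>-th power of
  \<open>Rhs \<rho>\<close>, and each level is used twice, which gives the factor 4.\<close>

lemma U_sum:
  assumes \<rho>: "0 < \<rho>"
  shows "(\<Sum>n. epowr (dy (- int_decode n) * U (X (int_decode n))) \<rho>) \<le> ennreal (4 * jump_const \<rho>) * epowr (Rhs \<rho>) \<rho>"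
proof -
  define g where "g \<equiv> \<lambda>t. epowr (G t) \<rho> * indicator {0<..} t"
  define B where "B \<equiv> epowr (epowr (S 0) (- 1) * U UNIV) \<rho>"
  define I where "I \<equiv> \<lambda>i. (\<integral>\<^sup>+t\<in>A i. g t \<partial>ls_measure (h \<rho>)) + B * indicator (A i) 0"
  have "g \<in> borel_measurable borel" unfolding g_def by measurable
  then have [measurable]: "g \<in> borel_measurable (ls_measure (h \<rho>))"
    by (simp add: measurable_cong_sets[OF sets_ls_measure refl])
  have I: "(\<Sum>n. I (int_decode n + k)) \<le> 2 * epowr (Rhs \<rho>) \<rho>" for k
  proof -
    have "(\<Sum>n. I (int_decode n + k)) = (\<Sum>n. \<integral>\<^sup>+t\<in>A (int_decode n + k). g t \<partial>ls_measure (h \<rho>)) + B * (\<Sum>n. indicator (A (int_decode n + k)) 0)"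
      unfolding I_def by (simp only: suminf_add[symmetric] summableI ennreal_suminf_cmult)
    also have "\<dots> \<le> (\<integral>\<^sup>+t. g t \<partial>ls_measure (h \<rho>)) + B * 1"
      by (intro add_mono mult_left_mono suminf_nn_integral_A_le) (auto simp: suminf_indicator_A)
    also have "(\<integral>\<^sup>+t. g t \<partial>ls_measure (h \<rho>)) = epowr (epowr (\<integral>\<^sup>+t\<in>{0<..}. epowr (G t) \<rho> \<partial>ls_measure (h \<rho>)) (1 / \<rho>)) \<rho>"
      using \<rho> by (simp add: g_def)
    also have "\<dots> \<le> epowr (Rhs \<rho>) \<rho>" unfolding Rhs_def using \<rho> by (intro epowr_mono) auto
    also have "B * 1 \<le> epowr (Rhs \<rho>) \<rho>" unfolding Rhs_def B_def using \<rho> by (simp add: epowr_mono add_increasing)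
    finally show ?thesis by (simp add: add_mono mult_2)
  qed
  have "(\<Sum>n. epowr (dy (- int_decode n) * U (X (int_decode n))) \<rho>)
    \<le> (\<Sum>n. ennreal (jump_const \<rho>) * (I (int_decode n + (- 1)) + I (int_decode n + 0)))"
  proof (intro suminf_le summableI)
    fix n
    show "epowr (dy (- int_decode n) * U (X (int_decode n))) \<rho> \<le> ennreal (jump_const \<rho>) * (I (int_decode n + (- 1)) + I (int_decode n + 0))"
      using U_level[OF \<rho>, of "int_decode n"] unfolding I_def g_def B_def by (simp only: diff_conv_add_uminus add_0_right)
  qed
  also have "\<dots> = ennreal (jump_const \<rho>) * ((\<Sum>n. I (int_decode n + (- 1))) + (\<Sum>n. I (int_decode n + 0)))"
    by (simp only: ennreal_suminf_cmult suminf_add summableI)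
  also have "\<dots> \<le> ennreal (jump_const \<rho>) * (2 * epowr (Rhs \<rho>) \<rho> + 2 * epowr (Rhs \<rho>) \<rho>)"
    by (intro mult_left_mono add_mono I) auto
  also have "2 * epowr (Rhs \<rho>) \<rho> + 2 * epowr (Rhs \<rho>) \<rho> = 4 * epowr (Rhs \<rho>) \<rho>"
    by (simp flip: distrib_right)
  also have "ennreal (jump_const \<rho>) * (4 * epowr (Rhs \<rho>) \<rho>) = ennreal (4 * jump_const \<rho>) * epowr (Rhs \<rho>) \<rho>"
    using jump_const_pos[of \<rho>] by (simp add: ennreal_mult mult_ac)
  finally show ?thesis .
qed

text \<open>The shell contributions factor as \<open>y n * z n\<close>, with cancelling powers of 2
  put into the two factors. Hoelder's inequality with exponents \<open>p1 / \<tau>\<close> and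
  \<open>p1 / \<rho>\<close> pairs \<open>\<Phi>_sum\<close> with \<open>U_sum\<close>; for infinite
  \<open>\<theta>\<close> the first factor is bounded uniformly and
  \<open>\<rho> = p1\<close>.\<close>

lemma upper_large_theta:
  assumes \<rho>: "0 < \<rho>" and top: "\<theta> = top \<Longrightarrow> \<rho> = p1" and conj: "\<theta> \<noteq> top \<Longrightarrow> p1 / \<tau> + p1 / \<rho> = 1"
  shows "J \<le> ennreal ((if \<theta> = top then 2 else (2 * level_const \<tau>) powr (1 / \<tau>)) * (4 * jump_const \<rho>) powr (1 / \<rho>)) * Rhs \<rho>"
proof (rule J_leI)
  fix f :: "'a \<Rightarrow> real" assume f: "f \<in> borel_measurable lebesgue" and fin: "\<And>r. II f (ball 0 r) < top"
  define y where "y = (\<lambda>n. dy (int_decode n) * \<Phi> f (int_decode n))"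
  define z where "z = (\<lambda>n. dy (- int_decode n) * U (X (int_decode n)))"
  have "MM f UNIV \<le> (\<Sum>n. MM f (X (int_decode n)))" by (rule MM_le_suminf[OF f])
  also have "\<dots> \<le> (\<Sum>n. epowr (y n) p1 * epowr (z n) p1)"
  proof (intro suminf_le summableI)
    fix n
    define i where "i = int_decode n"
    have "MM f (X i) \<le> epowr (U (X i) * \<Phi> f i) p1" by (rule MM_X_le[OF f])
    also have "U (X i) * \<Phi> f i = dy i * (dy (- i) * (U (X i) * \<Phi> f i))" unfolding dy_cancel2 ..
    also have "\<dots> = y n * z n" by (simp only: y_def z_def i_def mult_ac)
    finally show "MM f (X i) \<le> epowr (y n) p1 * epowr (z n) p1" using p1_pos by (simp add: epowr_mult)
  qed
  finally have 1: "MM f UNIV \<le> (\<Sum>n. epowr (y n) p1 * epowr (z n) p1)" .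
  define C where "C = (if \<theta> = top then 2 else (2 * level_const \<tau>) powr (1 / \<tau>))"
  have C: "0 < C" using level_const_pos[OF \<tau>_pos] by (cases "\<theta> = top") (force simp: C_def)+
  have "(\<Sum>n. epowr (y n) p1 * epowr (z n) p1) \<le> epowr (ennreal C * N f) p1 * epowr (ennreal (4 * jump_const \<rho>) * epowr (Rhs \<rho>) \<rho>) (p1 / \<rho>)"
  proof (cases "\<theta> = top")
    case True
    have "(\<Sum>n. epowr (y n) p1 * epowr (z n) p1) \<le> (\<Sum>n. epowr (ennreal C * N f) p1 * epowr (z n) p1)"
      using p1_pos True \<Phi>_top_le[OF f fin] unfolding y_def by (intro suminf_le mult_right_mono epowr_mono) (auto simp: C_def)
    also have "\<dots> = epowr (ennreal C * N f) p1 * (\<Sum>n. epowr (z n) p1)" by simp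
    also have "\<dots> \<le> epowr (ennreal C * N f) p1 * (ennreal (4 * jump_const \<rho>) * epowr (Rhs \<rho>) \<rho>)"
      using U_sum[OF \<rho>] top[OF True] unfolding z_def by (intro mult_left_mono) auto
    finally show ?thesis using top[OF True] p1_pos by simp
  next
    case False
    note \<tau> = \<tau>_pos[OF False]
    have "(\<Sum>n. epowr (y n) p1 * epowr (z n) p1) = (\<Sum>n. epowr (epowr (y n) \<tau>) (p1 / \<tau>) * epowr (epowr (z n) \<rho>) (p1 / \<rho>))"
      using \<tau> \<rho> p1_pos by (simp add: epowr_epowr)
    also have "\<dots> \<le> epowr (\<Sum>n. epowr (y n) \<tau>) (p1 / \<tau>) * epowr (\<Sum>n. epowr (z n) \<rho>) (p1 / \<rho>)"
      using \<tau> \<rho> p1_pos conj[OF False] by (intro suminf_Hoelder) auto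
    also have "\<dots> \<le> epowr (ennreal (2 * level_const \<tau>) * epowr (N f) \<tau>) (p1 / \<tau>) * epowr (ennreal (4 * jump_const \<rho>) * epowr (Rhs \<rho>) \<rho>) (p1 / \<rho>)"
      using \<tau> \<rho> p1_pos \<Phi>_sum[OF f False] U_sum[OF \<rho>] unfolding y_def z_def
      by (intro mult_mono epowr_mono) auto
    also have "epowr (ennreal (2 * level_const \<tau>) * epowr (N f) \<tau>) (p1 / \<tau>) = epowr (ennreal C * N f) p1"
      using \<tau> p1_pos False level_const_pos[OF \<tau>] by (simp add: C_def epowr_mult epowr_epowr epowr_ennreal powr_powr)
    finally show ?thesis .
  qed
  also have "\<dots> = epowr (ennreal (C * (4 * jump_const \<rho>) powr (1 / \<rho>)) * Rhs \<rho> * N f) p1"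
  proof -
    obtain c where c: "4 * jump_const \<rho> = c" "0 < c" using jump_const_pos[of \<rho>] by simp
    show ?thesis unfolding c(1) using \<rho> p1_pos C c(2)
    by (simp add: epowr_mult epowr_epowr epowr_ennreal powr_powr ennreal_mult mult_ac)
  qed
  finally show "epowr (MM f UNIV) (1 / p1) \<le> ennreal (C * (4 * jump_const \<rho>) powr (1 / \<rho>)) * Rhs \<rho> * N f"
    using 1 p1_pos by (simp add: epowr_le_swap)
qed

end

section \<open>Lower bounds\<close>

text \<open>Convexity of the power \<open>e\<close> with weights \<open>c i / C\<close>. Vanishing
  \<open>a i\<close> are removed first, since convexity is used on the open half-line, and restored
  at the end by monotonicity of the sums.\<close>

lemma sum_powr_Jensen:
  fixes a c :: "'i \<Rightarrow> real"
  assumes F: "finite F" and c: "\<And>i. i \<in> F \<Longrightarrow> 0 < c i" and a: "\<And>i. i \<in> F \<Longrightarrow> 0 \<le> a i" and e: "1 \<le> e"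
  shows "(\<Sum>i\<in>F. c i * a i) powr e \<le> (\<Sum>i\<in>F. c i) powr (e - 1) * (\<Sum>i\<in>F. c i * a i powr e)"
proof -
  define H where "H = {i \<in> F. 0 < a i}"
  have H: "finite H" "H \<subseteq> F" using F by (auto simp: H_def)
  have "(\<Sum>i\<in>F. c i * a i) = (\<Sum>i\<in>H. c i * a i)"
    using a F by (intro sum.mono_neutral_right) (force simp: H_def)+
  moreover have "(\<Sum>i\<in>H. c i * a i) powr e \<le> (\<Sum>i\<in>F. c i) powr (e - 1) * (\<Sum>i\<in>F. c i * a i powr e)"
  proof (cases "H = {}")
    case True
    then show ?thesis using c by (auto intro!: mult_nonneg_nonneg sum_nonneg simp: less_imp_le)
  next
    case False
    define C where "C = (\<Sum>i\<in>H. c i)"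
    have C: "0 < C" unfolding C_def using False H c by (intro sum_pos) auto
    have "(\<Sum>i\<in>H. (c i / C) *\<^sub>R a i) powr e \<le> (\<Sum>i\<in>H. (c i / C) * a i powr e)"
      using H(1) False powr_convex[OF e]
    proof (rule convex_on_sum)
      show "(\<Sum>i\<in>H. c i / C) = 1" using C by (simp add: C_def flip: sum_divide_distrib)
      show "0 \<le> c i / C" if "i \<in> H" for i using that H c[of i] C by (auto intro!: divide_nonneg_pos simp: less_imp_le)
      show "a i \<in> {0<..}" if "i \<in> H" for i using that by (simp add: H_def)
    qed
    then have "C powr e * ((\<Sum>i\<in>H. c i * a i) / C) powr e \<le> C powr e * ((\<Sum>i\<in>H. c i * a i powr e) / C)"
      by (intro mult_left_mono) (simp_all add: sum_divide_distrib)
    also have "C powr e * ((\<Sum>i\<in>H. c i * a i) / C) powr e = (\<Sum>i\<in>H. c i * a i) powr e"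
      using C H a c by (subst powr_mult[symmetric]) (auto intro!: divide_nonneg_pos sum_nonneg mult_nonneg_nonneg simp: less_imp_le)
    also have "C powr e * ((\<Sum>i\<in>H. c i * a i powr e) / C) = C powr (e - 1) * (\<Sum>i\<in>H. c i * a i powr e)"
      using C by (simp add: powr_diff)
    also have "\<dots> \<le> (\<Sum>i\<in>F. c i) powr (e - 1) * (\<Sum>i\<in>F. c i * a i powr e)"
      unfolding C_def using F H c e
      by (intro mult_mono powr_mono2 sum_mono2 sum_nonneg mult_nonneg_nonneg) (auto intro: less_imp_le)
    finally show ?thesis .
  qed
  ultimately show ?thesis by simp
qed

text \<open>The exponents \<open>nat (k - i)\<close> are distinct, so the sum is part of a geometric
  series.\<close>

lemma sum_geometric_le:
  assumes F: "finite F" "\<And>i. i \<in> F \<Longrightarrow> i \<le> (k::int)" and a: "0 < a"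
  shows "(\<Sum>i\<in>F. 2 powr (- (real_of_int (k - i) * a))) \<le> 1 / (1 - 2 powr (- a))"
proof -
  have lt: "2 powr (- a) < 1" using powr_less_mono[of "- a" 0 2] a by simp
  have "(\<Sum>i\<in>F. 2 powr (- (real_of_int (k - i) * a))) = (\<Sum>i\<in>F. (2 powr (- a)) ^ nat (k - i))"
  proof (rule sum.cong)
    fix i assume "i \<in> F"
    then have "real (nat (k - i)) = real_of_int (k - i)" using F by simp
    then show "2 powr (- (real_of_int (k - i) * a)) = (2 powr (- a)) ^ nat (k - i)"
      by (simp add: powr_powr mult.commute del: of_int_diff flip: powr_realpow)
  qed simp
  also have "\<dots> = (\<Sum>n\<in>(\<lambda>i. nat (k - i)) ` F. (2 powr (- a)) ^ n)"
  proof (subst sum.reindex)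
    show "inj_on (\<lambda>i. nat (k - i)) F"
    proof (rule inj_onI)
      fix x y assume "x \<in> F" "y \<in> F" "nat (k - x) = nat (k - y)"
      then show "x = y" using F(2)[of x] F(2)[of y] by (simp add: eq_nat_nat_iff)
    qed
  qed simp
  also have "\<dots> \<le> (\<Sum>n. (2 powr (- a)) ^ n)"
    using F lt by (intro sum_le_suminf summable_geometric) auto
  also have "\<dots> = 1 / (1 - 2 powr (- a))" using lt by (intro suminf_geometric) simp
  finally show ?thesis .
qed

text \<open>Each \<open>c i\<close> is a geometric factor times the largest weighted term, so the whole sum is
  controlled by that term; this replaces a Hardy inequality for all exponents at once.\<close>

lemma sum_powr_le_geometric:
  assumes F: "finite F" "\<And>i. i \<in> F \<Longrightarrow> i \<le> (k::int)" and a: "0 < a" and e: "0 < e"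
    and c: "\<And>i. i \<in> F \<Longrightarrow> 0 \<le> c i"
  shows "(\<Sum>i\<in>F. c i) powr e \<le> (1 / (1 - 2 powr (- a))) powr e * (\<Sum>i\<in>F. (2 powr (real_of_int (k - i) * a) * c i) powr e)"
proof (cases "F = {}")
  case False
  define m where "m = Max ((\<lambda>i. 2 powr (real_of_int (k - i) * a) * c i) ` F)"
  have "m \<in> (\<lambda>i. 2 powr (real_of_int (k - i) * a) * c i) ` F" unfolding m_def using F False by (intro Max_in) auto
  then obtain j where j: "j \<in> F" "m = 2 powr (real_of_int (k - j) * a) * c j" by blast
  then have m: "0 \<le> m" using c by simp
  have "c i \<le> 2 powr (- (real_of_int (k - i) * a)) * m" if "i \<in> F" for i
  proof -
    have "2 powr (real_of_int (k - i) * a) * c i \<le> m" unfolding m_def using F that by (intro Max_ge) auto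
    then have "2 powr (- (real_of_int (k - i) * a)) * (2 powr (real_of_int (k - i) * a) * c i) \<le> 2 powr (- (real_of_int (k - i) * a)) * m"
      by (rule mult_left_mono) simp
    then show ?thesis by (simp flip: mult.assoc powr_add del: of_int_diff)
  qed
  then have "(\<Sum>i\<in>F. c i) \<le> (\<Sum>i\<in>F. 2 powr (- (real_of_int (k - i) * a))) * m"
    unfolding sum_distrib_right by (rule sum_mono)
  also have "\<dots> \<le> (1 / (1 - 2 powr (- a))) * m"
    using m by (intro mult_right_mono sum_geometric_le F a)
  finally have "(\<Sum>i\<in>F. c i) powr e \<le> ((1 / (1 - 2 powr (- a))) * m) powr e"
    using e c by (intro powr_mono2) (auto intro: sum_nonneg)
  also have "\<dots> = (1 / (1 - 2 powr (- a))) powr e * m powr e"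
    by (rule powr_mult)
  also have "\<dots> \<le> (1 / (1 - 2 powr (- a))) powr e * (\<Sum>i\<in>F. (2 powr (real_of_int (k - i) * a) * c i) powr e)"
    unfolding j(2) using F j(1) by (intro mult_left_mono member_le_sum) auto
  finally show ?thesis .
qed simp

section \<open>Test functions combined from several pieces\<close>

context weight_pair
begin

text \<open>Jensen's inequality at each point with \<open>e = p2 / p1\<close> gives a bound linear
  in the \<open>p2\<close>-th powers of the pieces; integrating with
  \<open>II (g i) UNIV \<le> 1\<close> leaves \<open>C powr (e - 1) * C\<close>. As \<open>f\<close>
  is prescribed only on \<open>Y\<close>, pieces vanishing on \<open>Y\<close> can be left out of
  \<open>F\<close>.\<close>

lemma II_combination_le:
  fixes g :: "'i \<Rightarrow> 'a \<Rightarrow> real"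
  assumes F: "finite F" and c: "\<And>i. i \<in> F \<Longrightarrow> 0 < c i"
    and g [measurable]: "\<And>i. i \<in> F \<Longrightarrow> g i \<in> borel_measurable lebesgue" and 1: "\<And>i. i \<in> F \<Longrightarrow> II (g i) UNIV \<le> 1"
    and f: "\<And>x. x \<in> Y \<Longrightarrow> f x = (\<Sum>i\<in>F. c i * \<bar>g i x\<bar> powr p1) powr (1 / p1)"
  shows "II f Y \<le> ennreal ((\<Sum>i\<in>F. c i) powr (p2 / p1))"
proof -
  define e where "e = p2 / p1"
  have e: "1 \<le> e" using p1_pos p12 by (simp add: e_def)
  define C where "C = (\<Sum>i\<in>F. c i)"
  have C: "0 \<le> C" unfolding C_def using c by (intro sum_nonneg) (auto intro: less_imp_le)
  have "II f Y \<le> (\<Sum>i\<in>F. ennreal (C powr (e - 1) * c i) * II (g i) UNIV)"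
  proof -
    have "II f Y \<le> (\<integral>\<^sup>+x. (\<Sum>i\<in>F. ennreal (C powr (e - 1) * c i) * ennreal (\<bar>g i x\<bar> powr p2 * v2 x)) \<partial>lebesgue)"
      unfolding wint_def
    proof (rule nn_integral_mono_AE)
      from v_pos show "AE x in lebesgue. ennreal (\<bar>f x\<bar> powr p2 * v2 x) * indicator Y x
        \<le> (\<Sum>i\<in>F. ennreal (C powr (e - 1) * c i) * ennreal (\<bar>g i x\<bar> powr p2 * v2 x))"
      proof eventually_elim
        case (elim x)
        show ?case
        proof (cases "x \<in> Y")
          case True
          have "\<bar>f x\<bar> powr p2 = (\<Sum>i\<in>F. c i * \<bar>g i x\<bar> powr p1) powr e"
            using f[OF True] by (simp add: powr_powr e_def)
          also have "\<dots> \<le> C powr (e - 1) * (\<Sum>i\<in>F. c i * (\<bar>g i x\<bar> powr p1) powr e)"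
            unfolding C_def using F c e by (intro sum_powr_Jensen) auto
          also have "\<dots> = (\<Sum>i\<in>F. C powr (e - 1) * c i * \<bar>g i x\<bar> powr p2)"
            using p1_pos by (simp add: powr_powr e_def sum_distrib_left mult.assoc)
          finally have "\<bar>f x\<bar> powr p2 * v2 x \<le> (\<Sum>i\<in>F. C powr (e - 1) * c i * (\<bar>g i x\<bar> powr p2 * v2 x))"
            using elim mult_right_mono[of _ _ "v2 x"] by (fastforce simp: sum_distrib_right mult.assoc)
          then have "ennreal (\<bar>f x\<bar> powr p2 * v2 x) \<le> ennreal (\<Sum>i\<in>F. C powr (e - 1) * c i * (\<bar>g i x\<bar> powr p2 * v2 x))"
            by (rule ennreal_leI)
          also have "\<dots> = (\<Sum>i\<in>F. ennreal (C powr (e - 1) * c i * (\<bar>g i x\<bar> powr p2 * v2 x)))"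
            using c elim by (intro sum_ennreal[symmetric]) (auto intro!: mult_nonneg_nonneg simp: less_imp_le)
          also have "\<dots> = (\<Sum>i\<in>F. ennreal (C powr (e - 1) * c i) * ennreal (\<bar>g i x\<bar> powr p2 * v2 x))"
            using c elim by (intro sum.cong refl ennreal_mult) (auto intro!: mult_nonneg_nonneg simp: less_imp_le)
          finally show ?thesis using True by simp
        qed simp
      qed
    qed
    also have "\<dots> = (\<Sum>i\<in>F. \<integral>\<^sup>+x. ennreal (C powr (e - 1) * c i) * ennreal (\<bar>g i x\<bar> powr p2 * v2 x) \<partial>lebesgue)"
      by (rule nn_integral_sum) measurable
    also have "\<dots> = (\<Sum>i\<in>F. ennreal (C powr (e - 1) * c i) * II (g i) UNIV)"
      unfolding wint_def by (intro sum.cong refl) (simp add: nn_integral_cmult)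
    finally show ?thesis .
  qed
  also have "\<dots> \<le> (\<Sum>i\<in>F. ennreal (C powr (e - 1) * c i) * 1)"
    using 1 by (intro sum_mono mult_left_mono) auto
  also have "\<dots> = ennreal (\<Sum>i\<in>F. C powr (e - 1) * c i)"
    using c by (simp add: less_imp_le)
  also have "(\<Sum>i\<in>F. C powr (e - 1) * c i) = C powr (e - 1) * C" by (simp add: C_def sum_distrib_left)
  also have "\<dots> = C powr e" using C by (cases "C = 0") (auto simp: powr_diff)
  finally show ?thesis by (simp add: C_def e_def)
qed

text \<open>The \<open>p1\<close>-th power undoes the root, so the integrand is additive in the
  pieces even where their supports overlap.\<close>

lemma MM_combination_ge:
  fixes g :: "'i \<Rightarrow> 'a \<Rightarrow> real"
  assumes F: "finite F" and c: "\<And>i. i \<in> F \<Longrightarrow> 0 < c i"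
    and g [measurable]: "\<And>i. i \<in> F \<Longrightarrow> g i \<in> borel_measurable lebesgue"
  shows "(\<Sum>i\<in>F. ennreal (c i) * MM (g i) UNIV) \<le> MM (\<lambda>x. (\<Sum>i\<in>F. c i * \<bar>g i x\<bar> powr p1) powr (1 / p1)) UNIV"
proof -
  have "(\<Sum>i\<in>F. ennreal (c i) * MM (g i) UNIV) = (\<Sum>i\<in>F. \<integral>\<^sup>+x. ennreal (c i) * ennreal (\<bar>g i x\<bar> powr p1 * v1 x) \<partial>lebesgue)"
    unfolding wint_def by (intro sum.cong refl) (simp add: nn_integral_cmult)
  also have "\<dots> = (\<integral>\<^sup>+x. (\<Sum>i\<in>F. ennreal (c i) * ennreal (\<bar>g i x\<bar> powr p1 * v1 x)) \<partial>lebesgue)"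
    by (rule nn_integral_sum[symmetric]) measurable
  also have "\<dots> \<le> MM (\<lambda>x. (\<Sum>i\<in>F. c i * \<bar>g i x\<bar> powr p1) powr (1 / p1)) UNIV"
    unfolding wint_def
  proof (rule nn_integral_mono_AE)
    from v_pos show "AE x in lebesgue. (\<Sum>i\<in>F. ennreal (c i) * ennreal (\<bar>g i x\<bar> powr p1 * v1 x))
      \<le> ennreal (\<bar>(\<Sum>i\<in>F. c i * \<bar>g i x\<bar> powr p1) powr (1 / p1)\<bar> powr p1 * v1 x) * indicator UNIV x"
    proof eventually_elim
      case (elim x)
      have "0 \<le> (\<Sum>i\<in>F. c i * \<bar>g i x\<bar> powr p1)" using c by (intro sum_nonneg) (auto intro!: mult_nonneg_nonneg simp: less_imp_le)
      then have "\<bar>(\<Sum>i\<in>F. c i * \<bar>g i x\<bar> powr p1) powr (1 / p1)\<bar> powr p1 = (\<Sum>i\<in>F. c i * \<bar>g i x\<bar> powr p1)"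
        using p1_pos by (simp add: powr_powr)
      moreover have "(\<Sum>i\<in>F. ennreal (c i) * ennreal (\<bar>g i x\<bar> powr p1 * v1 x)) = (\<Sum>i\<in>F. ennreal (c i * \<bar>g i x\<bar> powr p1 * v1 x))"
        using c elim by (intro sum.cong refl) (auto simp: mult.assoc less_imp_le simp flip: ennreal_mult)
      moreover have "\<dots> = ennreal (\<Sum>i\<in>F. c i * \<bar>g i x\<bar> powr p1 * v1 x)"
        using c elim by (intro sum_ennreal) (auto intro!: mult_nonneg_nonneg simp: less_imp_le)
      ultimately show ?case by (simp add: sum_distrib_right)
    qed
  qed
  finally show ?thesis .
qed

end

context embedding
begin

lemma A_cover_pos: "0 < t \<Longrightarrow> \<exists>i. t \<in> A i"
  using A_cover[of t] S_finite[of t] by simp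

lemma inverse_S: "S t < top \<Longrightarrow> epowr (S t) (- 1) * S t = 1"
  using S_pos[of t] by (cases "S t") (auto simp: epowr_ennreal powr_minus simp flip: ennreal_mult)

text \<open>For infinite \<open>S t\<close> the left-hand side is 0. The case \<open>t = 0\<close>
  handles the second summand of (b).\<close>

lemma inverse_S_G_le_J:
  assumes "0 \<le> t" shows "epowr (S t) (- 1) * G t \<le> J"
proof (cases "S t = top")
  case True
  then show ?thesis by (simp add: epowr_def)
next
  case False
  then have "S t < top" by (simp add: top.not_eq_extremum)
  then have "epowr (S t) (- 1) * G t \<le> epowr (S t) (- 1) * (J * S t)"
    by (intro mult_left_mono G_le_J assms) auto
  also have "\<dots> = (epowr (S t) (- 1) * S t) * J" by (simp only: mult_ac)
  also have "\<dots> = J" using inverse_S[OF \<open>S t < top\<close>] by simp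
  finally show ?thesis .
qed

lemma lower_small_theta: "(SUP t\<in>{0<..}. epowr (S t) (- 1) * G t) \<le> J"
  by (intro SUP_least inverse_S_G_le_J) simp

section \<open>The lower bound for \<theta> above \<open>p1\<close>\<close>

definition Y :: "int \<Rightarrow> 'a set" where "Y i = {x. norm x \<in> D i}"

lemma Y_borel [measurable]: "Y i \<in> sets borel"
  unfolding Y_def by measurable

lemma Y_lebesgue: "Y i \<in> sets lebesgue"
  by simp

text \<open>A ball around the origin that meets \<open>Y i\<close> has its radius in
  \<open>D i\<close>, and over \<open>D i\<close> the weight has norm at most
  \<open>dy i\<close>.\<close>

lemma U_Y_le: "U (Y i) \<le> J * dy i"
proof (rule U_le_J[OF Y_lebesgue D_borel _ Lnorm_D_le])
  show "r \<in> D i" if "ball 0 r \<inter> Y i \<noteq> {}" for r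
  proof -
    obtain x :: 'a where "norm x \<in> D i" "norm x < r" using \<open>ball 0 r \<inter> Y i \<noteq> {}\<close> by (auto simp: Y_def)
    then show ?thesis using D_up[of "norm x" i r] by simp
  qed
qed simp

text \<open>For \<open>t\<close> in \<open>A i\<close> the complement of the ball lies in
  \<open>Y i\<close>, so \<open>G\<close> is at most \<open>U (Y i)\<close> on that level, whose
  Stieltjes measure is at most \<open>2 powr ((i + 1) * \<rho>)\<close>.\<close>

lemma integral_G_le:
  assumes \<rho>: "0 < \<rho>"
  shows "(\<integral>\<^sup>+t\<in>{0<..}. epowr (G t) \<rho> \<partial>ls_measure (h \<rho>))
    \<le> ennreal (2 powr \<rho>) * (\<Sum>n. epowr (dy (- int_decode n) * U (Y (int_decode n))) \<rho>)"
proof -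
  have [measurable]: "A i \<in> sets (ls_measure (h \<rho>))" for i by simp
  have "(\<integral>\<^sup>+t\<in>{0<..}. epowr (G t) \<rho> \<partial>ls_measure (h \<rho>))
     \<le> (\<integral>\<^sup>+t. (\<Sum>n. epowr (U (Y (int_decode n))) \<rho> * indicator (A (int_decode n)) t) \<partial>ls_measure (h \<rho>))"
  proof (rule nn_integral_mono)
    fix t
    show "epowr (G t) \<rho> * indicator {0<..} t \<le> (\<Sum>n. epowr (U (Y (int_decode n))) \<rho> * indicator (A (int_decode n)) t)"
    proof (cases "0 < t")
      case True
      then obtain i where i: "t \<in> A i" using A_cover_pos by blast
      have "- ball 0 t \<subseteq> Y i"
        using i A_subset_D[of i] by (auto simp: Y_def not_less intro: D_up)
      then have "G t \<le> U (Y i)" unfolding G_def by (intro U_mono) (auto simp: Y_lebesgue)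
      then have "epowr (G t) \<rho> \<le> (\<Sum>n\<in>{int_encode i}. epowr (U (Y (int_decode n))) \<rho> * indicator (A (int_decode n)) t)"
        using i \<rho> by (simp add: epowr_mono)
      also have "\<dots> \<le> (\<Sum>n. epowr (U (Y (int_decode n))) \<rho> * indicator (A (int_decode n)) t)"
        by (rule sum_le_suminf) auto
      finally show ?thesis using True by simp
    qed simp
  qed
  also have "\<dots> = (\<Sum>n. \<integral>\<^sup>+t. epowr (U (Y (int_decode n))) \<rho> * indicator (A (int_decode n)) t \<partial>ls_measure (h \<rho>))"
    by (rule nn_integral_suminf) measurable
  also have "\<dots> \<le> (\<Sum>n. ennreal (2 powr \<rho>) * epowr (dy (- int_decode n) * U (Y (int_decode n))) \<rho>)"
  proof (intro suminf_le summableI)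
    fix n
    define i where "i = int_decode n"
    have "(\<integral>\<^sup>+t. epowr (U (Y i)) \<rho> * indicator (A i) t \<partial>ls_measure (h \<rho>)) = epowr (U (Y i)) \<rho> * emeasure (ls_measure (h \<rho>)) (A i)"
      by (rule nn_integral_cmult_indicator) simp
    also have "\<dots> \<le> epowr (U (Y i)) \<rho> * ennreal (2 powr (real_of_int (i + 1) * \<rho>))"
      by (intro mult_left_mono emeasure_A_le \<rho>) auto
    also have "2 powr (real_of_int (i + 1) * \<rho>) = 2 powr \<rho> * (2 powr (real_of_int i)) powr \<rho>"
      by (simp add: powr_powr algebra_simps flip: powr_add)
    also have "epowr (U (Y i)) \<rho> * ennreal \<dots> = ennreal (2 powr \<rho>) * epowr (dy (- i) * U (Y i)) \<rho>"
      using \<rho> by (simp add: epowr_mult epowr_ennreal ennreal_mult mult_ac)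
    finally show "(\<integral>\<^sup>+t. epowr (U (Y i)) \<rho> * indicator (A i) t \<partial>ls_measure (h \<rho>)) \<le> ennreal (2 powr \<rho>) * epowr (dy (- i) * U (Y i)) \<rho>" .
  qed
  finally show ?thesis by simp
qed

text \<open>The first factor comes from \<open>sum_powr_le_geometric\<close> with
  \<open>a = p1 / 2\<close> and \<open>e = \<tau> / p1\<close>, the second from the geometric series
  with ratio \<open>2 powr (- (\<tau> / 2))\<close> in \<open>N_step_le\<close>.\<close>

definition Hardy_const :: real where
  "Hardy_const = (1 / (1 - 2 powr (- (p1 / 2)))) powr (\<tau> / p1) * (1 / (1 - 2 powr (- (\<tau> / 2))))"

text \<open>A discrete Hardy inequality. On \<open>A k\<close> only indices \<open>i \<le> k\<close>
  enter the bound for \<open>\<phi>\<close>. They are separated at the cost of a factor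
  \<open>2 powr ((k - i) * (\<tau> / 2))\<close>, which uses up half of the decay in
  \<open>k - i\<close> of the bound for the weight over \<open>D k\<close>, so a convergent
  geometric series remains.\<close>

lemma N_step_le:
  assumes \<theta>: "\<theta> \<noteq> top" and F: "finite F" and c: "\<And>i. i \<in> F \<Longrightarrow> 0 < c i"
    and \<phi>: "\<And>r. \<phi> f r \<le> ennreal ((\<Sum>i\<in>{i\<in>F. r \<in> D i}. c i) powr (1 / p1))"
  shows "epowr (N f) \<tau> \<le> ennreal (Hardy_const * (\<Sum>i\<in>F. 2 powr (- (real_of_int i * \<tau>)) * c i powr (\<tau> / p1)))"
proof -
  note \<tau> = \<tau>_pos[OF \<theta>]
  define K where "K = (1 / (1 - 2 powr (- (p1 / 2)))) powr (\<tau> / p1)"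
  \<comment> \<open>\<open>H i\<close> majorises this cost on all levels at once: for
    \<open>r\<close> in \<open>A k\<close> with \<open>i \<le> k\<close> the term
    \<open>n = k - i\<close> alone suffices.\<close>
  define H where "H = (\<lambda>i r. \<Sum>n. ennreal (2 powr (real n * (\<tau> / 2))) * indicator (D (i + int n)) r)"
  have [measurable]: "D j \<in> sets lebesgue" for j by simp
  have H_meas [measurable]: "H i \<in> borel_measurable lebesgue" for i unfolding H_def by measurable
  have lt: "2 powr (- (\<tau> / 2)) < 1" using powr_less_mono[of "- (\<tau> / 2)" 0 2] \<tau> by simp
  have "epowr (w r * \<phi> f r) \<tau> \<le> (\<Sum>i\<in>F. ennreal (K * c i powr (\<tau> / p1)) * (epowr (w r) \<tau> * H i r))" for r
  proof (cases "0 < r")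
    case False
    then show ?thesis using \<tau> by (simp add: w_def)
  next
    case True
    then obtain k where k: "r \<in> A k" using A_cover_pos by blast
    define F' where "F' = {i\<in>F. r \<in> D i}"
    have F': "finite F'" "F' \<subseteq> F" using F by (auto simp: F'_def)
    have le: "i \<le> k" if "i \<in> F'" for i
      using that k D_antimono[of "k + 1" i] by (force simp: F'_def A_def)
    have "epowr (\<phi> f r) \<tau> \<le> epowr (ennreal ((\<Sum>i\<in>F'. c i) powr (1 / p1))) \<tau>"
      using \<phi>[of r] \<tau> unfolding F'_def by (intro epowr_mono) auto
    also have "\<dots> = ennreal ((\<Sum>i\<in>F'. c i) powr (\<tau> / p1))"
      using \<tau> by (simp add: epowr_ennreal_nonneg powr_powr)
    also have "\<dots> \<le> ennreal (K * (\<Sum>i\<in>F'. (2 powr (real_of_int (k - i) * (p1 / 2)) * c i) powr (\<tau> / p1)))"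
      unfolding K_def using F' le c p1_pos \<tau>
      by (intro ennreal_leI sum_powr_le_geometric) (auto intro: less_imp_le)
    also have "\<dots> = (\<Sum>i\<in>F'. ennreal (K * c i powr (\<tau> / p1)) * ennreal (2 powr (real_of_int (k - i) * (\<tau> / 2))))"
    proof -
      have "K * (\<Sum>i\<in>F'. (2 powr (real_of_int (k - i) * (p1 / 2)) * c i) powr (\<tau> / p1))
        = (\<Sum>i\<in>F'. K * c i powr (\<tau> / p1) * 2 powr (real_of_int (k - i) * (\<tau> / 2)))"
        unfolding sum_distrib_left using p1_pos
        by (intro sum.cong refl) (simp add: powr_mult powr_powr mult_ac)
      also have "ennreal \<dots> = (\<Sum>i\<in>F'. ennreal (K * c i powr (\<tau> / p1) * 2 powr (real_of_int (k - i) * (\<tau> / 2))))"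
        by (intro sum_ennreal[symmetric]) (simp add: K_def)
      also have "\<dots> = (\<Sum>i\<in>F'. ennreal (K * c i powr (\<tau> / p1)) * ennreal (2 powr (real_of_int (k - i) * (\<tau> / 2))))"
        by (intro sum.cong refl ennreal_mult) (simp_all add: K_def)
      finally show ?thesis .
    qed
    also have "\<dots> \<le> (\<Sum>i\<in>F'. ennreal (K * c i powr (\<tau> / p1)) * H i r)"
    proof (intro sum_mono mult_left_mono)
      fix i assume i: "i \<in> F'"
      define n where "n = nat (k - i)"
      have n: "i + int n = k" "real n = real_of_int (k - i)" using le[OF i] by (auto simp: n_def)
      have "ennreal (2 powr (real_of_int (k - i) * (\<tau> / 2))) = (\<Sum>n\<in>{n}. ennreal (2 powr (real n * (\<tau> / 2))) * indicator (D (i + int n)) r)"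
      proof -
        have "r \<in> D (i + int n)" unfolding n(1) using k A_subset_D by blast
        then show ?thesis by (simp add: n(2))
      qed
      also have "\<dots> \<le> H i r" unfolding H_def by (rule sum_le_suminf) auto
      finally show "ennreal (2 powr (real_of_int (k - i) * (\<tau> / 2))) \<le> H i r" .
    qed simp
    also have "\<dots> \<le> (\<Sum>i\<in>F. ennreal (K * c i powr (\<tau> / p1)) * H i r)"
      using F F' by (intro sum_mono2) auto
    finally have "epowr (w r) \<tau> * epowr (\<phi> f r) \<tau> \<le> epowr (w r) \<tau> * (\<Sum>i\<in>F. ennreal (K * c i powr (\<tau> / p1)) * H i r)"
      by (rule mult_left_mono) simp
    then show ?thesis using \<tau> by (simp add: epowr_mult sum_distrib_left mult_ac)
  qed
  then have "epowr (N f) \<tau> \<le> (\<integral>\<^sup>+r. (\<Sum>i\<in>F. ennreal (K * c i powr (\<tau> / p1)) * (epowr (w r) \<tau> * H i r)) \<partial>lebesgue)"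
    unfolding epowr_N[OF \<theta>] by (rule nn_integral_mono)
  also have "\<dots> = (\<Sum>i\<in>F. \<integral>\<^sup>+r. ennreal (K * c i powr (\<tau> / p1)) * (epowr (w r) \<tau> * H i r) \<partial>lebesgue)"
    by (rule nn_integral_sum) measurable
  also have "\<dots> = (\<Sum>i\<in>F. ennreal (K * c i powr (\<tau> / p1)) * (\<integral>\<^sup>+r. epowr (w r) \<tau> * H i r \<partial>lebesgue))"
    by (intro sum.cong refl nn_integral_cmult) measurable
  also have "\<dots> \<le> (\<Sum>i\<in>F. ennreal (K * c i powr (\<tau> / p1)) * ennreal (2 powr (- (real_of_int i * \<tau>)) * (1 / (1 - 2 powr (- (\<tau> / 2))))))"
  proof (intro sum_mono mult_left_mono)
    fix i
    have "(\<integral>\<^sup>+r. epowr (w r) \<tau> * H i r \<partial>lebesgue)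
      = (\<integral>\<^sup>+r. (\<Sum>n. ennreal (2 powr (real n * (\<tau> / 2))) * (epowr (w r) \<tau> * indicator (D (i + int n)) r)) \<partial>lebesgue)"
      unfolding H_def ennreal_suminf_cmult[symmetric] by (simp only: mult_ac)
    also have "\<dots> = (\<Sum>n. \<integral>\<^sup>+r. ennreal (2 powr (real n * (\<tau> / 2))) * (epowr (w r) \<tau> * indicator (D (i + int n)) r) \<partial>lebesgue)"
      by (rule nn_integral_suminf) measurable
    also have "\<dots> \<le> (\<Sum>n. ennreal (2 powr (- (real_of_int i * \<tau>)) * (2 powr (- (\<tau> / 2))) ^ n))"
    proof (intro suminf_le summableI)
      fix n
      have "(\<integral>\<^sup>+r. ennreal (2 powr (real n * (\<tau> / 2))) * (epowr (w r) \<tau> * indicator (D (i + int n)) r) \<partial>lebesgue)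
        = ennreal (2 powr (real n * (\<tau> / 2))) * (\<integral>\<^sup>+r\<in>D (i + int n). epowr (w r) \<tau> \<partial>lebesgue)"
        by (rule nn_integral_cmult) measurable
      also have "\<dots> \<le> ennreal (2 powr (real n * (\<tau> / 2))) * epowr (dy (i + int n)) \<tau>"
        using Lnorm_D_le[of "i + int n"] \<theta> \<tau> epowr_le_swap[of "1 / \<tau>"]
        by (intro mult_left_mono) (simp_all add: Lnorm_def)
      also have "\<dots> = ennreal (2 powr (real n * (\<tau> / 2)) * 2 powr (- real_of_int (i + int n) * \<tau>))"
        by (simp add: epowr_ennreal powr_powr ennreal_mult)
      also have "2 powr (real n * (\<tau> / 2)) * 2 powr (- real_of_int (i + int n) * \<tau>) = 2 powr (- (real_of_int i * \<tau>)) * (2 powr (- (\<tau> / 2))) ^ n"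
        by (simp add: powr_powr algebra_simps flip: powr_add powr_realpow)
      finally show "(\<integral>\<^sup>+r. ennreal (2 powr (real n * (\<tau> / 2))) * (epowr (w r) \<tau> * indicator (D (i + int n)) r) \<partial>lebesgue)
        \<le> ennreal (2 powr (- (real_of_int i * \<tau>)) * (2 powr (- (\<tau> / 2))) ^ n)" .
    qed
    also have "\<dots> = ennreal (2 powr (- (real_of_int i * \<tau>)) * (1 / (1 - 2 powr (- (\<tau> / 2)))))"
      using lt by (intro suminf_ennreal_eq sums_mult geometric_sums) auto
    finally show "(\<integral>\<^sup>+r. epowr (w r) \<tau> * H i r \<partial>lebesgue) \<le> ennreal (2 powr (- (real_of_int i * \<tau>)) * (1 / (1 - 2 powr (- (\<tau> / 2)))))" .
  qed simp
  also have "\<dots> = (\<Sum>i\<in>F. ennreal (Hardy_const * (2 powr (- (real_of_int i * \<tau>)) * c i powr (\<tau> / p1))))"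
    using lt by (intro sum.cong refl) (simp add: Hardy_const_def K_def mult_ac flip: ennreal_mult)
  also have "\<dots> = ennreal (\<Sum>i\<in>F. Hardy_const * (2 powr (- (real_of_int i * \<tau>)) * c i powr (\<tau> / p1)))"
    using lt by (intro sum_ennreal) (auto simp: Hardy_const_def)
  finally show ?thesis by (simp add: sum_distrib_left)
qed

text \<open>On \<open>A k\<close> the sum is dominated by a geometric series with largest term
  \<open>2 powr (k * p1)\<close>, so \<open>\<phi> f r\<close> is at most a constant times
  \<open>2 powr k\<close>, while \<open>w\<close> is almost everywhere at most \<open>dy k\<close>
  there.\<close>

lemma N_step_le_top:
  assumes \<theta>: "\<theta> = top" and F: "finite F"
    and \<phi>: "\<And>r. \<phi> f r \<le> ennreal ((\<Sum>i\<in>{i\<in>F. r \<in> D i}. 2 powr (real_of_int i * p1)) powr (1 / p1))"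
  shows "N f \<le> ennreal ((1 / (1 - 2 powr (- p1))) powr (1 / p1))"
proof -
  have [measurable]: "D j \<in> sets lebesgue" for j by simp
  have lt: "2 powr (- p1) < 1" using powr_less_mono[of "- p1" 0 2] p1_pos by simp
  have "AE r in lebesgue. w r * indicator (D i) r \<le> dy i" for i
  proof -
    have "esssup lebesgue (\<lambda>r. w r * indicator (D i) r) \<le> dy i"
      using Lnorm_D_le[of i] \<theta> by (simp add: Lnorm_def)
    then show ?thesis using esssup_AE[of "\<lambda>r. w r * indicator (D i) r" lebesgue] by (auto elim: eventually_mono)
  qed
  \<comment> \<open>The integers are countable, so one null set serves all levels.\<close>
  then have "AE r in lebesgue. \<forall>i. w r * indicator (D i) r \<le> dy i"
    unfolding AE_all_countable by blast
  then have "AE r in lebesgue. w r * \<phi> f r * indicator {0<..} r \<le> ennreal ((1 / (1 - 2 powr (- p1))) powr (1 / p1))"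
  proof eventually_elim
    case (elim r)
    show ?case
    proof (cases "0 < r")
      case True
      then obtain k where k: "r \<in> A k" using A_cover_pos by blast
      define F' where "F' = {i\<in>F. r \<in> D i}"
      have F': "finite F'" using F by (auto simp: F'_def)
      have le: "i \<le> k" if "i \<in> F'" for i
        using that k D_antimono[of "k + 1" i] by (force simp: F'_def A_def)
      have "(\<Sum>i\<in>F'. 2 powr (real_of_int i * p1)) = 2 powr (real_of_int k * p1) * (\<Sum>i\<in>F'. 2 powr (- (real_of_int (k - i) * p1)))"
        unfolding sum_distrib_left by (intro sum.cong refl) (simp add: algebra_simps flip: powr_add)
      also have "\<dots> \<le> 2 powr (real_of_int k * p1) * (1 / (1 - 2 powr (- p1)))"
        by (intro mult_left_mono sum_geometric_le F' le p1_pos) auto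
      finally have "(\<Sum>i\<in>F'. 2 powr (real_of_int i * p1)) powr (1 / p1) \<le> (2 powr (real_of_int k * p1) * (1 / (1 - 2 powr (- p1)))) powr (1 / p1)"
        using p1_pos by (intro powr_mono2 sum_nonneg) auto
      also have "\<dots> = 2 powr real_of_int k * (1 / (1 - 2 powr (- p1))) powr (1 / p1)"
        using p1_pos by (simp only: powr_mult powr_powr) simp
      finally have "\<phi> f r \<le> ennreal (2 powr real_of_int k * (1 / (1 - 2 powr (- p1))) powr (1 / p1))"
        using \<phi>[of r] unfolding F'_def by (meson ennreal_leI order_trans)
      moreover have "w r \<le> dy k" using elim[rule_format, of k] k A_subset_D[of k] by (auto simp: indicator_def)
      ultimately have "w r * \<phi> f r \<le> dy k * ennreal (2 powr real_of_int k * (1 / (1 - 2 powr (- p1))) powr (1 / p1))"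
        by (intro mult_mono) auto
      also have "\<dots> = ennreal ((1 / (1 - 2 powr (- p1))) powr (1 / p1))"
        by (simp add: powr_minus flip: ennreal_mult)
      finally show ?thesis using True by simp
    qed simp
  qed
  then show ?thesis unfolding N_eq Lnorm_def using \<theta> by (auto intro!: esssup_I)
qed

text \<open>Collects the constants arising in \<open>level_sum_le\<close>; it depends only on
  \<open>p1\<close>, \<open>\<theta>\<close> and \<open>\<rho>\<close>.\<close>

definition level_sum_const :: "real \<Rightarrow> real" where
  "level_sum_const \<rho> = (if \<theta> = top then 2 * (1 / (1 - 2 powr (- p1))) else (2 powr (1 / p1) * Hardy_const powr (1 / \<tau>)) powr \<rho>)"

lemma level_sum_const_pos: "0 < level_sum_const \<rho>"
proof -
  have *: "2 powr (- x) < (1::real)" if "0 < x" for x using powr_less_mono[of "- x" 0 2] that by simp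
  have "0 < Hardy_const" if "\<theta> \<noteq> top"
    unfolding Hardy_const_def using *[of "p1 / 2"] *[of "\<tau> / 2"] p1_pos \<tau>_pos[OF that]
    by (intro mult_pos_pos) auto
  then show ?thesis using *[OF p1_pos] by (auto simp: level_sum_const_def)
qed

text \<open>With \<open>T\<close> the left-hand sum, the test function \<open>f\<close> has
  \<open>MM f UNIV\<close> at least \<open>T / 2\<close>. For finite \<open>\<theta>\<close> the
  \<open>\<tau>\<close>-th power of \<open>N f\<close> is at most a multiple of \<open>T\<close>, so
  \<open>T powr (1 / p1)\<close> is at most a multiple of \<open>J * T powr (1 / \<tau>)\<close>;
  finiteness of \<open>I\<close> and \<open>J\<close> makes \<open>T\<close> a real number that can
  be cancelled. For infinite \<open>\<theta>\<close> the norm \<open>N f\<close> is bounded by a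
  constant.\<close>

lemma level_sum_le:
  assumes \<rho>: "0 < \<rho>" and top: "\<theta> = top \<Longrightarrow> \<rho> = p1" and conj: "\<theta> \<noteq> top \<Longrightarrow> p1 / \<tau> + p1 / \<rho> = 1"
    and fin: "finite I"
  shows "(\<Sum>i\<in>I. epowr (dy (- i) * U (Y i)) \<rho>) \<le> ennreal (level_sum_const \<rho>) * epowr J \<rho>"
proof (cases "J = top")
  case True
  then show ?thesis using \<rho> level_sum_const_pos[of \<rho>] by (simp add: ennreal_mult_top)
next
  case False
  then obtain j where j: "J = ennreal j" "0 \<le> j" by (cases J) auto
  define \<gamma> where "\<gamma> i = enn2real (U (Y i))" for i
  have \<gamma>: "U (Y i) = ennreal (\<gamma> i)" "0 \<le> \<gamma> i" for i
  proof -
    have "U (Y i) < top" using U_Y_le[of i] False by (auto intro: le_less_trans simp: ennreal_mult_less_top top.not_eq_extremum)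
    then show "U (Y i) = ennreal (\<gamma> i)" by (simp add: \<gamma>_def)
  qed (simp add: \<gamma>_def)
  \<comment> \<open>Levels with \<open>\<gamma> i = 0\<close> contribute nothing; dropping them
    keeps all coefficients \<open>c i\<close> positive.\<close>
  define F where "F = {i \<in> I. 0 < \<gamma> i}"
  have F: "finite F" using fin by (simp add: F_def)
  define T where "T = (\<Sum>i\<in>F. 2 powr (real_of_int i * \<rho>) * \<gamma> i powr \<rho>)"
  have sum_eq: "(\<Sum>i\<in>I. epowr (dy (- i) * U (Y i)) \<rho>) = ennreal T"
  proof -
    have "(\<Sum>i\<in>I. epowr (dy (- i) * U (Y i)) \<rho>) = (\<Sum>i\<in>F. epowr (dy (- i) * U (Y i)) \<rho>)"
      using fin \<rho> \<gamma> by (intro sum.mono_neutral_right) (auto simp: F_def not_less ennreal_neg)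
    also have "\<dots> = (\<Sum>i\<in>F. ennreal (2 powr (real_of_int i * \<rho>) * \<gamma> i powr \<rho>))"
      using \<rho> \<gamma>(2) by (intro sum.cong refl) (simp add: \<gamma>(1) epowr_ennreal_nonneg powr_mult powr_powr flip: ennreal_mult)
    finally show ?thesis by (simp add: T_def)
  qed
  show ?thesis
  proof (cases "F = {}")
    case True
    then show ?thesis unfolding sum_eq by (simp add: T_def)
  next
    case ne: False
    have T: "0 < T" unfolding T_def using F ne by (intro sum_pos) (auto simp: F_def)
    \<comment> \<open>equality case of Hoelder's inequality between \<open>c i * \<gamma> i powr p1\<close> and \<open>2 powr (- i * \<theta>) * c i powr (\<theta> / p1)\<close>\<close>
    define c where "c i = 2 powr (real_of_int i * \<rho>) * \<gamma> i powr (\<rho> - p1)" for i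
    have c: "0 < c i" if "i \<in> F" for i using that by (simp add: c_def F_def)
    have "\<exists>g. g \<in> borel_measurable lebesgue \<and> (\<forall>x. x \<notin> Y i \<longrightarrow> g x = 0) \<and> II g UNIV \<le> 1 \<and> ennreal (\<gamma> i powr p1 / 2) < MM g UNIV"
      if "i \<in> F" for i
    proof -
      \<comment> \<open>Halving leaves the strict gap that \<open>MM_sharp\<close> requires.\<close>
      have "ennreal (\<gamma> i powr p1 / 2) < epowr (U (Y i)) p1"
        using that p1_pos by (simp add: \<gamma>(1) F_def epowr_ennreal ennreal_less_iff)
      from MM_sharp[OF Y_lebesgue this] show ?thesis by blast
    qed
    then obtain g where g: "\<And>i. i \<in> F \<Longrightarrow> g i \<in> borel_measurable lebesgue" "\<And>i x. i \<in> F \<Longrightarrow> x \<notin> Y i \<Longrightarrow> g i x = 0"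
      "\<And>i. i \<in> F \<Longrightarrow> II (g i) UNIV \<le> 1" "\<And>i. i \<in> F \<Longrightarrow> ennreal (\<gamma> i powr p1 / 2) < MM (g i) UNIV"
      by metis
    note g(1)[measurable]
    define f where "f x = (\<Sum>i\<in>F. c i * \<bar>g i x\<bar> powr p1) powr (1 / p1)" for x
    have f: "f \<in> borel_measurable lebesgue" unfolding f_def by measurable
    have "II f UNIV \<le> ennreal ((\<Sum>i\<in>F. c i) powr (p2 / p1))"
      using F c g by (intro II_combination_le) (auto simp: f_def)
    then have II: "II f UNIV < top" by (rule le_less_trans) simp
    have \<phi>: "\<phi> f r \<le> ennreal ((\<Sum>i\<in>{i\<in>F. r \<in> D i}. c i) powr (1 / p1))" for r
    proof -
      have "II f (ball 0 r) \<le> ennreal ((\<Sum>i\<in>{i\<in>F. r \<in> D i}. c i) powr (p2 / p1))"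
      proof (rule II_combination_le)
        fix x :: 'a assume x: "x \<in> ball 0 r"
        \<comment> \<open>\<open>g i\<close> is supported in \<open>Y i\<close>, which meets the
          ball of radius \<open>r\<close> only if \<open>r\<close> is in \<open>D i\<close>.\<close>
        have "g i x = 0" if "i \<in> F" "r \<notin> D i" for i
          using that x g(2)[of i x] D_up[of "norm x" i r] by (auto simp: Y_def)
        then show "f x = (\<Sum>i\<in>{i\<in>F. r \<in> D i}. c i * \<bar>g i x\<bar> powr p1) powr (1 / p1)"
          unfolding f_def using F p1_pos by (intro arg_cong2[where f="(powr)"] sum.mono_neutral_right) auto
      qed (use F c g in auto)
      then have "\<phi> f r \<le> epowr (ennreal ((\<Sum>i\<in>{i\<in>F. r \<in> D i}. c i) powr (p2 / p1))) (1 / p2)"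
        unfolding \<phi>_def using p2_pos by (intro epowr_mono) auto
      then show ?thesis using p2_pos by (simp add: epowr_ennreal_nonneg powr_powr)
    qed
    have "ennreal (T / 2) = (\<Sum>i\<in>F. ennreal (c i) * ennreal (\<gamma> i powr p1 / 2))"
    proof -
      have "T / 2 = (\<Sum>i\<in>F. c i * (\<gamma> i powr p1 / 2))"
        unfolding T_def sum_divide_distrib c_def by (intro sum.cong refl) (simp add: mult.assoc flip: powr_add)
      also have "ennreal \<dots> = (\<Sum>i\<in>F. ennreal (c i * (\<gamma> i powr p1 / 2)))"
        using c by (intro sum_ennreal[symmetric]) (auto simp: less_imp_le)
      also have "\<dots> = (\<Sum>i\<in>F. ennreal (c i) * ennreal (\<gamma> i powr p1 / 2))"
        using c by (intro sum.cong refl ennreal_mult) (auto simp: less_imp_le)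
      finally show ?thesis .
    qed
    also have "\<dots> \<le> (\<Sum>i\<in>F. ennreal (c i) * MM (g i) UNIV)"
      using g(4) by (intro sum_mono mult_left_mono) (auto simp: less_imp_le)
    also have "\<dots> \<le> MM f UNIV"
      unfolding f_def using F c g(1) by (rule MM_combination_ge)
    finally have MM: "ennreal (T / 2) \<le> MM f UNIV" .
    have le: "ennreal ((T / 2) powr (1 / p1)) \<le> J * ennreal B" if "N f \<le> ennreal B" for B
    proof -
      have "ennreal ((T / 2) powr (1 / p1)) = epowr (ennreal (T / 2)) (1 / p1)" using T by (simp add: epowr_ennreal)
      also have "\<dots> \<le> epowr (MM f UNIV) (1 / p1)" using MM p1_pos by (intro epowr_mono) auto
      also have "\<dots> \<le> J * ennreal B" using that by (intro le_J[OF f II]) auto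
      finally show ?thesis .
    qed
    have "T \<le> level_sum_const \<rho> * j powr \<rho>"
    proof (cases "\<theta> = top")
      case True
      define b where "b = 1 / (1 - 2 powr (- p1))"
      have b: "0 < b" using powr_less_mono[of "- p1" 0 2] p1_pos by (simp add: b_def)
      \<comment> \<open>Here \<open>\<rho> = p1\<close>, so the power of \<open>\<gamma> i\<close>
        in \<open>c i\<close> has exponent 0.\<close>
      have "c i = 2 powr (real_of_int i * p1)" if "i \<in> F" for i
        using that top[OF True] by (simp add: c_def F_def)
      then have "(\<Sum>i\<in>{i\<in>F. r \<in> D i}. c i) = (\<Sum>i\<in>{i\<in>F. r \<in> D i}. 2 powr (real_of_int i * p1))" for r
        by (intro sum.cong) auto
      with \<phi> have "N f \<le> ennreal (b powr (1 / p1))"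
        unfolding b_def by (intro N_step_le_top[OF True F]) simp
      from le[OF this] have "(T / 2) powr (1 / p1) \<le> j * b powr (1 / p1)"
        using j b by (simp flip: ennreal_mult)
      then have "((T / 2) powr (1 / p1)) powr p1 \<le> (j * b powr (1 / p1)) powr p1"
        using p1_pos by (intro powr_mono2) auto
      then have "T \<le> 2 * b * j powr p1" using T b p1_pos j(2)
        by (simp add: powr_powr powr_mult mult_ac)
      moreover have "level_sum_const \<rho> = 2 * b" unfolding level_sum_const_def b_def if_P[OF True] ..
      ultimately show ?thesis unfolding top[OF True] by simp
    next
      case False
      note \<tau> = \<tau>_pos[OF False]
      \<comment> \<open>All three restate \<open>1 / \<rho> = 1 / p1 - 1 / \<tau>\<close>. The first
        two make the sum in \<open>N_step_le\<close> equal to \<open>T\<close>, the third merges the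
        two powers of \<open>T\<close> after division.\<close>
      have rt: "\<rho> * \<tau> / p1 - \<tau> = \<rho>" "(\<rho> - p1) * (\<tau> / p1) = \<rho>" "1 / p1 - 1 / \<tau> = 1 / \<rho>"
        using conj[OF False] \<rho> \<tau> p1_pos by (simp_all add: field_simps)
      have "2 powr (- (real_of_int i * \<tau>)) * c i powr (\<tau> / p1) = 2 powr (real_of_int i * \<rho>) * \<gamma> i powr \<rho>" for i
      proof -
        have "2 powr (- (real_of_int i * \<tau>)) * c i powr (\<tau> / p1)
           = (2 powr (- (real_of_int i * \<tau>)) * 2 powr (real_of_int i * \<rho> * (\<tau> / p1))) * \<gamma> i powr ((\<rho> - p1) * (\<tau> / p1))"
          by (simp only: c_def powr_mult powr_powr mult.assoc)
        also have "2 powr (- (real_of_int i * \<tau>)) * 2 powr (real_of_int i * \<rho> * (\<tau> / p1)) = (2::real) powr (real_of_int i * (\<rho> * \<tau> / p1 - \<tau>))"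
          by (simp add: algebra_simps flip: powr_add)
        finally show ?thesis unfolding rt .
      qed
      then have "epowr (N f) \<tau> \<le> ennreal (Hardy_const * T)"
        using N_step_le[OF False F c \<phi>] by (simp add: T_def)
      then have "N f \<le> epowr (ennreal (Hardy_const * T)) (1 / \<tau>)" using \<tau> by (simp add: epowr_le_swap)
      moreover have H: "0 \<le> Hardy_const"
        unfolding Hardy_const_def using powr_less_mono[of "- (\<tau> / 2)" 0 2] \<tau> by (intro mult_nonneg_nonneg) auto
      ultimately have "N f \<le> ennreal ((Hardy_const * T) powr (1 / \<tau>))"
        using \<tau> T by (simp add: epowr_ennreal_nonneg)
      from le[OF this] have "(T / 2) powr (1 / p1) \<le> j * (Hardy_const * T) powr (1 / \<tau>)"
        using j by (simp flip: ennreal_mult)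
      then have "T powr (1 / p1) \<le> (2 powr (1 / p1) * Hardy_const powr (1 / \<tau>)) * j * T powr (1 / \<tau>)"
        using T H by (simp add: powr_divide powr_mult field_simps)
      \<comment> \<open>\<open>T\<close> is a positive real, being a nonempty finite sum of positive
        terms, so its power may be divided out.\<close>
      then have "T powr (1 / p1) / T powr (1 / \<tau>) \<le> (2 powr (1 / p1) * Hardy_const powr (1 / \<tau>)) * j"
        using T by (simp add: divide_le_eq)
      then have "T powr (1 / \<rho>) \<le> (2 powr (1 / p1) * Hardy_const powr (1 / \<tau>)) * j"
        by (simp only: rt flip: powr_diff)
      then have "(T powr (1 / \<rho>)) powr \<rho> \<le> ((2 powr (1 / p1) * Hardy_const powr (1 / \<tau>)) * j) powr \<rho>"
        using \<rho> by (intro powr_mono2) auto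
      then show ?thesis using T \<rho> j(2) False by (simp add: powr_powr powr_mult level_sum_const_def)
    qed
    then have "ennreal T \<le> ennreal (level_sum_const \<rho> * j powr \<rho>)" by (rule ennreal_leI)
    also have "\<dots> = ennreal (level_sum_const \<rho>) * epowr J \<rho>"
      using j \<rho> level_sum_const_pos[of \<rho>] by (simp add: epowr_ennreal_nonneg ennreal_mult)
    finally show ?thesis unfolding sum_eq .
  qed
qed

text \<open>\<open>integral_G_le\<close> and \<open>level_sum_le\<close> bound the integral by
  \<open>C\<close> times the \<open>\<rho>\<close>-th power of \<open>J\<close>, and
  \<open>inverse_S_G_le_J\<close> at 0 bounds the second summand by \<open>J\<close>; hence the
  constant \<open>C powr (1 / \<rho>) + 1\<close>.\<close>

lemma lower_large_theta:
  assumes \<rho>: "0 < \<rho>" and top: "\<theta> = top \<Longrightarrow> \<rho> = p1" and conj: "\<theta> \<noteq> top \<Longrightarrow> p1 / \<tau> + p1 / \<rho> = 1"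
  shows "ennreal (1 / ((2 powr \<rho> * level_sum_const \<rho>) powr (1 / \<rho>) + 1)) * Rhs \<rho> \<le> J"
proof -
  define C where "C = 2 powr \<rho> * level_sum_const \<rho>"
  have C: "0 < C" using level_sum_const_pos by (simp add: C_def)
  have "(\<Sum>n. epowr (dy (- int_decode n) * U (Y (int_decode n))) \<rho>) \<le> ennreal (level_sum_const \<rho>) * epowr J \<rho>"
  \<comment> \<open>Partial sums run over finite sets of levels, and the bound in
    \<open>level_sum_le\<close> is uniform in the set.\<close>
  proof (intro suminf_le_const summableI)
    fix m
    have "(\<Sum>n<m. epowr (dy (- int_decode n) * U (Y (int_decode n))) \<rho>) = (\<Sum>i\<in>int_decode ` {..<m}. epowr (dy (- i) * U (Y i)) \<rho>)"
      by (subst sum.reindex) (auto simp: inj_int_decode)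
    also have "\<dots> \<le> ennreal (level_sum_const \<rho>) * epowr J \<rho>"
      by (intro level_sum_le \<rho> top conj) auto
    finally show "(\<Sum>n<m. epowr (dy (- int_decode n) * U (Y (int_decode n))) \<rho>) \<le> ennreal (level_sum_const \<rho>) * epowr J \<rho>" .
  qed
  then have "ennreal (2 powr \<rho>) * (\<Sum>n. epowr (dy (- int_decode n) * U (Y (int_decode n))) \<rho>) \<le> ennreal C * epowr J \<rho>"
    using level_sum_const_pos[of \<rho>] mult_left_mono[of _ _ "ennreal (2 powr \<rho>)"] by (simp add: C_def ennreal_mult mult.assoc)
  with integral_G_le[OF \<rho>] have "(\<integral>\<^sup>+t\<in>{0<..}. epowr (G t) \<rho> \<partial>ls_measure (h \<rho>)) \<le> ennreal C * epowr J \<rho>"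
    by (rule order_trans)
  then have "epowr (\<integral>\<^sup>+t\<in>{0<..}. epowr (G t) \<rho> \<partial>ls_measure (h \<rho>)) (1 / \<rho>) \<le> epowr (ennreal C * epowr J \<rho>) (1 / \<rho>)"
    using \<rho> by (intro epowr_mono) auto
  also have "\<dots> = ennreal (C powr (1 / \<rho>)) * J" using \<rho> C by (simp add: epowr_mult epowr_ennreal)
  finally have "Rhs \<rho> \<le> ennreal (C powr (1 / \<rho>)) * J + J"
    unfolding Rhs_def using inverse_S_G_le_J[of 0] by (intro add_mono) (simp_all add: G_0)
  also have "\<dots> = ennreal (C powr (1 / \<rho>) + 1) * J" by (simp add: distrib_right)
  finally have "ennreal (1 / (C powr (1 / \<rho>) + 1)) * Rhs \<rho> \<le> ennreal (1 / (C powr (1 / \<rho>) + 1)) * (ennreal (C powr (1 / \<rho>) + 1) * J)"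
    by (rule mult_left_mono) simp
  also have "\<dots> = ennreal ((1 / (C powr (1 / \<rho>) + 1)) * (C powr (1 / \<rho>) + 1)) * J"
    by (subst ennreal_mult) (simp_all add: mult.assoc)
  also have "(1 / (C powr (1 / \<rho>) + 1)) * (C powr (1 / \<rho>) + 1) = 1"
    using powr_ge_zero[of C "1 / \<rho>"] by (simp add: add_nonneg_eq_0_iff)
  finally show ?thesis by (simp add: C_def)
qed

end

section \<open>Two-sided estimates with constants independent of \<omega>\<close>

theorem theorem4p1:
  fixes p1 p2 :: real and \<theta> :: ennreal and v1 v2 :: "'a::euclidean_space \<Rightarrow> real"
  assumes "0 < p1" and "p1 \<le> p2" and "0 < \<theta>"
    and "v1 \<in> Wclass" and "v2 \<in> Wclass"
  defines "s \<equiv> (if p1 = p2 then top else ennreal (p1 * p2 / (p2 - p1)))"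
    and "u \<equiv> (\<lambda>x. v1 x powr (1 / p1) * v2 x powr (- 1 / p2))"
    and "\<rho> \<equiv> (if \<theta> = top then p1 else p1 * enn2real \<theta> / (enn2real \<theta> - p1))"
  shows
    "(\<theta> \<le> ennreal p1 \<longrightarrow>
       (\<exists>c C. c > 0 \<and> C > 0 \<and> (\<forall>\<omega> \<in> Omega \<theta>.
          ennreal c * (SUP t \<in> {0<..}. epowr (Lnorm lebesgue \<theta> {t<..} (\<lambda>r. ennreal (\<omega> r))) (- 1)
                         * wnorm lebesgue s (- ball 0 t) (\<lambda>_. 1) u)
            \<le> embnorm (ennreal p2) \<theta> (ennreal p1) \<omega> v2 v1 \<and>
          embnorm (ennreal p2) \<theta> (ennreal p1) \<omega> v2 v1
            \<le> ennreal C * (SUP t \<in> {0<..}. epowr (Lnorm lebesgue \<theta> {t<..} (\<lambda>r. ennreal (\<omega> r))) (- 1)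
                         * wnorm lebesgue s (- ball 0 t) (\<lambda>_. 1) u))))
   \<and> (ennreal p1 < \<theta> \<longrightarrow>
       (\<exists>c C. c > 0 \<and> C > 0 \<and> (\<forall>\<omega> \<in> Omega \<theta>.
          ennreal c * (epowr (\<integral>\<^sup>+ t \<in> {0<..}. epowr (wnorm lebesgue s (- ball 0 t) (\<lambda>_. 1) u) \<rho>
                                 \<partial>ls_measure (hfun \<theta> \<rho> \<omega>)) (1 / \<rho>)
                       + epowr (Lnorm lebesgue \<theta> {0<..} (\<lambda>r. ennreal (\<omega> r))) (- 1)
                         * wnorm lebesgue s UNIV (\<lambda>_. 1) u)
            \<le> embnorm (ennreal p2) \<theta> (ennreal p1) \<omega> v2 v1 \<and>
          embnorm (ennreal p2) \<theta> (ennreal p1) \<omega> v2 v1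
            \<le> ennreal C * (epowr (\<integral>\<^sup>+ t \<in> {0<..}. epowr (wnorm lebesgue s (- ball 0 t) (\<lambda>_. 1) u) \<rho>
                                 \<partial>ls_measure (hfun \<theta> \<rho> \<omega>)) (1 / \<rho>)
                       + epowr (Lnorm lebesgue \<theta> {0<..} (\<lambda>r. ennreal (\<omega> r))) (- 1)
                         * wnorm lebesgue s UNIV (\<lambda>_. 1) u))))"
proof (intro conjI impI)
  have emb: "embedding p1 p2 v1 v2 \<theta> \<omega>" if "\<omega> \<in> Omega \<theta>" for \<omega>
    using assms(1-5) that by unfold_locales
  have U_eq: "wnorm lebesgue s Z (\<lambda>_. 1) u = weight_pair.U p1 p2 v1 v2 Z" for Z
  proof -
    interpret weight_pair p1 p2 v1 v2 using assms(1-5) by unfold_locales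
    show ?thesis unfolding U_def s_def u_def assms(6,7) ..
  qed
  {
    assume le: "\<theta> \<le> ennreal p1"
    define C where "C = (2 * level_const (enn2real \<theta>)) powr (1 / enn2real \<theta>)"
    have "\<theta> \<noteq> top" using le by (auto simp: top_unique)
    with assms(3) have "0 < C"
      using level_const_pos[of "enn2real \<theta>"] by (simp add: C_def enn2real_positive_iff top.not_eq_extremum)
    show "\<exists>c C. c > 0 \<and> C > 0 \<and> (\<forall>\<omega> \<in> Omega \<theta>.
          ennreal c * (SUP t \<in> {0<..}. epowr (Lnorm lebesgue \<theta> {t<..} (\<lambda>r. ennreal (\<omega> r))) (- 1)
                         * wnorm lebesgue s (- ball 0 t) (\<lambda>_. 1) u)
            \<le> embnorm (ennreal p2) \<theta> (ennreal p1) \<omega> v2 v1 \<and>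
          embnorm (ennreal p2) \<theta> (ennreal p1) \<omega> v2 v1
            \<le> ennreal C * (SUP t \<in> {0<..}. epowr (Lnorm lebesgue \<theta> {t<..} (\<lambda>r. ennreal (\<omega> r))) (- 1)
                         * wnorm lebesgue s (- ball 0 t) (\<lambda>_. 1) u))"
    \<comment> \<open>The lower bound in (a) holds with constant 1.\<close>
    proof (rule exI[of _ 1], rule exI[of _ C], intro conjI ballI)
      fix \<omega> assume "\<omega> \<in> Omega \<theta>"
      then interpret embedding p1 p2 v1 v2 \<theta> \<omega> by (rule emb)
      have *: "(SUP t\<in>{0<..}. epowr (Lnorm lebesgue \<theta> {t<..} (\<lambda>r. ennreal (\<omega> r))) (- 1) * wnorm lebesgue s (- ball 0 t) (\<lambda>_. 1) u)
         = (SUP t\<in>{0<..}. epowr (S t) (- 1) * G t)"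
        by (intro SUP_cong refl) (simp add: S_nonneg G_def U_eq)
      show "ennreal 1 * (SUP t \<in> {0<..}. epowr (Lnorm lebesgue \<theta> {t<..} (\<lambda>r. ennreal (\<omega> r))) (- 1)
                         * wnorm lebesgue s (- ball 0 t) (\<lambda>_. 1) u)
            \<le> embnorm (ennreal p2) \<theta> (ennreal p1) \<omega> v2 v1"
        unfolding * using lower_small_theta by (simp add: J_def)
      show "embnorm (ennreal p2) \<theta> (ennreal p1) \<omega> v2 v1
            \<le> ennreal C * (SUP t \<in> {0<..}. epowr (Lnorm lebesgue \<theta> {t<..} (\<lambda>r. ennreal (\<omega> r))) (- 1)
                         * wnorm lebesgue s (- ball 0 t) (\<lambda>_. 1) u)"
        unfolding * C_def using upper_small_theta[OF le] by (simp add: J_def)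
    qed (use \<open>0 < C\<close> in auto)
  }
  {
    assume less: "ennreal p1 < \<theta>"
    have \<tau>: "p1 < enn2real \<theta>" if "\<theta> \<noteq> top"
      using less that assms(1) by (cases \<theta>) (auto simp: ennreal_less_iff)
    have \<rho>: "0 < \<rho>" using assms(1) \<tau> by (cases "\<theta> = top") (auto simp: assms(8))
    have top: "\<theta> = top \<Longrightarrow> \<rho> = p1" by (simp add: assms(8))
    have conj: "p1 / enn2real \<theta> + p1 / \<rho> = 1" if "\<theta> \<noteq> top"
      using that \<tau>[OF that] assms(1) by (simp add: assms(8) field_simps)
    define C where "C = (if \<theta> = top then 2 else (2 * level_const (enn2real \<theta>)) powr (1 / enn2real \<theta>)) * (4 * jump_const \<rho>) powr (1 / \<rho>)"
    have "0 < C"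
      using level_const_pos[of "enn2real \<theta>"] jump_const_pos[of \<rho>] \<tau> assms(1)
      by (cases "\<theta> = top") (force simp: C_def)+
    \<comment> \<open>Outside the locale \<open>level_sum_const\<close> takes only
      \<open>p1\<close>, \<open>\<theta>\<close> and \<open>\<rho>\<close> as arguments, so
      \<open>c\<close> is fixed before \<open>\<omega>\<close> is chosen.\<close>
    define c where "c = 1 / ((2 powr \<rho> * embedding.level_sum_const p1 \<theta> \<rho>) powr (1 / \<rho>) + 1)"
    have "0 < c" unfolding c_def by (intro divide_pos_pos add_nonneg_pos) auto
    show "\<exists>c C. c > 0 \<and> C > 0 \<and> (\<forall>\<omega> \<in> Omega \<theta>.
          ennreal c * (epowr (\<integral>\<^sup>+ t \<in> {0<..}. epowr (wnorm lebesgue s (- ball 0 t) (\<lambda>_. 1) u) \<rho>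
                                 \<partial>ls_measure (hfun \<theta> \<rho> \<omega>)) (1 / \<rho>)
                       + epowr (Lnorm lebesgue \<theta> {0<..} (\<lambda>r. ennreal (\<omega> r))) (- 1)
                         * wnorm lebesgue s UNIV (\<lambda>_. 1) u)
            \<le> embnorm (ennreal p2) \<theta> (ennreal p1) \<omega> v2 v1 \<and>
          embnorm (ennreal p2) \<theta> (ennreal p1) \<omega> v2 v1
            \<le> ennreal C * (epowr (\<integral>\<^sup>+ t \<in> {0<..}. epowr (wnorm lebesgue s (- ball 0 t) (\<lambda>_. 1) u) \<rho>
                                 \<partial>ls_measure (hfun \<theta> \<rho> \<omega>)) (1 / \<rho>)
                       + epowr (Lnorm lebesgue \<theta> {0<..} (\<lambda>r. ennreal (\<omega> r))) (- 1)
                         * wnorm lebesgue s UNIV (\<lambda>_. 1) u))"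
    proof (rule exI[of _ c], rule exI[of _ C], intro conjI ballI)
      fix \<omega> assume "\<omega> \<in> Omega \<theta>"
      then interpret embedding p1 p2 v1 v2 \<theta> \<omega> by (rule emb)
      have *: "epowr (\<integral>\<^sup>+ t \<in> {0<..}. epowr (wnorm lebesgue s (- ball 0 t) (\<lambda>_. 1) u) \<rho> \<partial>ls_measure (hfun \<theta> \<rho> \<omega>)) (1 / \<rho>)
                       + epowr (Lnorm lebesgue \<theta> {0<..} (\<lambda>r. ennreal (\<omega> r))) (- 1) * wnorm lebesgue s UNIV (\<lambda>_. 1) u = Rhs \<rho>"
        by (simp add: Rhs_def S_nonneg G_def U_eq h_def[OF \<rho>])
      show "ennreal c * (epowr (\<integral>\<^sup>+ t \<in> {0<..}. epowr (wnorm lebesgue s (- ball 0 t) (\<lambda>_. 1) u) \<rho>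
                                 \<partial>ls_measure (hfun \<theta> \<rho> \<omega>)) (1 / \<rho>)
                       + epowr (Lnorm lebesgue \<theta> {0<..} (\<lambda>r. ennreal (\<omega> r))) (- 1)
                         * wnorm lebesgue s UNIV (\<lambda>_. 1) u)
            \<le> embnorm (ennreal p2) \<theta> (ennreal p1) \<omega> v2 v1"
        unfolding * c_def using lower_large_theta[OF \<rho> top conj] by (simp add: J_def)
      show "embnorm (ennreal p2) \<theta> (ennreal p1) \<omega> v2 v1
            \<le> ennreal C * (epowr (\<integral>\<^sup>+ t \<in> {0<..}. epowr (wnorm lebesgue s (- ball 0 t) (\<lambda>_. 1) u) \<rho>
                                 \<partial>ls_measure (hfun \<theta> \<rho> \<omega>)) (1 / \<rho>)
                       + epowr (Lnorm lebesgue \<theta> {0<..} (\<lambda>r. ennreal (\<omega> r))) (- 1)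
                         * wnorm lebesgue s UNIV (\<lambda>_. 1) u)"
        unfolding * C_def using upper_large_theta[OF \<rho> top conj] by (simp add: J_def)
    qed (use \<open>0 < C\<close> \<open>0 < c\<close> in auto)
  }
qed

end
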